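(* Let $s\ge1$ be an integer, $R,\bar\alpha>0$, and assume $A\mathrm e^{-A}\lesssim\Delta^2$ as well as $\Delta\big(\|(\delta_j)_j\|_{l^2}^2+\|(x_j\delta_j)_j\|_{l^2}^2\big)\lesssim\|\delta\|_{l^\infty}^2$. Let $\hat\gamma$ be an estimator of $\gamma$ satisfying $\sup_{\mathcal P}\mathbb E_{\mathcal P}[|\hat\gamma-\gamma|^2]<\infty$, the supremum being over $\mathcal P=(\gamma,k)\in\mathcal H_s(R,\bar\alpha)$. Choosing the cut-off value $U=U_{\bar\alpha}:=\varepsilon^{-2/(2s+2T\bar\alpha+5)}$ in the estimator $\hat k_e$ (with trimming function $\kappa=\kappa_{\bar\alpha}$), we obtain for its risk the uniform convergence rate $$\sup_{\mathcal P=(\gamma,k)\in\mathcal H_s(R,\bar\alpha)}\mathbb E_{\mathcal P}\big[\|\hat k_e-k_e\|_{L^2}^2\big]^{1/2}\lesssim\varepsilon^{2s/(2s+2T\bar\alpha+5)}.$$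
   Context: **Model.** Fix a maturity $T>0$. A pair $\mathcal P=(\gamma,k)$, with $\gamma\in\mathbb R$ and $k:\mathbb R\to[0,\infty)$ of bounded variation, determines a Lévy process $X$ with triplet $(0,\gamma,k(x)/|x|)$ (no Gaussian part, Lévy density $k(x)/|x|$), so that $\varphi_T(u)=\mathbb E[\mathrm e^{\mathrm iuX_T}]=\exp(T(\mathrm i\gamma u+\int(\mathrm e^{\mathrm iux}-1)\frac{k(x)}{|x|}\mathrm dx))$. The martingale condition is $\gamma+\int(\mathrm e^x-1)\frac{k(x)}{|x|}\mathrm dx=0$ (equivalently $\mathbb E[\mathrm e^{X_t}]=1$ for all $t\geq 0$). Put $\alpha:=k(0+)+k(0-)$, $k_e(x):=\operatorname{sgn}(x)\mathrm e^xk(x)$, $\|k\|_{\mathrm{TV}}$ the total variation of $k$ on $\mathbb R$. **Classes.** $\mathcal G_0(R,\bar\alpha)$: all $(\gamma,k)$ with $k$ of bounded variation, the martingale condition, $\mathbb E[\mathrm e^{2X_T}]\le R$, $\alpha\in[0,\bar\alpha]$ and $\max\{\sup_{x\in(0,1]}\frac{k(x)+k(-x)-\alpha}{x},\|k_e\|_{L^1},\|k\|_{\mathrm{TV}}\}\le R$. $\mathcal H_s(R,\bar\alpha)$: all $(\gamma,k)\in\mathcal G_0(R,\bar\alpha)$ with in addition $k\in C^s(\mathbb R\setminus\{0\})$, $\mathbb E_{\mathcal P}[|X_T\mathrm e^{X_T}|]\le R$, $|\gamma|\le R$ and $\|k_e^{(l)}\|_{L^2}\le R$ for $l=0,\dots,s$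 (derivatives on $\mathbb R\setminus\{0\}$). **Observations.** The option function is $\mathcal O(x)=\mathbb E[(\mathrm e^{X_T}-\mathrm e^x)_+]$ for $x\ge0$ and $\mathcal O(x)=\mathbb E[(\mathrm e^x-\mathrm e^{X_T})_+]$ for $x<0$. One observes $O_j=\mathcal O(x_j)+\delta_j\varepsilon_j$, $j=1,\dots,N$, at deterministic points $x_1<\dots<x_N$, with known noise levels $\delta_j>0$ and independent centered $\varepsilon_j$ with $\mathbb E[\varepsilon_j^2]=1$, $\sup_j\mathbb E[\varepsilon_j^4]<\infty$. Set $\delta=(\delta_j)_j$, $\Delta:=\max_{j=2,\dots,N}(x_j-x_{j-1})$, $A:=\min(x_N,-x_1)$ and $\varepsilon:=\Delta^{3/2}+\Delta^{1/2}\|\delta\|_{l^\infty}$. Asymptotics: $\Delta\to0$, $A\to\infty$, $\varepsilon\to0$. $a\lesssim b$ means $a\le Cb$ with a constant $C$ not depending on the asymptotic parameters nor on $\mathcal P$ ($s,R,\bar\alpha,T$, the bound on $\sup_j\mathbb E[\varepsilon_j^4]$ and the kernel being fixed). **Interpolation.** $\tilde{\mathcal O}(x)=\beta_0(x)+\sum_{j=1}^NO_jb_j(x)$, where $b_j(x)=\frac{x-x_{j-1}}{x_j-x_{j-1}}\mathbf 1_{[x_{j-1},x_j)}(x)+\frac{x_{j+1}-x}{x_{j+1}-x_j}\mathbf 1_{[x_j,x_{j+1}]}(x)$, with auxiliary nodes $x_0<x_1$, $x_{N+1}>x_N$ at distance at most $\Delta$ from $x_1$, resp. $x_N$. With $j_0$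 such that $x_{j_0-1}<0\le x_{j_0}$, $\beta_0$ is the continuous function supported in $[x_{j_0-1},x_{j_0}]$, linear on $[x_{j_0-1},0]$ and on $[0,x_{j_0}]$, with $\beta_0'(0+)-\beta_0'(0-)=-1$ ($\beta_0=0$ if $x_{j_0}=0$). The Fourier transform is $\mathcal Ff(u)=\int\mathrm e^{\mathrm iux}f(x)\mathrm dx$. **Empirical derivative.** For $\kappa>0$, $v_\kappa(z)=z$ if $|z|\ge\kappa$ and $v_\kappa(z)=\kappa z/|z|$ if $0<|z|<\kappa$. Set $$\tilde\psi'(u):=\frac1T\,\frac{(\mathrm i-2u)\mathcal F\tilde{\mathcal O}(u)-(u+\mathrm iu^2)\mathcal F(x\tilde{\mathcal O}(x))(u)}{v_{\kappa(u)}\big(1+\mathrm iu(1+\mathrm iu)\mathcal F\tilde{\mathcal O}(u)\big)},\quad u\in\mathbb R.$$ The trimming function is $\kappa=\kappa_{\bar\alpha}$ with $\kappa_{\bar\alpha}(u)=\frac13\mathrm e^{-TR}$ for $|u|<1$ and $\kappa_{\bar\alpha}(u)=\frac13C_\varphi(T,R)|u|^{-T\bar\alpha}$ for $|u|\ge1$, where $C_\varphi(T,R)>0$ is a constant depending only on $T,R$ such that $|\varphi_T(u-\mathrm i)|\ge C_\varphi(T,R)|u|^{-T\bar\alpha}$ for all $|u|\ge1$ and all $\mathcal P\in\mathcal G_0(R,\bar\alpha)$ (such a constant exists); then $\frac13|\varphi_T(u-\mathrm i)|\ge\kappa(u)$ for all $u$. **Estimator.** $\hat k_e(x):=\mathcal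 F^{-1}\big[(-\hat\gamma-\mathrm i\tilde\psi'(u))\,\mathcal FW_k(u/U)\big](x)$ for $x>0$ and $\hat k_e(x):=\mathcal F^{-1}\big[(-\hat\gamma-\mathrm i\tilde\psi'(u))\,\mathcal FW_k(-u/U)\big](x)$ for $x<0$, where $\mathcal FW_k(\pm u/U)$ denotes $\mathcal FW_k$ evaluated at $\pm u/U$. The kernel $W_k$ is real, has Sobolev smoothness $T\bar\alpha+2$, i.e. $\int(1+|u|^2)^{T\bar\alpha+2}|\mathcal FW_k(u/U)|^2\mathrm du<\infty$, has support in $(-\infty,0]$, and satisfies $\int W_k(x)\mathrm dx=1$, $\int x^lW_k(x)\mathrm dx=0$ for $l=1,\dots,s-1$, and $x^{2s-1}W_k(x)\in L^1(\mathbb R)$. *)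

theory Defs
  imports "HOL-Probability.Probability"
begin

section \<open>Norms, Fourier transform, smoothness off the origin\<close>

definition esqrt :: "ennreal \<Rightarrow> ennreal" where
  "esqrt a = (if a = \<infinity> then \<infinity> else ennreal (sqrt (enn2real a)))"

definition L1norm :: "(real \<Rightarrow> 'b::real_normed_vector) \<Rightarrow> ennreal" where
  "L1norm f = (\<integral>\<^sup>+ x. ennreal (norm (f x)) \<partial>lborel)"

definition L2norm :: "(real \<Rightarrow> 'b::real_normed_vector) \<Rightarrow> ennreal" where
  "L2norm f = esqrt (\<integral>\<^sup>+ x. ennreal ((norm (f x))\<^sup>2) \<partial>lborel)"

definition total_variation :: "(real \<Rightarrow> real) \<Rightarrow> ennreal" where
  "total_variation f =
     Sup {ennreal (\<Sum>i<n. \<bar>f (t (Suc i)) - f (t i)\<bar>) | (n::nat) (t::nat \<Rightarrow> real).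
            \<forall>i<n. t i \<le> t (Suc i)}"

definition fourier :: "(real \<Rightarrow> complex) \<Rightarrow> real \<Rightarrow> complex" where
  "fourier f u = (CLINT x|lborel. exp (\<i> * of_real (u * x)) * f x)"

definition inv_fourier :: "(real \<Rightarrow> complex) \<Rightarrow> real \<Rightarrow> complex" where
  "inv_fourier g x = (CLINT u|lborel. exp (- \<i> * of_real (u * x)) * g u) / of_real (2 * pi)"

definition Cs_off_zero :: "nat \<Rightarrow> (real \<Rightarrow> real) \<Rightarrow> bool" where
  "Cs_off_zero s f \<longleftrightarrow>
     (\<forall>l<s. \<forall>x. x \<noteq> 0 \<longrightarrow> (deriv ^^ l) f differentiable (at x)) \<and>
     continuous_on (- {0}) ((deriv ^^ s) f)"


section \<open>The exponential Levy model\<close>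

definition levy_process :: "'p measure \<Rightarrow> (real \<Rightarrow> 'p \<Rightarrow> real) \<Rightarrow> bool" where
  "levy_process M X \<longleftrightarrow>
     prob_space M \<and>
     (\<forall>t\<ge>0. X t \<in> borel_measurable M) \<and>
     (AE \<omega> in M. X 0 \<omega> = 0) \<and>
     (\<forall>(n::nat) t. 0 \<le> t 0 \<and> (\<forall>i<n. t i \<le> t (Suc i)) \<longrightarrow>
        prob_space.indep_vars M (\<lambda>_. borel) (\<lambda>i \<omega>. X (t (Suc i)) \<omega> - X (t i) \<omega>) {..<n}) \<and>
     (\<forall>t\<ge>0. \<forall>h\<ge>0. distr M borel (\<lambda>\<omega>. X (t + h) \<omega> - X t \<omega>) = distr M borel (X h)) \<and>
     (AE \<omega> in M. \<forall>t\<ge>0. ((\<lambda>r. X r \<omega>) \<longlongrightarrow> X t \<omega>) (at_right t) \<and>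
        (t > 0 \<longrightarrow> (\<exists>l. ((\<lambda>r. X r \<omega>) \<longlongrightarrow> l) (at_left t))))"

text \<open>The triplet is \<open>(0, \<gamma>, k(x)/|x|)\<close>, without truncation function in the exponent. The
  integrability conjunct is the Levy measure condition for a bounded \<open>k\<close>; it keeps the integral
  in the exponent meaningful.\<close>

definition has_levy_triplet ::
    "'p measure \<Rightarrow> (real \<Rightarrow> 'p \<Rightarrow> real) \<Rightarrow> real \<Rightarrow> (real \<Rightarrow> real) \<Rightarrow> bool" where
  "has_levy_triplet M X \<gamma> k \<longleftrightarrow>
     integrable lborel (\<lambda>x. min 1 \<bar>x\<bar> * (k x / \<bar>x\<bar>)) \<and>
     (\<forall>t\<ge>0. \<forall>u. char (distr M borel (X t)) u =
        exp (of_real t * (\<i> * of_real (\<gamma> * u) +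
          (CLINT x|lborel. (exp (\<i> * of_real (u * x)) - 1) * of_real (k x / \<bar>x\<bar>)))))"

text \<open>The existential conjunct restricts nothing beyond the Levy measure condition: a process exists
  for every such pair, and the path space type \<^typ>\<open>real \<Rightarrow> real\<close> is large enough to carry it.\<close>

definition levy_pair :: "real \<times> (real \<Rightarrow> real) \<Rightarrow> bool" where
  "levy_pair = (\<lambda>(\<gamma>, k).
     (\<forall>x. 0 \<le> k x) \<and> total_variation k < \<infinity> \<and>
     (\<exists>(M :: (real \<Rightarrow> real) measure) X. levy_process M X \<and> has_levy_triplet M X \<gamma> k))"

definition levy_law :: "real \<Rightarrow> real \<times> (real \<Rightarrow> real) \<Rightarrow> real measure" where
  "levy_law T = (\<lambda>(\<gamma>, k). THE \<mu>. \<exists>(M :: (real \<Rightarrow> real) measure) X.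
     levy_process M X \<and> has_levy_triplet M X \<gamma> k \<and> \<mu> = distr M borel (X T))"

lemma levy_law_eq:
  fixes M :: "(real \<Rightarrow> real) measure"
  assumes "T \<ge> 0" "levy_process M X" "has_levy_triplet M X \<gamma> k"
  shows "levy_law T (\<gamma>, k) = distr M borel (X T)"
proof -
  have rd: "real_distribution (distr N borel (Y T))"
    if "levy_process N Y" for N :: "(real \<Rightarrow> real) measure" and Y
  proof -
    have "prob_space N" "Y T \<in> borel_measurable N"
      using that assms(1) by (auto simp: levy_process_def)
    then show ?thesis
      by (auto intro!: prob_space.real_distribution_distr)
  qed
  show ?thesis
    unfolding levy_law_def prod.case
  proof (rule the_equality)
    show "\<exists>(N :: (real \<Rightarrow> real) measure) Y. levy_process N Y \<and> has_levy_triplet N Y \<gamma> k \<and>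
            distr M borel (X T) = distr N borel (Y T)"
      using assms by blast
  next
    fix \<mu>
    assume "\<exists>(N :: (real \<Rightarrow> real) measure) Y. levy_process N Y \<and> has_levy_triplet N Y \<gamma> k \<and>
              \<mu> = distr N borel (Y T)"
    then obtain N :: "(real \<Rightarrow> real) measure" and Y where
      N: "levy_process N Y" "has_levy_triplet N Y \<gamma> k" and \<mu>: "\<mu> = distr N borel (Y T)"
      by blast
    have "char (distr N borel (Y T)) = char (distr M borel (X T))"
      using N(2) assms(1,3) by (auto simp: has_levy_triplet_def fun_eq_iff)
    then show "\<mu> = distr M borel (X T)"
      unfolding \<mu> by (intro Levy_uniqueness rd N(1) assms(2))
  qed
qed

definition martingale_condition :: "real \<Rightarrow> (real \<Rightarrow> real) \<Rightarrow> bool" where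
  "martingale_condition \<gamma> k \<longleftrightarrow>
     integrable lborel (\<lambda>x. (exp x - 1) * (k x / \<bar>x\<bar>)) \<and>
     \<gamma> + (LINT x|lborel. (exp x - 1) * (k x / \<bar>x\<bar>)) = 0"

definition jump_activity :: "(real \<Rightarrow> real) \<Rightarrow> real" where
  "jump_activity k = Lim (at_right 0) k + Lim (at_left 0) k"

definition k_exp :: "(real \<Rightarrow> real) \<Rightarrow> real \<Rightarrow> real" where
  "k_exp k x = sgn x * exp x * k x"

definition class_G0 :: "real \<Rightarrow> real \<Rightarrow> real \<Rightarrow> (real \<times> (real \<Rightarrow> real)) set" where
  "class_G0 T R \<alpha>max = {(\<gamma>, k).
     levy_pair (\<gamma>, k) \<and> martingale_condition \<gamma> k \<and>
     (\<integral>\<^sup>+ y. ennreal (exp (2 * y)) \<partial>levy_law T (\<gamma>, k)) \<le> ennreal R \<and>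
     jump_activity k \<in> {0..\<alpha>max} \<and>
     (\<forall>x\<in>{0<..1}. (k x + k (- x) - jump_activity k) / x \<le> R) \<and>
     L1norm (k_exp k) \<le> ennreal R \<and>
     total_variation k \<le> ennreal R}"

text \<open>The value of \<open>(deriv ^^ l) (k_exp k)\<close> at \<open>0\<close> is arbitrary and does not affect its
  \<open>L\<^sup>2\<close> norm.\<close>

definition class_H :: "real \<Rightarrow> nat \<Rightarrow> real \<Rightarrow> real \<Rightarrow> (real \<times> (real \<Rightarrow> real)) set" where
  "class_H T s R \<alpha>max = {(\<gamma>, k).
     (\<gamma>, k) \<in> class_G0 T R \<alpha>max \<and> Cs_off_zero s k \<and>
     (\<integral>\<^sup>+ y. ennreal \<bar>y * exp y\<bar> \<partial>levy_law T (\<gamma>, k)) \<le> ennreal R \<and>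
     \<bar>\<gamma>\<bar> \<le> R \<and>
     (\<forall>l\<le>s. L2norm ((deriv ^^ l) (k_exp k)) \<le> ennreal R)}"

text \<open>\<open>\<phi>\<^sub>T(z) = E[exp (i z X\<^sub>T)]\<close> for complex \<open>z\<close>.\<close>

definition char_ext :: "real \<Rightarrow> real \<times> (real \<Rightarrow> real) \<Rightarrow> complex \<Rightarrow> complex" where
  "char_ext T P z = (CLINT y|levy_law T P. exp (\<i> * z * of_real y))"

definition option_fun :: "real \<Rightarrow> real \<times> (real \<Rightarrow> real) \<Rightarrow> real \<Rightarrow> real" where
  "option_fun T P x =
     (if x \<ge> 0 then (LINT y|levy_law T P. max 0 (exp y - exp x))
      else (LINT y|levy_law T P. max 0 (exp x - exp y)))"


section \<open>Design and observations\<close>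

definition mesh :: "nat \<Rightarrow> (nat \<Rightarrow> real) \<Rightarrow> real" where
  "mesh N x = Max ((\<lambda>j. x j - x (j - 1)) ` {2..N})"

definition design_range :: "nat \<Rightarrow> (nat \<Rightarrow> real) \<Rightarrow> real" where
  "design_range N x = min (x N) (- x 1)"

definition linf :: "nat \<Rightarrow> (nat \<Rightarrow> real) \<Rightarrow> real" where
  "linf N \<delta> = Max ((\<lambda>j. \<bar>\<delta> j\<bar>) ` {1..N})"

definition l2 :: "nat \<Rightarrow> (nat \<Rightarrow> real) \<Rightarrow> real" where
  "l2 N \<delta> = sqrt (\<Sum>j=1..N. (\<delta> j)\<^sup>2)"

definition noise_level :: "nat \<Rightarrow> (nat \<Rightarrow> real) \<Rightarrow> (nat \<Rightarrow> real) \<Rightarrow> real" where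
  "noise_level N x \<delta> = mesh N x powr (3/2) + mesh N x powr (1/2) * linf N \<delta>"

text \<open>\<open>x 1, \<dots>, x N\<close> are the observation points, \<open>x 0\<close> and \<open>x (N + 1)\<close> the auxiliary nodes.\<close>

definition design :: "nat \<Rightarrow> (nat \<Rightarrow> real) \<Rightarrow> (nat \<Rightarrow> real) \<Rightarrow> bool" where
  "design N x \<delta> \<longleftrightarrow>
     2 \<le> N \<and> (\<forall>j\<le>N. x j < x (Suc j)) \<and>
     x 1 - x 0 \<le> mesh N x \<and> x (Suc N) - x N \<le> mesh N x \<and>
     (\<forall>j\<in>{1..N}. 0 < \<delta> j)"

definition noise :: "'a measure \<Rightarrow> nat \<Rightarrow> (nat \<Rightarrow> 'a \<Rightarrow> real) \<Rightarrow> real \<Rightarrow> bool" where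
  "noise M N e B \<longleftrightarrow>
     prob_space M \<and> prob_space.indep_vars M (\<lambda>_. borel) e {1..N} \<and>
     (\<forall>j\<in>{1..N}. integrable M (\<lambda>\<omega>. (e j \<omega>) ^ 4) \<and> (LINT \<omega>|M. (e j \<omega>) ^ 4) \<le> B \<and>
        (LINT \<omega>|M. e j \<omega>) = 0 \<and> (LINT \<omega>|M. (e j \<omega>)\<^sup>2) = 1)"

definition observations :: "real \<Rightarrow> real \<times> (real \<Rightarrow> real) \<Rightarrow> nat \<Rightarrow> (nat \<Rightarrow> real) \<Rightarrow>
    (nat \<Rightarrow> real) \<Rightarrow> (nat \<Rightarrow> 'a \<Rightarrow> real) \<Rightarrow> 'a \<Rightarrow> nat \<Rightarrow> real" where
  "observations T P N x \<delta> e \<omega> = (\<lambda>j\<in>{1..N}. option_fun T P (x j) + \<delta> j * e j \<omega>)"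


section \<open>Interpolation of the option function\<close>

definition hat_fun :: "(nat \<Rightarrow> real) \<Rightarrow> nat \<Rightarrow> real \<Rightarrow> real" where
  "hat_fun x j y =
     (y - x (j - 1)) / (x j - x (j - 1)) * indicator {x (j - 1)..<x j} y +
     (x (j + 1) - y) / (x (j + 1) - x j) * indicator {x j..x (j + 1)} y"

definition j_zero :: "nat \<Rightarrow> (nat \<Rightarrow> real) \<Rightarrow> nat" where
  "j_zero N x = (THE j. j \<in> {1..N} \<and> x (j - 1) < 0 \<and> 0 \<le> x j)"

text \<open>\<open>kink a b\<close> is supported in \<open>[a, b]\<close>, where \<open>a < 0 \<le> b\<close>; the height \<open>- a * b / (b - a)\<close> at
  \<open>0\<close> is the one for which the slope drops by \<open>1\<close> there, see \<open>kink_props\<close>.\<close>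

definition kink :: "real \<Rightarrow> real \<Rightarrow> real \<Rightarrow> real" where
  "kink a b y =
     (if a \<le> y \<and> y \<le> 0 then b * (y - a) / (b - a)
      else if 0 < y \<and> y \<le> b then - a * (b - y) / (b - a)
      else 0)"

lemma kink_props:
  assumes "a < 0" "0 < b"
  shows "continuous_on UNIV (kink a b)"
    and "\<And>y. y \<notin> {a..b} \<Longrightarrow> kink a b y = 0"
    and "\<exists>c p q. (\<forall>y\<in>{a..0}. kink a b y = c + p * y) \<and> (\<forall>y\<in>{0..b}. kink a b y = c + q * y) \<and>
           q - p = -1"
proof -
  have ba: "0 < b - a"
    using assms by simp
  have eq: "kink a b y = max 0 (min (b * (y - a)) (- a * (b - y))) / (b - a)" for y
  proof -
    have diff: "- a * (b - y) - b * (y - a) = - (b - a) * y"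
      by (simp add: algebra_simps)
    consider "y < a" | "a \<le> y" "y \<le> 0" | "0 < y" "y \<le> b" | "b < y"
      by linarith
    then show ?thesis
    proof cases
      case 1
      then have "b * (y - a) \<le> 0"
        using assms by (intro mult_nonneg_nonpos) auto
      then show ?thesis
        using 1 assms by (simp add: kink_def max_def min_def)
    next
      case 2
      have "0 \<le> - (b - a) * y"
        using 2 ba by (intro mult_nonpos_nonpos) auto
      then have "b * (y - a) \<le> - a * (b - y)"
        using diff by linarith
      moreover have "0 \<le> b * (y - a)"
        using 2 assms by (intro mult_nonneg_nonneg) auto
      ultimately show ?thesis
        using 2 by (simp only: kink_def max_def min_def) simp
    next
      case 3
      have "- (b - a) * y \<le> 0"
        using 3 ba by (intro mult_nonpos_nonneg) auto
      then have "min (b * (y - a)) (- a * (b - y)) = - a * (b - y)"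
        using diff by (intro min_absorb2) linarith
      moreover have "0 \<le> - a * (b - y)"
        using 3 assms by (intro mult_nonneg_nonneg) auto
      ultimately show ?thesis
        using 3 by (simp only: kink_def max_def) simp
    next
      case 4
      then have "- a * (b - y) \<le> 0"
        using assms by (intro mult_nonneg_nonpos) auto
      then have "min (b * (y - a)) (- a * (b - y)) \<le> 0"
        by (rule min.coboundedI2)
      then show ?thesis
        using 4 assms by (simp only: kink_def max_absorb1) simp
    qed
  qed
  have eq': "kink a b = (\<lambda>y. max 0 (min (b * (y - a)) (- a * (b - y))) / (b - a))"
    using eq by (rule ext)
  show "continuous_on UNIV (kink a b)"
    using assms unfolding eq' by (intro continuous_intros) auto
  show "\<And>y. y \<notin> {a..b} \<Longrightarrow> kink a b y = 0"
    using assms by (auto simp: kink_def)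
  show "\<exists>c p q. (\<forall>y\<in>{a..0}. kink a b y = c + p * y) \<and> (\<forall>y\<in>{0..b}. kink a b y = c + q * y) \<and>
          q - p = -1"
  proof (intro exI conjI ballI)
    fix y assume "y \<in> {a..0}"
    then show "kink a b y = - a * b / (b - a) + b / (b - a) * y"
      by (simp add: kink_def algebra_simps flip: add_divide_distrib diff_divide_distrib)
  next
    fix y assume "y \<in> {0..b}"
    then show "kink a b y = - a * b / (b - a) + a / (b - a) * y"
      using assms
      by (auto simp: kink_def algebra_simps simp flip: add_divide_distrib diff_divide_distrib)
  next
    show "a / (b - a) - b / (b - a) = -1"
      using ba by (simp add: field_simps flip: diff_divide_distrib)
  qed
qed

lemma kink_zero: "kink a 0 y = 0"
  by (simp add: kink_def)

definition interpolant :: "nat \<Rightarrow> (nat \<Rightarrow> real) \<Rightarrow> (nat \<Rightarrow> real) \<Rightarrow> real \<Rightarrow> real" where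
  "interpolant N x obs y =
     kink (x (j_zero N x - 1)) (x (j_zero N x)) y + (\<Sum>j=1..N. obs j * hat_fun x j y)"


section \<open>The estimator\<close>

text \<open>\<open>trim \<kappa> 0 = 0\<close> is a convention; below it is relevant only on a null set of frequencies.\<close>

definition trim :: "real \<Rightarrow> complex \<Rightarrow> complex" where
  "trim \<kappa> z = (if cmod z \<ge> \<kappa> then z else of_real \<kappa> * z / of_real (cmod z))"

definition empirical_deriv ::
    "real \<Rightarrow> (real \<Rightarrow> real) \<Rightarrow> (real \<Rightarrow> real) \<Rightarrow> real \<Rightarrow> complex" where
  "empirical_deriv T \<kappa> f u =
     (let F0 = fourier (\<lambda>y. of_real (f y)) u;
          F1 = fourier (\<lambda>y. of_real (y * f y)) u
      in 1 / of_real T *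
         (((\<i> - 2 * of_real u) * F0 - (of_real u + \<i> * of_real (u\<^sup>2)) * F1) /
          trim (\<kappa> u) (1 + \<i> * of_real u * (1 + \<i> * of_real u) * F0)))"

definition trim_level :: "real \<Rightarrow> real \<Rightarrow> real \<Rightarrow> real \<Rightarrow> real \<Rightarrow> real" where
  "trim_level T R \<alpha>max C\<phi> u =
     (if \<bar>u\<bar> < 1 then 1/3 * exp (- T * R) else 1/3 * C\<phi> * \<bar>u\<bar> powr (- T * \<alpha>max))"

definition trim_constant :: "real \<Rightarrow> real \<Rightarrow> real \<Rightarrow> real \<Rightarrow> bool" where
  "trim_constant T R \<alpha>max C\<phi> \<longleftrightarrow> 0 < C\<phi> \<and>
     (\<forall>P\<in>class_G0 T R \<alpha>max. \<forall>u. 1 \<le> \<bar>u\<bar> \<longrightarrow>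
        C\<phi> * \<bar>u\<bar> powr (- T * \<alpha>max) \<le> cmod (char_ext T P (of_real u - \<i>)))"

definition kernel_fourier :: "(real \<Rightarrow> real) \<Rightarrow> real \<Rightarrow> complex" where
  "kernel_fourier W = fourier (\<lambda>x. of_real (W x))"

definition kernel_cond :: "real \<Rightarrow> real \<Rightarrow> nat \<Rightarrow> (real \<Rightarrow> real) \<Rightarrow> bool" where
  "kernel_cond T \<alpha>max s W \<longleftrightarrow>
     integrable lborel W \<and>
     (\<forall>U>0. integrable lborel
        (\<lambda>u. (1 + \<bar>u\<bar>\<^sup>2) powr (T * \<alpha>max + 2) * (cmod (kernel_fourier W (u / U)))\<^sup>2)) \<and>
     closure {x. W x \<noteq> 0} \<subseteq> {..0} \<and>
     (LINT x|lborel. W x) = 1 \<and>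
     (\<forall>l\<in>{1..<s}. (LINT x|lborel. x ^ l * W x) = 0) \<and>
     integrable lborel (\<lambda>x. x ^ (2 * s - 1) * W x)"

definition k_hat :: "(real \<Rightarrow> real) \<Rightarrow> real \<Rightarrow> real \<Rightarrow> (real \<Rightarrow> complex) \<Rightarrow> real \<Rightarrow> complex" where
  "k_hat W U g d x =
     (if x > 0 then
        inv_fourier (\<lambda>u. (- of_real g - \<i> * d u) * kernel_fourier W (u / U)) x
      else if x < 0 then
        inv_fourier (\<lambda>u. (- of_real g - \<i> * d u) * kernel_fourier W (- u / U)) x
      else 0)"

text \<open>An estimator of \<open>\<gamma>\<close> is a measurable function \<open>G\<close> of the data \<open>(O\<^sub>1, \<dots>, O\<^sub>N)\<close>.\<close>

definition k_estimator :: "real \<Rightarrow> (real \<Rightarrow> real) \<Rightarrow> (real \<Rightarrow> real) \<Rightarrow> real \<Rightarrow>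
    nat \<Rightarrow> (nat \<Rightarrow> real) \<Rightarrow> ((nat \<Rightarrow> real) \<Rightarrow> real) \<Rightarrow> (nat \<Rightarrow> real) \<Rightarrow> real \<Rightarrow> complex" where
  "k_estimator T \<kappa> W U N x G obs =
     k_hat W U (G obs) (empirical_deriv T \<kappa> (interpolant N x obs))"

definition gamma_risk :: "real \<Rightarrow> real \<times> (real \<Rightarrow> real) \<Rightarrow> 'a measure \<Rightarrow> nat \<Rightarrow> (nat \<Rightarrow> real) \<Rightarrow>
    (nat \<Rightarrow> real) \<Rightarrow> (nat \<Rightarrow> 'a \<Rightarrow> real) \<Rightarrow> ((nat \<Rightarrow> real) \<Rightarrow> real) \<Rightarrow> ennreal" where
  "gamma_risk T P M N x \<delta> e G =
     (\<integral>\<^sup>+ \<omega>. ennreal (\<bar>G (observations T P N x \<delta> e \<omega>) - fst P\<bar>\<^sup>2) \<partial>M)"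

definition k_risk :: "real \<Rightarrow> real \<times> (real \<Rightarrow> real) \<Rightarrow> (real \<Rightarrow> real) \<Rightarrow> (real \<Rightarrow> real) \<Rightarrow> real \<Rightarrow>
    'a measure \<Rightarrow> nat \<Rightarrow> (nat \<Rightarrow> real) \<Rightarrow> (nat \<Rightarrow> real) \<Rightarrow> (nat \<Rightarrow> 'a \<Rightarrow> real) \<Rightarrow>
    ((nat \<Rightarrow> real) \<Rightarrow> real) \<Rightarrow> ennreal" where
  "k_risk T P \<kappa> W U M N x \<delta> e G =
     esqrt (\<integral>\<^sup>+ \<omega>. (L2norm (\<lambda>y.
       k_estimator T \<kappa> W U N x G (observations T P N x \<delta> e \<omega>) y
         - of_real (k_exp (snd P) y)))\<^sup>2 \<partial>M)"

end

(* On the half-line x > 0 the kernel, being supported in the negative half-line, annihilates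
   additive constants in the frequency domain, and with them the error of the estimator of gamma. The
   remaining error splits into a smoothing bias of order U^(-s), which by the support condition only
   sees k_e to the right of x, and the residual of the empirical derivative. Trimming makes this
   residual linear in the Fourier transforms of the interpolation error and of its product with x;
   no quadratic remainder occurs. Their second moments are of order epsilon^2 uniformly in the
   frequency: the payoff is a mixture of kinked exponentials, each of which is interpolated with an
   L^1 error of order Delta^2. Plancherel's inequality turns this into a variance of order
   epsilon^2 U^(2 T alpha + 5), and the cut-off balances the two. The same argument applied to the
   reflected function covers x < 0. *)

theory Submission
  imports Defs "HOL-Complex_Analysis.Complex_Analysis"
begin

section \<open>Fourier transform: Plancherel inequality and inversion\<close>

text \<open>The triplet fixes the law of the log-price through its characteristic function on the
  real line, but the estimator lives on the shifted line \<open>u - \<i>\<close>, the far edge of a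
  strip of width one. The Levy-Khinchine formula is carried there by reflection and analytic
  continuation; at \<open>u = 0\<close> it turns the martingale condition into
  \<open>E[exp X] = 1\<close>, which the transform of the option function needs. Differentiation
  cancels the factor \<open>1 / |x|\<close> of the Levy density, so the logarithmic derivative of
  the shifted characteristic function is a constant plus the transform of \<open>k_exp k\<close>, up
  to a factor.

  The exponents: trimming costs \<open>|u|\<close> to the power \<open>T * \<alpha>max\<close>,
  numerator and denominator cost \<open>u\<^sup>2\<close>. Squared and integrated over frequencies
  of order \<open>U\<close> this gives \<open>U powr (2 * T * \<alpha>max + 5)\<close>; equating
  \<open>\<epsilon>\<^sup>2\<close> times it with \<open>U powr (- 2 * s)\<close> yields the
  cut-off.

  The estimator of the drift is an arbitrary function of the data. The risk is therefore bounded
  path by path by a majorant free of it and quadratic in the noise, and second moments are computed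
  for that majorant.\<close>

lemma esqrt_power2: "(esqrt a)\<^sup>2 = a"
proof (cases a)
  case (real r)
  then show ?thesis
    by (simp add: esqrt_def ennreal_power)
next
  case top
  then show ?thesis
    by (simp add: esqrt_def power2_eq_square)
qed

lemma esqrt_le_iff:
  assumes "0 \<le> b"
  shows "esqrt a \<le> ennreal b \<longleftrightarrow> a \<le> ennreal (b\<^sup>2)"
proof (cases a)
  case (real r)
  then show ?thesis
    using assms by (simp add: esqrt_def ennreal_le_iff2 real_le_lsqrt sqrt_le_D real_sqrt_le_iff real_le_lsqrt)
      (metis assms real_sqrt_le_iff real_sqrt_unique)
next
  case top
  then show ?thesis
    by (simp add: esqrt_def top_unique)
qed

lemma L2norm_power2: "(L2norm f)\<^sup>2 = (\<integral>\<^sup>+ x. ennreal ((norm (f x))\<^sup>2) \<partial>lborel)"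
  by (simp add: L2norm_def esqrt_power2)

lemma norm_exp_minus_i_times [simp]: "cmod (exp (- (\<i> * of_real t))) = 1"
  using norm_exp_i_times[of "-t"] by simp

lemma cnj_measurable [measurable]: "cnj \<in> borel_measurable borel"
  by (intro borel_measurable_continuous_onI continuous_intros)

lemma fourier_integrable:
  assumes "integrable lborel f"
  shows "integrable lborel (\<lambda>x. exp (\<i> * of_real (u * x)) * f x)"
proof -
  have [measurable]: "f \<in> borel_measurable lborel"
    using assms by simp
  show ?thesis
    by (rule Bochner_Integration.integrable_bound[OF assms]) (auto simp: norm_mult simp del: of_real_mult)
qed

lemma inv_fourier_integrable:
  assumes "integrable lborel f"
  shows "integrable lborel (\<lambda>x. exp (- \<i> * of_real (x * u)) * f x)"
  using fourier_integrable[OF assms, of "-u"] by (simp add: mult.commute)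

lemma fourier_eq_inv_fourier: "fourier f u = 2 * pi * inv_fourier f (- u)"
  by (simp add: fourier_def inv_fourier_def mult.commute)

lemma fourier_norm_le:
  assumes "integrable lborel f"
  shows "cmod (fourier f u) \<le> (LINT x|lborel. cmod (f x))"
  unfolding fourier_def
  by (rule order_trans[OF integral_norm_bound]) (simp add: norm_mult del: of_real_mult)

lemma fourier_add:
  assumes "integrable lborel f" "integrable lborel g"
  shows "fourier (\<lambda>x. f x + g x) u = fourier f u + fourier g u"
  unfolding fourier_def using fourier_integrable[OF assms(1)] fourier_integrable[OF assms(2)]
  by (simp add: distrib_left)

lemma fourier_diff:
  assumes "integrable lborel f" "integrable lborel g"
  shows "fourier (\<lambda>x. f x - g x) u = fourier f u - fourier g u"
  unfolding fourier_def using fourier_integrable[OF assms(1)] fourier_integrable[OF assms(2)]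
  by (simp add: right_diff_distrib)

lemma fourier_cmult: "fourier (\<lambda>x. c * f x) u = c * fourier f u"
  unfolding fourier_def by (simp add: mult.left_commute)

lemma fourier_sum:
  assumes "\<And>i. i \<in> I \<Longrightarrow> integrable lborel (f i)"
  shows "fourier (\<lambda>x. \<Sum>i\<in>I. f i x) u = (\<Sum>i\<in>I. fourier (f i) u)"
  unfolding fourier_def using fourier_integrable[OF assms]
  by (simp add: sum_distrib_left)

lemma fourier_measurable [measurable]:
  assumes [measurable]: "f \<in> borel_measurable borel"
  shows "fourier f \<in> borel_measurable borel"
  unfolding fourier_def by measurable

lemma inv_fourier_measurable [measurable]:
  assumes [measurable]: "f \<in> borel_measurable borel"
  shows "inv_fourier f \<in> borel_measurable borel"
  unfolding inv_fourier_def by measurable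

section \<open>Plancherel's inequality by Gaussian damping\<close>

lemma nn_integral_gaussian:
  assumes "0 < \<sigma>"
  shows "(\<integral>\<^sup>+ v. ennreal (exp (- (\<sigma> * (u - v))\<^sup>2 / 2)) \<partial>lborel) = ennreal (sqrt (2 * pi) / \<sigma>)"
proof -
  have eq: "exp (- (\<sigma> * (u - v))\<^sup>2 / 2) = sqrt (2 * pi) / \<sigma> * normal_density u (1 / \<sigma>) v" for v
    using assms by (simp add: normal_density_def power2_commute[of u v] power_mult_distrib power_divide real_sqrt_mult real_sqrt_divide)
  have "(\<integral>\<^sup>+ v. ennreal (normal_density u (1 / \<sigma>) v) \<partial>lborel) = 1"
    using prob_space.emeasure_space_1[OF prob_space_normal_density[of "1 / \<sigma>" u]] assms
    by (simp add: emeasure_density)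
  moreover have "(\<integral>\<^sup>+ v. ennreal (sqrt (2 * pi) / \<sigma> * normal_density u (1 / \<sigma>) v) \<partial>lborel) =
      ennreal (sqrt (2 * pi) / \<sigma>) * (\<integral>\<^sup>+ v. ennreal (normal_density u (1 / \<sigma>) v) \<partial>lborel)"
    using assms by (subst nn_integral_cmult[symmetric]) (auto simp: ennreal_mult' simp del: times_divide_eq_left)
  ultimately show ?thesis
    unfolding eq by simp
qed


text \<open>The Gaussian weight makes the expanded double integral over frequencies
  \<open>(u, v)\<close> absolutely convergent for merely integrable \<open>g\<close>. Integrating
  out the space variable leaves the kernel \<open>exp (- (\<sigma> * (u - v))\<^sup>2 / 2)\<close>,
  whose mass in either variable is \<open>sqrt (2 * pi) / \<sigma>\<close>. This cancels the
  \<open>\<sigma>\<close> of the rescaled weight, so the bound is the same for all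
  \<open>\<sigma>\<close>.\<close>

lemma plancherel_damped:
  assumes g: "integrable lborel g" and \<sigma>: "0 < \<sigma>"
  shows "(\<integral>\<^sup>+ y. ennreal (exp (- (y / \<sigma>)\<^sup>2 / 2) * (cmod (inv_fourier g y))\<^sup>2) \<partial>lborel)
    \<le> ennreal (1 / (2 * pi)) * (\<integral>\<^sup>+ u. ennreal ((cmod (g u))\<^sup>2) \<partial>lborel)"
proof -
  have [measurable]: "g \<in> borel_measurable borel"
    using borel_measurable_integrable[OF g] by simp
  let ?N = std_normal_distribution
  let ?P = "lborel \<Otimes>\<^sub>M lborel :: (real \<times> real) measure"
  let ?I = "\<integral>\<^sup>+ u. ennreal ((cmod (g u))\<^sup>2) \<partial>lborel"
  define H where "H x = (CLINT u|lborel. exp (- \<i> * of_real (u * x)) * g u)" for x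
  have H_meas [measurable]: "H \<in> borel_measurable borel"
    unfolding H_def by measurable
  define G where "G = (\<lambda>p. g (fst p) * cnj (g (snd p)))"
  define E where "E = (\<lambda>x p. exp (- \<i> * of_real (\<sigma> * x * (fst p - snd p))) * G p)"
  interpret N: prob_space ?N
    by (rule prob_space_normal_density) simp
  interpret NP: pair_sigma_finite ?N ?P
    by unfold_locales
  have G_meas [measurable]: "G \<in> borel_measurable ?P"
    unfolding G_def by measurable
  have E_norm: "cmod (E x p) = cmod (G p)" for x p
    unfolding E_def by (simp add: norm_mult del: of_real_mult of_real_diff)
  have G_int: "integrable ?P G"
    unfolding G_def
  proof (rule lborel_pair.Fubini_integrable)
    show "(\<lambda>p. g (fst p) * cnj (g (snd p))) \<in> borel_measurable ?P"
      by measurable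
  qed (use g in \<open>auto simp: norm_mult integrable_norm\<close>)
  have E_int: "integrable (?N \<Otimes>\<^sub>M ?P) (\<lambda>(x, p). E x p)"
  proof (rule NP.Fubini_integrable)
    show "(\<lambda>(x, p). E x p) \<in> borel_measurable (?N \<Otimes>\<^sub>M ?P)"
      unfolding E_def by measurable
    have "(\<lambda>p. E x p) \<in> borel_measurable ?P" for x
      unfolding E_def by measurable
    then show "AE x in ?N. integrable ?P (\<lambda>p. case (x, p) of (x, p) \<Rightarrow> E x p)"
      by (intro AE_I2) (auto simp: E_norm intro: Bochner_Integration.integrable_bound[OF G_int])
  qed (simp add: E_norm)
  have E_int1: "integrable ?P (E x)" for x
  proof (rule Bochner_Integration.integrable_bound[OF G_int])
    show "E x \<in> borel_measurable ?P"
      unfolding E_def by measurable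
  qed (simp add: E_norm)
  have HH: "complex_of_real ((cmod (H (\<sigma> * x)))\<^sup>2) = (LINT p|?P. E x p)" for x
  proof -
    have 1: "cnj (H (\<sigma> * x)) = (CLINT v|lborel. cnj (exp (- \<i> * of_real (v * (\<sigma> * x))) * g v))"
      unfolding H_def by (rule Bochner_Integration.integral_cnj[symmetric])
    have "complex_of_real ((cmod (H (\<sigma> * x)))\<^sup>2) = H (\<sigma> * x) * cnj (H (\<sigma> * x))"
      by (rule complex_norm_square)
    also have "\<dots> = (CLINT u|lborel. exp (- \<i> * of_real (u * (\<sigma> * x))) * g u * cnj (H (\<sigma> * x)))"
      by (subst H_def) (simp only: integral_mult_left_zero)
    also have "\<dots> = (CLINT u|lborel. CLINT v|lborel. exp (- \<i> * of_real (u * (\<sigma> * x))) * g u * cnj (exp (- \<i> * of_real (v * (\<sigma> * x))) * g v))"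
      unfolding 1 by (simp only: integral_mult_right_zero)
    also have "\<dots> = (CLINT u|lborel. CLINT v|lborel. E x (u, v))"
      by (simp add: E_def G_def exp_cnj algebra_simps flip: exp_add)
    also have "\<dots> = (LINT p|?P. E x p)"
      using lborel_pair.integral_fst'[OF E_int1[of x]] by simp
    finally show ?thesis .
  qed
  \<comment> \<open>The integral over the normal variable is its characteristic function at the
    scaled frequency difference.\<close>
  have inner: "(LINT x|?N. E x p) = of_real (exp (- (\<sigma> * (fst p - snd p))\<^sup>2 / 2)) * G p" for p
  proof -
    have "(LINT x|?N. E x p) = char ?N (\<sigma> * (snd p - fst p)) * G p"
      unfolding E_def char_def integral_mult_left_zero by (simp add: algebra_simps)
    then show ?thesis
      by (simp add: char_std_normal_distribution power_mult_distrib power2_commute)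
  qed
  have sq_int: "integrable ?N (\<lambda>x. complex_of_real ((cmod (H (\<sigma> * x)))\<^sup>2))"
    unfolding HH using NP.integrable_fst'[OF E_int] by simp
  have "(\<integral>\<^sup>+ x. ennreal ((cmod (H (\<sigma> * x)))\<^sup>2) \<partial>?N) = ennreal (LINT x|?N. (cmod (H (\<sigma> * x)))\<^sup>2)"
    using sq_int unfolding complex_of_real_integrable_eq by (intro nn_integral_eq_integral) auto
  also have "(LINT x|?N. (cmod (H (\<sigma> * x)))\<^sup>2) = cmod (LINT x|?N. complex_of_real ((cmod (H (\<sigma> * x)))\<^sup>2))"
    unfolding integral_complex_of_real norm_of_real by (simp add: integral_nonneg_AE)
  also have "(LINT x|?N. complex_of_real ((cmod (H (\<sigma> * x)))\<^sup>2)) = (LINT p|?P. LINT x|?N. E x p)"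
    unfolding HH using NP.Fubini_integral[OF E_int] by simp
  also have "ennreal (cmod \<dots>) \<le> (\<integral>\<^sup>+ p. ennreal (cmod (LINT x|?N. E x p)) \<partial>?P)"
    unfolding inner
    by (rule integral_norm_bound_ennreal, rule Bochner_Integration.integrable_bound[OF G_int])
      (auto simp: norm_mult mult_left_le_one_le)
  \<comment> \<open>Arithmetic-geometric mean: each half keeps \<open>g\<close> at one frequency
    only, so the Gaussian can be integrated in the other (Schur's test).\<close>
  also have "\<dots> \<le> (\<integral>\<^sup>+ p. ennreal (1/2) * (ennreal (exp (- (\<sigma> * (fst p - snd p))\<^sup>2 / 2)) * ennreal ((cmod (g (fst p)))\<^sup>2)) +
      ennreal (1/2) * (ennreal (exp (- (\<sigma> * (fst p - snd p))\<^sup>2 / 2)) * ennreal ((cmod (g (snd p)))\<^sup>2)) \<partial>?P)"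
  proof (rule nn_integral_mono)
    fix p :: "real \<times> real"
    let ?e = "exp (- (\<sigma> * (fst p - snd p))\<^sup>2 / 2)"
    have "cmod (g (fst p)) * cmod (g (snd p)) \<le> 1/2 * (cmod (g (fst p)))\<^sup>2 + 1/2 * (cmod (g (snd p)))\<^sup>2"
      using sum_squares_bound[of "cmod (g (fst p))" "cmod (g (snd p))"] by simp
    then have "?e * (cmod (g (fst p)) * cmod (g (snd p))) \<le> ?e * (1/2 * (cmod (g (fst p)))\<^sup>2 + 1/2 * (cmod (g (snd p)))\<^sup>2)"
      by (intro mult_left_mono) auto
    then have "cmod (LINT x|?N. E x p) \<le> 1/2 * (?e * (cmod (g (fst p)))\<^sup>2) + 1/2 * (?e * (cmod (g (snd p)))\<^sup>2)"
      unfolding inner by (simp add: norm_mult G_def algebra_simps)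
    then show "ennreal (cmod (LINT x|?N. E x p)) \<le> ennreal (1/2) * (ennreal ?e * ennreal ((cmod (g (fst p)))\<^sup>2)) +
      ennreal (1/2) * (ennreal ?e * ennreal ((cmod (g (snd p)))\<^sup>2))"
      by (simp add: ennreal_mult[symmetric] ennreal_plus[symmetric] ennreal_leI del: ennreal_plus ennreal_half)
  qed
  also have "\<dots> = ennreal (1/2) * (\<integral>\<^sup>+ u. \<integral>\<^sup>+ v. ennreal (exp (- (\<sigma> * (u - v))\<^sup>2 / 2)) * ennreal ((cmod (g u))\<^sup>2) \<partial>lborel \<partial>lborel) +
      ennreal (1/2) * (\<integral>\<^sup>+ v. \<integral>\<^sup>+ u. ennreal (exp (- (\<sigma> * (u - v))\<^sup>2 / 2)) * ennreal ((cmod (g v))\<^sup>2) \<partial>lborel \<partial>lborel)"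
    by (subst nn_integral_add, measurable, subst (1 2) nn_integral_cmult, measurable,
        subst lborel.nn_integral_fst[symmetric], measurable, subst lborel_pair.nn_integral_snd[symmetric], measurable)
  also have "\<dots> = ennreal (1/2) * (ennreal (sqrt (2 * pi) / \<sigma>) * ?I) + ennreal (1/2) * (ennreal (sqrt (2 * pi) / \<sigma>) * ?I)"
  proof -
    have sym: "exp (- (\<sigma> * (u - v))\<^sup>2 / 2) = exp (- (\<sigma> * (v - u))\<^sup>2 / 2)" for u v
      by (simp add: power_mult_distrib power2_commute)
    have a1: "(\<integral>\<^sup>+ v. ennreal (exp (- (\<sigma> * (u - v))\<^sup>2 / 2)) * ennreal c \<partial>lborel) = ennreal (sqrt (2 * pi) / \<sigma>) * ennreal c" for u c
      by (subst nn_integral_multc) (auto simp only: nn_integral_gaussian[OF \<sigma>], measurable)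
    have a2: "(\<integral>\<^sup>+ u. ennreal (exp (- (\<sigma> * (u - v))\<^sup>2 / 2)) * ennreal c \<partial>lborel) = ennreal (sqrt (2 * pi) / \<sigma>) * ennreal c" for v c
      using a1[of v c] by (subst sym)
    show ?thesis
      unfolding a1 a2 by (subst (1 2) nn_integral_cmult) auto
  qed
  also have "\<dots> = ennreal (sqrt (2 * pi) / \<sigma>) * ?I"
    by (metis (no_types, lifting) add.commute distrib_right ennreal_half field_sum_of_halves ennreal_plus ennreal_1 half_gt_zero_iff less_eq_real_def mult_1 zero_less_one)
  finally have main: "(\<integral>\<^sup>+ x. ennreal ((cmod (H (\<sigma> * x)))\<^sup>2) \<partial>?N) \<le> ennreal (sqrt (2 * pi) / \<sigma>) * ?I" .
  have "(\<integral>\<^sup>+ y. ennreal (exp (- (y / \<sigma>)\<^sup>2 / 2) * (cmod (inv_fourier g y))\<^sup>2) \<partial>lborel)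
     = ennreal \<sigma> * (\<integral>\<^sup>+ x. ennreal (exp (- x\<^sup>2 / 2) * (cmod (inv_fourier g (\<sigma> * x)))\<^sup>2) \<partial>lborel)"
    using \<sigma> by (subst nn_integral_real_affine[where c = \<sigma> and t = 0]) auto
  also have "(\<integral>\<^sup>+ x. ennreal (exp (- x\<^sup>2 / 2) * (cmod (inv_fourier g (\<sigma> * x)))\<^sup>2) \<partial>lborel)
     = (\<integral>\<^sup>+ x. ennreal (sqrt (2 * pi) / (2 * pi)\<^sup>2) * (ennreal (std_normal_density x) * ennreal ((cmod (H (\<sigma> * x)))\<^sup>2)) \<partial>lborel)"
  proof (rule nn_integral_cong)
    fix x :: real
    have "cmod (inv_fourier g (\<sigma> * x)) = cmod (H (\<sigma> * x)) / (2 * pi)"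
      by (simp add: inv_fourier_def H_def norm_divide del: of_real_mult)
    then show "ennreal (exp (- x\<^sup>2 / 2) * (cmod (inv_fourier g (\<sigma> * x)))\<^sup>2) =
      ennreal (sqrt (2 * pi) / (2 * pi)\<^sup>2) * (ennreal (std_normal_density x) * ennreal ((cmod (H (\<sigma> * x)))\<^sup>2))"
      by (simp only:) (simp add: normal_density_def power_divide power2_eq_square field_simps flip: ennreal_mult)
  qed
  also have "\<dots> = ennreal (sqrt (2 * pi) / (2 * pi)\<^sup>2) * (\<integral>\<^sup>+ x. ennreal ((cmod (H (\<sigma> * x)))\<^sup>2) \<partial>?N)"
    by (simp add: nn_integral_cmult nn_integral_density)
  also have "ennreal \<sigma> * \<dots> \<le> ennreal \<sigma> * (ennreal (sqrt (2 * pi) / (2 * pi)\<^sup>2) * (ennreal (sqrt (2 * pi) / \<sigma>) * ?I))"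
    by (intro mult_left_mono main) auto
  also have "\<dots> = ennreal (\<sigma> * (sqrt (2 * pi) / (2 * pi)\<^sup>2 * (sqrt (2 * pi) / \<sigma>))) * ?I"
  proof -
    have p: "0 \<le> sqrt (2 * pi) / (2 * pi)\<^sup>2" "0 \<le> sqrt (2 * pi) / \<sigma>" "0 \<le> \<sigma>"
      using \<sigma> by auto
    show ?thesis
      by (simp only: ennreal_mult[OF p(3) mult_nonneg_nonneg[OF p(1,2)]] ennreal_mult[OF p(1,2)] mult.assoc)
  qed
  also have "\<sigma> * (sqrt (2 * pi) / (2 * pi)\<^sup>2 * (sqrt (2 * pi) / \<sigma>)) = 1 / (2 * pi)"
    using \<sigma> by (simp add: power2_eq_square field_simps)
  finally show ?thesis .
qed

text \<open>Fatou's lemma removes the damping along \<open>\<sigma> = n + 1\<close>, since the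
  damped bound does not depend on \<open>\<sigma>\<close>.\<close>

lemma plancherel_le:
  assumes g: "integrable lborel g"
  shows "(\<integral>\<^sup>+ y. ennreal ((cmod (inv_fourier g y))\<^sup>2) \<partial>lborel)
    \<le> ennreal (1 / (2 * pi)) * (\<integral>\<^sup>+ u. ennreal ((cmod (g u))\<^sup>2) \<partial>lborel)" (is "_ \<le> ?B")
proof -
  have [measurable]: "g \<in> borel_measurable borel"
    using borel_measurable_integrable[OF g] by simp
  let ?f = "\<lambda>n y. ennreal (exp (- (y / real (Suc n))\<^sup>2 / 2) * (cmod (inv_fourier g y))\<^sup>2)"
  have lim: "(\<lambda>n. ?f n y) \<longlonglongrightarrow> ennreal ((cmod (inv_fourier g y))\<^sup>2)" for y
  proof -
    have "(\<lambda>n. y / real (Suc n)) \<longlonglongrightarrow> 0"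
      by (rule LIMSEQ_Suc[OF lim_const_over_n])
    then have "(\<lambda>n. exp (- (y / real (Suc n))\<^sup>2 / 2) * (cmod (inv_fourier g y))\<^sup>2) \<longlonglongrightarrow> exp (- 0\<^sup>2 / 2) * (cmod (inv_fourier g y))\<^sup>2"
      by (intro tendsto_intros) auto
    then show ?thesis
      by (intro tendsto_ennrealI) simp
  qed
  have "(\<integral>\<^sup>+ y. ennreal ((cmod (inv_fourier g y))\<^sup>2) \<partial>lborel) = (\<integral>\<^sup>+ y. liminf (\<lambda>n. ?f n y) \<partial>lborel)"
    using lim_imp_Liminf[OF _ lim] by simp
  also have "\<dots> \<le> liminf (\<lambda>n. \<integral>\<^sup>+ y. ?f n y \<partial>lborel)"
    by (rule nn_integral_liminf) measurable
  also have "\<dots> \<le> ?B"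
    using plancherel_damped[OF g] by (intro Liminf_le) auto
  finally show ?thesis .
qed


text \<open>Reduction to Levy's uniqueness theorem for probability measures: the positive and
  negative parts of \<open>d\<close> have equal transforms. Adding a standard normal density to both
  before normalising keeps the mass \<open>c\<close> positive even if \<open>d\<close>
  vanishes.\<close>

lemma fourier_inj_real:
  fixes d :: "real \<Rightarrow> real"
  assumes d: "integrable lborel d" and F: "\<And>u. fourier (\<lambda>x. of_real (d x)) u = 0"
  shows "AE x in lborel. d x = 0"
proof -
  have [measurable]: "d \<in> borel_measurable borel"
    using borel_measurable_integrable[OF d] by simp
  have n: "integrable lborel std_normal_density" "(LINT x|lborel. std_normal_density x) = 1"
    using integrable_std_normal_moment[of 0] integral_std_normal_moment_even[of 0] by simp_all
  let ?n = std_normal_density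
  have pos: "integrable lborel (\<lambda>x. max 0 (d x))" and neg: "integrable lborel (\<lambda>x. max 0 (- d x))"
    using d by auto
  define c where "c = 1 + (LINT x|lborel. max 0 (d x))"
  have c0: "0 < c"
    unfolding c_def by (intro add_pos_nonneg integral_nonneg_AE) auto
  \<comment> \<open>The transform at frequency 0 is the integral of \<open>d\<close>; its vanishing
    gives both parts the same mass, so one constant \<open>c\<close> normalises both.\<close>
  have "(LINT x|lborel. max 0 (d x)) - (LINT x|lborel. max 0 (- d x)) = (LINT x|lborel. max 0 (d x) - max 0 (- d x))"
    using pos neg by simp
  also have "\<dots> = (LINT x|lborel. d x)"
    by (rule Bochner_Integration.integral_cong) auto
  also have "\<dots> = 0"
    using F[of 0] by (simp add: fourier_def del: of_real_eq_0_iff) (metis integral_complex_of_real of_real_eq_0_iff)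
  finally have c': "c = 1 + (LINT x|lborel. max 0 (- d x))"
    by (simp add: c_def)
  define D where "D = (\<lambda>f x. (max 0 (f x) + ?n x) / c :: real)"
  have D_meas [measurable]: "D f \<in> borel_measurable borel" if [measurable]: "f \<in> borel_measurable borel" for f
    unfolding D_def by measurable
  have D_pos: "0 \<le> D f x" for f x
    unfolding D_def using c0 by simp
  have D_int: "integrable lborel (D f)" if "integrable lborel (\<lambda>x. max 0 (f x))" for f
    unfolding D_def using that n by simp
  have dist: "real_distribution (density lborel (D f))"
    if f: "f \<in> borel_measurable borel" "integrable lborel (\<lambda>x. max 0 (f x))" "c = 1 + (LINT x|lborel. max 0 (f x))" for f
  proof -
    have "(\<integral>\<^sup>+ x. ennreal (D f x) \<partial>lborel) = ennreal (LINT x|lborel. D f x)"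
      using D_int[OF f(2)] by (intro nn_integral_eq_integral) (auto simp: D_pos)
    also have "(LINT x|lborel. D f x) = ((LINT x|lborel. max 0 (f x)) + (LINT x|lborel. ?n x)) / c"
      unfolding D_def using f(2) n by simp
    also have "\<dots> = 1"
      using c0 f(3) n by simp
    finally have "prob_space (density lborel (D f))"
      using f(1) by (intro prob_spaceI) (simp add: emeasure_density)
    then show ?thesis
      by (simp add: real_distribution_def real_distribution_axioms_def)
  qed
  have D_char: "char (density lborel (D f)) u = fourier (\<lambda>x. of_real (D f x)) u"
    if f: "f \<in> borel_measurable borel" for f u
    unfolding char_def fourier_def using f
    by (subst integral_density) (auto simp: D_pos scaleR_conv_of_real mult.commute)
  have "density lborel (D d) = density lborel (D (\<lambda>x. - d x))"
  proof (rule Levy_uniqueness)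
    show "real_distribution (density lborel (D d))" "real_distribution (density lborel (D (\<lambda>x. - d x)))"
      using pos neg c' by (auto intro!: dist simp: c_def)
    show "char (density lborel (D d)) = char (density lborel (D (\<lambda>x. - d x)))"
    proof
      fix u
      have "fourier (\<lambda>x. of_real (D d x)) u - fourier (\<lambda>x. of_real (D (\<lambda>x. - d x) x)) u
          = fourier (\<lambda>x. of_real (D d x) - of_real (D (\<lambda>x. - d x) x)) u"
        using D_int pos neg by (intro fourier_diff[symmetric] integrable_of_real) auto
      also have "(\<lambda>x. complex_of_real (D d x) - of_real (D (\<lambda>x. - d x) x)) = (\<lambda>x. of_real (1 / c) * of_real (d x))"
        unfolding D_def of_real_diff[symmetric] of_real_mult[symmetric] using c0 by (auto simp: field_simps max_def)
      finally show "char (density lborel (D d)) u = char (density lborel (D (\<lambda>x. - d x))) u"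
        by (simp only: D_char fourier_cmult F) (simp add: D_char)
    qed
  qed
  then have "AE x in lborel. ennreal (D d x) = ennreal (D (\<lambda>x. - d x) x)"
    by (subst (asm) sigma_finite_measure.density_unique_iff[OF sigma_finite_lborel]) auto
  then show ?thesis
  proof (rule AE_mp, intro AE_I2 impI)
    fix x assume "ennreal (D d x) = ennreal (D (\<lambda>x. - d x) x)"
    then have "D d x = D (\<lambda>x. - d x) x"
      by (simp add: D_pos)
    then show "d x = 0"
      unfolding D_def using c0 by (auto simp: max_def split: if_splits)
  qed
qed

lemma fourier_cnj: "fourier (\<lambda>x. cnj (f x)) u = cnj (fourier f (- u))"
  unfolding fourier_def Bochner_Integration.integral_cnj[symmetric] by (simp add: exp_cnj del: Bochner_Integration.integral_cnj)

text \<open>Conjugation in space is conjugation plus reflection in frequency, so real and imaginary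
  part inherit the vanishing transform.\<close>

lemma fourier_inj:
  assumes d: "integrable lborel d" and F: "\<And>u. fourier d u = 0"
  shows "AE x in lborel. d x = 0"
proof -
  have dc: "integrable lborel (\<lambda>x. cnj (d x))"
    using d by simp
  have re: "(\<lambda>x. complex_of_real (Re (d x))) = (\<lambda>x. 1/2 * (d x + cnj (d x)))"
    by (auto simp: complex_eq_iff)
  have im: "(\<lambda>x. complex_of_real (Im (d x))) = (\<lambda>x. - \<i>/2 * (d x - cnj (d x)))"
    by (auto simp: complex_eq_iff)
  have "AE x in lborel. Re (d x) = 0"
    using d by (intro fourier_inj_real) (auto simp only: re fourier_cmult fourier_add[OF d dc] fourier_cnj F integrable_Re, simp)
  moreover have "AE x in lborel. Im (d x) = 0"
    using d by (intro fourier_inj_real) (auto simp only: im fourier_cmult fourier_diff[OF d dc] fourier_cnj F integrable_Im, simp)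
  ultimately show ?thesis
    by eventually_elim (simp add: complex_eq_iff)
qed

text \<open>Fubini and the characteristic function of the normal law: randomising the frequency
  damps the function in space. Inversion applies this once to \<open>f\<close> and once to a
  reflected transform of \<open>f\<close>.\<close>

lemma gaussian_average_fourier:
  assumes h: "integrable lborel h"
  shows "(CLINT v|std_normal_distribution. fourier h (t + v)) = fourier (\<lambda>y. of_real (exp (- y\<^sup>2 / 2)) * h y) t"
proof -
  have [measurable]: "h \<in> borel_measurable borel"
    using borel_measurable_integrable[OF h] by simp
  let ?N = std_normal_distribution
  interpret N: prob_space ?N
    by (rule prob_space_normal_density) simp
  interpret NP: pair_sigma_finite ?N "lborel :: real measure"
    by unfold_locales
  let ?E = "\<lambda>v y. exp (\<i> * of_real ((t + v) * y)) * h y"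
  have E_int: "integrable (?N \<Otimes>\<^sub>M lborel) (\<lambda>(v, y). ?E v y)"
  proof (rule NP.Fubini_integrable)
    show "AE v in ?N. integrable lborel (\<lambda>y. case (v, y) of (v, y) \<Rightarrow> ?E v y)"
      using fourier_integrable[OF h] by (intro AE_I2) (simp del: of_real_mult of_real_add)
  qed (simp_all add: norm_mult del: of_real_mult of_real_add)
  have "(CLINT v|?N. fourier h (t + v)) = (CLINT y|lborel. CLINT v|?N. ?E v y)"
    unfolding fourier_def using NP.Fubini_integral[OF E_int] by simp
  also have "\<dots> = (CLINT y|lborel. exp (\<i> * of_real (t * y)) * h y * char ?N y)"
  proof (rule Bochner_Integration.integral_cong)
    fix y
    have "(CLINT v|?N. ?E v y) = (CLINT v|?N. exp (\<i> * of_real (t * y)) * h y * exp (\<i> * of_real (y * v)))"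
      by (simp add: algebra_simps exp_add)
    then show "(CLINT v|?N. ?E v y) = exp (\<i> * of_real (t * y)) * h y * char ?N y"
      by (simp only: integral_mult_right_zero char_def)
  qed simp
  finally show ?thesis
    by (simp add: char_std_normal_distribution fourier_def mult.assoc mult.left_commute mult.commute)
qed

text \<open>Both sides have the same Fourier transform after multiplication by a Gaussian, which makes
  them integrable.\<close>

lemma fourier_inversion:
  assumes f: "integrable lborel f" and Ff: "integrable lborel (fourier f)"
  shows "AE x in lborel. inv_fourier (fourier f) x = f x"
proof -
  have [measurable]: "f \<in> borel_measurable borel"
    using borel_measurable_integrable[OF f] by simp
  let ?N = std_normal_distribution
  let ?g = "inv_fourier (fourier f)"
  let ?e = "\<lambda>x::real. exp (- x\<^sup>2 / 2)"
  have lbN: "(CLINT v|?N. h v) = (CLINT v|lborel. of_real (?e v) * h v) / of_real (sqrt (2 * pi))"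
    if [measurable]: "h \<in> borel_measurable borel" for h :: "real \<Rightarrow> complex"
  proof -
    have "(CLINT v|?N. h v) = (CLINT v|lborel. (of_real (?e v) * h v) / of_real (sqrt (2 * pi)))"
      by (subst integral_density) (auto simp: scaleR_conv_of_real normal_density_def)
    then show ?thesis
      by simp
  qed
  have e_int: "integrable lborel ?e"
  proof -
    have "?e = (\<lambda>x. sqrt (2 * pi) * std_normal_density x)"
      by (auto simp: normal_density_def)
    then show ?thesis
      using integrable_std_normal_moment[of 0] by simp
  qed
  have fe: "integrable lborel (\<lambda>y. of_real (?e y) * f y)"
    by (rule Bochner_Integration.integrable_bound[OF f]) (auto simp: norm_mult mult_left_le_one_le)
  have g_bound: "cmod (?g x) \<le> (LINT u|lborel. cmod (fourier f u)) / (2 * pi)" for x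
    using fourier_norm_le[OF Ff, of "-x"] fourier_eq_inv_fourier[of "fourier f" "-x"]
    by (simp add: norm_mult field_simps)
  have ge: "integrable lborel (\<lambda>y. of_real (?e y) * ?g y)"
  proof (rule Bochner_Integration.integrable_bound)
    show "integrable lborel (\<lambda>y. (LINT u|lborel. cmod (fourier f u)) / (2 * pi) * ?e y)"
      using e_int by simp
    show "AE x in lborel. cmod (of_real (?e x) * ?g x) \<le> norm ((LINT u|lborel. cmod (fourier f u)) / (2 * pi) * ?e x)"
    proof (intro AE_I2)
      fix x
      show "cmod (of_real (?e x) * ?g x) \<le> norm ((LINT u|lborel. cmod (fourier f u)) / (2 * pi) * ?e x)"
        using mult_right_mono[OF g_bound[of x], of "?e x"] by (simp add: norm_mult mult.commute)
    qed
  qed measurable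
  have eq: "fourier (\<lambda>y. of_real (?e y) * ?g y) t = fourier (\<lambda>y. of_real (?e y) * f y) t" for t
  proof -
    \<comment> \<open>The transform of this function is
      \<open>2 * pi * exp (\<i> * of_real (t * x))\<close> times the candidate inverse. The
      averaging lemma, applied to it and to \<open>f\<close>, therefore expresses both damped
      transforms by the same Gaussian integral of \<open>fourier f\<close>.\<close>
    have h: "integrable lborel (\<lambda>u. fourier f (t - u))"
      using lborel_integrable_real_affine[OF Ff, of "-1" t] by simp
    have Fh: "fourier (\<lambda>u. fourier f (t - u)) x = 2 * pi * (exp (\<i> * of_real (t * x)) * ?g x)" for x
    proof -
      have "fourier (\<lambda>u. fourier f (t - u)) x = (CLINT u|lborel. exp (\<i> * of_real (x * (t - u))) * fourier f u)"
        unfolding fourier_def[of "\<lambda>u. fourier f (t - u)"]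
        by (subst lborel_integral_real_affine[where c = "-1" and t = t]) auto
      also have "\<dots> = (CLINT u|lborel. exp (\<i> * of_real (t * x)) * (exp (- \<i> * of_real (u * x)) * fourier f u))"
        by (simp add: algebra_simps flip: exp_add)
      finally show ?thesis
        unfolding integral_mult_right_zero by (simp add: inv_fourier_def)
    qed
    have "2 * pi * (CLINT x|?N. exp (\<i> * of_real (t * x)) * ?g x) = (CLINT v|?N. fourier (\<lambda>u. fourier f (t - u)) (0 + v))"
      by (simp add: Fh)
    also have "\<dots> = (CLINT u|lborel. of_real (?e u) * fourier f (t - u))"
      by (subst gaussian_average_fourier[OF h]) (simp add: fourier_def[of _ 0])
    also have "\<dots> = (CLINT u|lborel. of_real (?e u) * fourier f (t + u))"
      by (subst lborel_integral_real_affine[where c = "-1" and t = 0]) auto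
    also have "\<dots> = of_real (sqrt (2 * pi)) * (CLINT u|?N. fourier f (t + u))"
      by (subst lbN) auto
    also have "\<dots> = of_real (sqrt (2 * pi)) * fourier (\<lambda>y. of_real (?e y) * f y) t"
      by (simp add: gaussian_average_fourier[OF f])
    finally have 1: "2 * pi * (CLINT x|?N. exp (\<i> * of_real (t * x)) * ?g x) = of_real (sqrt (2 * pi)) * fourier (\<lambda>y. of_real (?e y) * f y) t" .
    have 2: "(CLINT x|?N. exp (\<i> * of_real (t * x)) * ?g x) = fourier (\<lambda>y. of_real (?e y) * ?g y) t / of_real (sqrt (2 * pi))"
      by (subst lbN) (auto simp: fourier_def mult.left_commute)
    have 3: "complex_of_real (2 * pi) = of_real (sqrt (2 * pi)) * of_real (sqrt (2 * pi))"
      by (simp flip: of_real_mult)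
    show ?thesis
      using 1 unfolding 2 3 by simp
  qed
  have "AE x in lborel. of_real (?e x) * ?g x - of_real (?e x) * f x = 0"
    using fe ge by (intro fourier_inj) (simp_all only: fourier_diff[OF ge fe] eq diff_self Bochner_Integration.integrable_diff)
  then show ?thesis
    by eventually_elim simp
qed

section \<open>One-sided smoothing with a kernel on the negative half-line\<close>

text \<open>Integral form of the remainder, whose weight
  \<open>(1 - t) ^ (s - 1) / fact (s - 1)\<close> is at most one. Steps \<open>h\<close> to the
  right stay inside the half-line of smoothness. The bound is kept as an extended integral because
  it is averaged over \<open>h\<close> afterwards.\<close>

lemma taylor_remainder_bound:
  fixes D :: "nat \<Rightarrow> real \<Rightarrow> real"
  assumes s: "0 < s"
    and D: "\<And>l x. l < s \<Longrightarrow> 0 < x \<Longrightarrow> (D l has_real_derivative D (Suc l) x) (at x)"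
    and cont: "continuous_on {0<..} (D s)"
    and x: "0 < x" and h: "0 \<le> h"
  shows "ennreal \<bar>D 0 (x + h) - (\<Sum>l<s. h ^ l / fact l * D l x)\<bar> \<le>
    (\<integral>\<^sup>+t. ennreal (h ^ s * \<bar>D s (x + t * h)\<bar>) * indicator {0..1} t \<partial>lborel)"
proof -
  define Df where "Df = (\<lambda>l t. h ^ l * D l (x + t * h))"
  define i where "i = (\<lambda>t. ((1 - t) ^ (s - 1) / fact (s - 1)) *\<^sub>R Df s t)"
  have pos: "0 < x + t * h" if "0 \<le> t" for t
    using x h that by (simp add: add_pos_nonneg)
  have deriv: "(Df m has_vector_derivative Df (Suc m) t) (at t within {0..1})" if "m < s" "0 \<le> t" "t \<le> 1" for m t
  proof -
    have "((\<lambda>t. D m (x + t * h)) has_real_derivative D (Suc m) (x + t * h) * h) (at t within {0..1})"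
      by (rule DERIV_chain2[where f = "D m" and g = "\<lambda>t. x + t * h", OF D[OF that(1) pos[OF that(2)]]])
        (auto intro!: derivative_eq_intros)
    from DERIV_cmult[OF this, of "h ^ m"] show ?thesis
      unfolding Df_def has_real_derivative_iff_has_vector_derivative[symmetric] by (simp add: mult_ac)
  qed
  have hi: "(i has_integral Df 0 1 - (\<Sum>l<s. ((1 - 0) ^ l / fact l) *\<^sub>R Df l 0)) {0..1}"
    unfolding i_def by (rule Taylor_has_integral) (use s deriv in auto)
  have "continuous_on {0..1} (\<lambda>t. D s (x + t * h))"
    by (rule continuous_on_compose2[OF cont]) (auto intro!: continuous_intros pos)
  then have "continuous_on {0..1} i"
    unfolding i_def Df_def by (intro continuous_intros) auto
  then have int: "set_integrable lborel {0..1} i"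
    by (rule borel_integrable_atLeastAtMost'[of 0 1 i])
  have "D 0 (x + h) - (\<Sum>l<s. h ^ l / fact l * D l x) = Df 0 1 - (\<Sum>l<s. ((1 - 0) ^ l / fact l) *\<^sub>R Df l 0)"
    by (simp add: Df_def)
  also have "\<dots> = integral {0..1} i"
    using hi by (simp add: has_integral_iff)
  also have "\<dots> = (LINT t:{0..1}|lborel. i t)"
    by (rule set_borel_integral_eq_integral(2)[OF int, symmetric])
  finally have eq: "D 0 (x + h) - (\<Sum>l<s. h ^ l / fact l * D l x) = (LINT t|lborel. indicator {0..1} t *\<^sub>R i t)"
    by (simp add: set_lebesgue_integral_def)
  have "ennreal (norm (LINT t|lborel. indicator {0..1} t *\<^sub>R i t)) \<le> (\<integral>\<^sup>+t. ennreal (norm (indicator {0..1} t *\<^sub>R i t)) \<partial>lborel)"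
    using int by (intro integral_norm_bound_ennreal) (simp add: set_integrable_def)
  also have "\<dots> \<le> (\<integral>\<^sup>+t. ennreal (h ^ s * \<bar>D s (x + t * h)\<bar>) * indicator {0..1} t \<partial>lborel)"
  proof (intro nn_integral_mono)
    fix t :: real
    have "\<bar>i t\<bar> \<le> h ^ s * \<bar>D s (x + t * h)\<bar>" if "t \<in> {0..1}"
    proof -
      have "(1 - t) ^ (s - 1) / fact (s - 1) \<le> 1 / 1"
        using that by (intro frac_le power_le_one) (auto simp: fact_ge_1)
      then have "(1 - t) ^ (s - 1) / fact (s - 1) * \<bar>Df s t\<bar> \<le> 1 * \<bar>Df s t\<bar>"
        by (intro mult_right_mono) auto
      then show ?thesis
        using that h by (simp add: i_def Df_def abs_mult)
    qed
    then show "ennreal (norm (indicator {0..1} t *\<^sub>R i t)) \<le> ennreal (h ^ s * \<bar>D s (x + t * h)\<bar>) * indicator {0..1} t"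
      by (auto simp: indicator_def intro!: ennreal_leI)
  qed
  finally show ?thesis
    using eq by simp
qed

text \<open>Only values of \<open>K\<close> to the right of \<open>x\<close> enter the smoothed function because the kernel
  lives on the negative half-line. Cauchy-Schwarz with respect to the weight \<open>|W y| |y / U|\<^sup>s\<close>
  replaces the Minkowski inequality for integrals.\<close>

lemma one_sided_bias:
  fixes D :: "nat \<Rightarrow> real \<Rightarrow> real" and K W :: "real \<Rightarrow> real"
  assumes s: "0 < s" and U: "0 < U"
    and D: "\<And>l x. l < s \<Longrightarrow> 0 < x \<Longrightarrow> (D l has_real_derivative D (Suc l) x) (at x)"
    and cont: "continuous_on {0<..} (D s)"
    and D0: "\<And>x. 0 < x \<Longrightarrow> D 0 x = K x"
    and K: "K \<in> borel_measurable borel"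
    and W: "integrable lborel W" "\<And>x. 0 < x \<Longrightarrow> W x = 0" "(LINT x|lborel. W x) = 1"
    and moments: "\<And>l. l < s \<Longrightarrow> integrable lborel (\<lambda>x. x ^ l * W x)"
      "\<And>l. l \<in> {1..<s} \<Longrightarrow> (LINT x|lborel. x ^ l * W x) = 0"
    and m: "(\<integral>\<^sup>+y. ennreal (\<bar>y\<bar> ^ s * \<bar>W y\<bar>) \<partial>lborel) \<le> ennreal m"
  shows "(\<integral>\<^sup>+x. ennreal (((LINT y|lborel. K (x - y / U) * W y) - K x)\<^sup>2) * indicator {0<..} x \<partial>lborel)
    \<le> ennreal ((m / U ^ s)\<^sup>2) * (\<integral>\<^sup>+x. ennreal ((D s x)\<^sup>2) * indicator {0<..} x \<partial>lborel)"
proof -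
  note [measurable] = K
  have [measurable]: "W \<in> borel_measurable borel"
    using borel_measurable_integrable[OF W(1)] by simp
  \<comment> \<open>Extension by zero makes translates of the top derivative meaningful on the whole
    line, as the change of variables below requires.\<close>
  define Ds where "Ds x = indicator {0<..} x * D s x" for x
  have Ds_meas [measurable]: "Ds \<in> borel_measurable borel"
  proof -
    have "(\<lambda>x. indicator {0<..} x *\<^sub>R D s x) \<in> borel_measurable borel"
      by (rule borel_measurable_continuous_on_indicator[OF _ cont]) simp
    then show ?thesis
      by (simp add: Ds_def[abs_def])
  qed
  let ?P = "lborel \<Otimes>\<^sub>M lborel :: (real \<times> real) measure"
  let ?a = "\<lambda>y. \<bar>y / U\<bar> ^ s * \<bar>W y\<bar>"
  let ?J = "\<integral>\<^sup>+x. ennreal ((D s x)\<^sup>2) * indicator {0<..} x \<partial>lborel"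
  have J: "?J = (\<integral>\<^sup>+x. ennreal ((Ds x)\<^sup>2) \<partial>lborel)"
    by (intro nn_integral_cong) (auto simp: Ds_def indicator_def)
  have a_int: "(\<integral>\<^sup>+y. ennreal (?a y) \<partial>lborel) \<le> ennreal (m / U ^ s)"
  proof -
    have "(\<integral>\<^sup>+y. ennreal (?a y) \<partial>lborel) = (\<integral>\<^sup>+y. ennreal (1 / U ^ s) * ennreal (\<bar>y\<bar> ^ s * \<bar>W y\<bar>) \<partial>lborel)"
      using U by (intro nn_integral_cong) (auto simp: power_divide abs_mult power_abs simp flip: ennreal_mult)
    also have "\<dots> = ennreal (1 / U ^ s) * (\<integral>\<^sup>+y. ennreal (\<bar>y\<bar> ^ s * \<bar>W y\<bar>) \<partial>lborel)"
      by (rule nn_integral_cmult) measurable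
    also have "\<dots> \<le> ennreal (1 / U ^ s) * ennreal m"
      by (intro mult_left_mono m) auto
    also have "\<dots> = ennreal (m / U ^ s)"
      using U by (simp flip: ennreal_mult')
    finally show ?thesis .
  qed
  let ?b = "\<lambda>x p. ennreal (?a (fst p) * (Ds (x - snd p * fst p / U))\<^sup>2) * indicator {0..1} (snd p)"
  have b_meas [measurable]: "(\<lambda>(x, p). ?b x p) \<in> borel_measurable (lborel \<Otimes>\<^sub>M ?P)"
    by measurable
  have pointwise: "ennreal (((LINT y|lborel. K (x - y / U) * W y) - K x)\<^sup>2) \<le> ennreal (m / U ^ s) * (\<integral>\<^sup>+p. ?b x p \<partial>?P)"
    if x: "0 < x" for x
  proof -
    \<comment> \<open>Taylor remainder of \<open>K\<close> at \<open>x\<close> for the step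
      \<open>- y / U\<close>. Subtracting the polynomial is free: its zeroth term integrates to
      \<open>K x\<close>, and the moment conditions remove the others.\<close>
    define \<rho> where "\<rho> y = K (x - y / U) - (\<Sum>l<s. (- y / U) ^ l / fact l * D l x)" for y
    have [measurable]: "\<rho> \<in> borel_measurable borel"
      unfolding \<rho>_def by measurable
    have poly: "(\<lambda>y. (\<Sum>l<s. (- y / U) ^ l / fact l * D l x) * W y) = (\<lambda>y. \<Sum>l<s. ((- 1 / U) ^ l / fact l * D l x) * (y ^ l * W y))"
    proof
      fix y
      have "(- y / U) ^ l = (- 1 / U) ^ l * y ^ l" for l
        by (simp flip: power_mult_distrib)
      then show "(\<Sum>l<s. (- y / U) ^ l / fact l * D l x) * W y = (\<Sum>l<s. ((- 1 / U) ^ l / fact l * D l x) * (y ^ l * W y))"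
        unfolding sum_distrib_right by (intro sum.cong) auto
    qed
    have poly_int: "integrable lborel (\<lambda>y. (\<Sum>l<s. (- y / U) ^ l / fact l * D l x) * W y)"
      unfolding poly by (intro Bochner_Integration.integrable_sum integrable_mult_right moments) auto
    have poly_val: "(LINT y|lborel. (\<Sum>l<s. (- y / U) ^ l / fact l * D l x) * W y) = K x"
    proof -
      have "(LINT y|lborel. (\<Sum>l<s. (- y / U) ^ l / fact l * D l x) * W y) = (\<Sum>l<s. ((- 1 / U) ^ l / fact l * D l x) * (LINT y|lborel. y ^ l * W y))"
        unfolding poly using moments(1) by (subst Bochner_Integration.integral_sum) auto
      also have "\<dots> = (\<Sum>l<s. if l = 0 then D 0 x else 0)"
        using moments(2) W(3) by (intro sum.cong) auto
      finally show ?thesis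
        using s D0[OF x] by simp
    qed
    define I where "I = (\<integral>\<^sup>+y. ennreal \<bar>W y * \<rho> y\<bar> \<partial>lborel)"
    have "ennreal \<bar>(LINT y|lborel. K (x - y / U) * W y) - K x\<bar> \<le> I"
    \<comment> \<open>If \<open>I\<close> is infinite the claim is trivial; otherwise the integral
      over \<open>y\<close> may be split into remainder and polynomial.\<close>
    proof (cases "I = \<infinity>")
      case False
      have int: "integrable lborel (\<lambda>y. W y * \<rho> y)"
        using False by (intro integrableI_bounded) (auto simp: I_def top.not_eq_extremum)
      have "(LINT y|lborel. W y * \<rho> y) = (LINT y|lborel. K (x - y / U) * W y) - K x"
      proof -
        have "(LINT y|lborel. K (x - y / U) * W y) = (LINT y|lborel. W y * \<rho> y + (\<Sum>l<s. (- y / U) ^ l / fact l * D l x) * W y)"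
          by (simp add: \<rho>_def algebra_simps)
        then show ?thesis
          using int poly_int poly_val by simp
      qed
      then show ?thesis
        using integral_norm_bound_ennreal[OF int] by (simp add: I_def)
    qed simp
    then have *: "(ennreal \<bar>(LINT y|lborel. K (x - y / U) * W y) - K x\<bar>)\<^sup>2 \<le> I\<^sup>2"
      by (intro power_mono) auto
    have "I \<le> (\<integral>\<^sup>+y. \<integral>\<^sup>+t. ennreal (?a y * \<bar>Ds (x - t * y / U)\<bar>) * indicator {0..1} t \<partial>lborel \<partial>lborel)"
      unfolding I_def
    proof (rule nn_integral_mono)
      fix y :: real
      show "ennreal \<bar>W y * \<rho> y\<bar> \<le> (\<integral>\<^sup>+t. ennreal (?a y * \<bar>Ds (x - t * y / U)\<bar>) * indicator {0..1} t \<partial>lborel)"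
      proof (cases "0 < y")
        case False
        then have h: "0 \<le> - y / U"
          using U by (simp add: divide_nonpos_pos)
        have pos: "0 < x + t * (- y / U)" if "0 \<le> t" for t
          using mult_nonneg_nonneg[OF that h] x by linarith
        have "ennreal \<bar>W y * \<rho> y\<bar> = ennreal \<bar>W y\<bar> * ennreal \<bar>D 0 (x + - y / U) - (\<Sum>l<s. (- y / U) ^ l / fact l * D l x)\<bar>"
          using D0[of "x + - y / U"] pos[of 1] by (simp add: abs_mult \<rho>_def flip: ennreal_mult)
        also have "\<dots> \<le> ennreal \<bar>W y\<bar> * (\<integral>\<^sup>+t. ennreal ((- y / U) ^ s * \<bar>D s (x + t * (- y / U))\<bar>) * indicator {0..1} t \<partial>lborel)"
          by (intro mult_left_mono taylor_remainder_bound[OF s D cont x h]) auto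
        also have "\<dots> = ennreal \<bar>W y\<bar> * (\<integral>\<^sup>+t. ennreal ((- y / U) ^ s * \<bar>Ds (x - t * y / U)\<bar>) * indicator {0..1} t \<partial>lborel)"
        proof (rule arg_cong2[where f = "(*)", OF refl], rule nn_integral_cong)
          fix t :: real
          have "Ds (x - t * y / U) = D s (x + t * (- y / U))" if "t \<in> {0..1}"
            using pos[of t] that by (simp add: Ds_def)
          then show "ennreal ((- y / U) ^ s * \<bar>D s (x + t * (- y / U))\<bar>) * indicator {0..1} t =
            ennreal ((- y / U) ^ s * \<bar>Ds (x - t * y / U)\<bar>) * indicator {0..1} t"
            by (cases "t \<in> {0..1}") auto
        qed
        also have "\<dots> = (\<integral>\<^sup>+t. ennreal \<bar>W y\<bar> * (ennreal ((- y / U) ^ s * \<bar>Ds (x - t * y / U)\<bar>) * indicator {0..1} t) \<partial>lborel)"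
          by (rule nn_integral_cmult[symmetric]) measurable
        also have "\<dots> = (\<integral>\<^sup>+t. ennreal (?a y * \<bar>Ds (x - t * y / U)\<bar>) * indicator {0..1} t \<partial>lborel)"
        proof (intro nn_integral_cong)
          fix t
          have "\<bar>y / U\<bar> = - y / U"
            using abs_of_nonneg[OF h] by (simp del: abs_divide)
          then have "ennreal (?a y * \<bar>Ds (x - t * y / U)\<bar>) = ennreal \<bar>W y\<bar> * ennreal ((- y / U) ^ s * \<bar>Ds (x - t * y / U)\<bar>)"
            using h by (simp add: mult_ac flip: ennreal_mult')
          then show "ennreal \<bar>W y\<bar> * (ennreal ((- y / U) ^ s * \<bar>Ds (x - t * y / U)\<bar>) * indicator {0..1} t) = ennreal (?a y * \<bar>Ds (x - t * y / U)\<bar>) * indicator {0..1} t"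
            by (simp add: mult.assoc)
        qed
        finally show ?thesis .
      qed (simp add: W(2))
    qed
    also have "\<dots> = (\<integral>\<^sup>+p. ennreal (?a (fst p) * \<bar>Ds (x - snd p * fst p / U)\<bar>) * indicator {0..1} (snd p) \<partial>?P)"
      by (subst lborel.nn_integral_fst[symmetric]) auto
    \<comment> \<open>Splitting the weight evenly prepares Cauchy-Schwarz: one factor integrates to
      the moment of the kernel, the other keeps the square of the derivative.\<close>
    also have "\<dots> = (\<integral>\<^sup>+p. (ennreal (sqrt (?a (fst p))) * indicator {0..1} (snd p)) * ennreal (sqrt (?a (fst p)) * \<bar>Ds (x - snd p * fst p / U)\<bar> * indicator {0..1} (snd p)) \<partial>?P)"
      by (intro nn_integral_cong) (auto simp: indicator_def simp flip: ennreal_mult')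
    finally have "I\<^sup>2 \<le> \<dots>\<^sup>2"
      by (simp add: power_mono)
    also have "\<dots> \<le> (\<integral>\<^sup>+p. (ennreal (sqrt (?a (fst p))) * indicator {0..1} (snd p))\<^sup>2 \<partial>?P) *
        (\<integral>\<^sup>+p. (ennreal (sqrt (?a (fst p)) * \<bar>Ds (x - snd p * fst p / U)\<bar> * indicator {0..1} (snd p)))\<^sup>2 \<partial>?P)"
      by (rule Cauchy_Schwarz_nn_integral) measurable
    also have "(\<integral>\<^sup>+p. (ennreal (sqrt (?a (fst p))) * indicator {0..1} (snd p))\<^sup>2 \<partial>?P) = (\<integral>\<^sup>+p. ennreal (?a (fst p)) * indicator {0..1} (snd p) \<partial>?P)"
      by (intro nn_integral_cong) (auto simp: indicator_def ennreal_power)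
    also have "\<dots> = (\<integral>\<^sup>+y. \<integral>\<^sup>+t. ennreal (?a y) * indicator {0..1::real} t \<partial>lborel \<partial>lborel)"
      by (subst lborel.nn_integral_fst[symmetric]) auto
    also have "\<dots> = (\<integral>\<^sup>+y. ennreal (?a y) \<partial>lborel)"
      by (simp add: nn_integral_cmult_indicator)
    also have "(\<integral>\<^sup>+p. (ennreal (sqrt (?a (fst p)) * \<bar>Ds (x - snd p * fst p / U)\<bar> * indicator {0..1} (snd p)))\<^sup>2 \<partial>?P) = (\<integral>\<^sup>+p. ?b x p \<partial>?P)"
      by (intro nn_integral_cong) (auto simp: indicator_def ennreal_power power_mult_distrib)
    also have "(\<integral>\<^sup>+y. ennreal (?a y) \<partial>lborel) * \<dots> \<le> ennreal (m / U ^ s) * \<dots>"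
      by (intro mult_right_mono a_int) auto
    finally show ?thesis
      using * by (simp add: ennreal_power)
  qed
  have "(\<integral>\<^sup>+x. ennreal (((LINT y|lborel. K (x - y / U) * W y) - K x)\<^sup>2) * indicator {0<..} x \<partial>lborel)
    \<le> (\<integral>\<^sup>+x. ennreal (m / U ^ s) * (\<integral>\<^sup>+p. ?b x p \<partial>?P) \<partial>lborel)"
    using pointwise by (intro nn_integral_mono) (auto simp: indicator_def)
  also have "\<dots> = ennreal (m / U ^ s) * (\<integral>\<^sup>+x. \<integral>\<^sup>+p. ?b x p \<partial>?P \<partial>lborel)"
    by (rule nn_integral_cmult) measurable
  also have "(\<integral>\<^sup>+x. \<integral>\<^sup>+p. ?b x p \<partial>?P \<partial>lborel) = (\<integral>\<^sup>+p. \<integral>\<^sup>+x. ?b x p \<partial>lborel \<partial>?P)"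
  proof -
    interpret pair_sigma_finite "lborel :: real measure" ?P
      by unfold_locales
    show ?thesis
      by (rule Fubini'[symmetric]) measurable
  qed
  \<comment> \<open>Translation in \<open>x\<close> does not change the integral of
    \<open>Ds\<close> squared, so this integral factors out for every \<open>p\<close>.\<close>
  also have "\<dots> = (\<integral>\<^sup>+p. ennreal (?a (fst p)) * indicator {0..1} (snd p) * ?J \<partial>?P)"
  proof (rule nn_integral_cong)
    fix p :: "real \<times> real"
    have "(\<integral>\<^sup>+x. ?b x p \<partial>lborel) = (\<integral>\<^sup>+x. (ennreal (?a (fst p)) * indicator {0..1} (snd p)) * ennreal ((Ds (- (snd p * fst p / U) + 1 * x))\<^sup>2) \<partial>lborel)"
      by (intro nn_integral_cong) (auto simp: ennreal_mult indicator_def)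
    also have "\<dots> = (ennreal (?a (fst p)) * indicator {0..1} (snd p)) * (\<integral>\<^sup>+x. ennreal ((Ds (- (snd p * fst p / U) + 1 * x))\<^sup>2) \<partial>lborel)"
      by (rule nn_integral_cmult) measurable
    also have "(\<integral>\<^sup>+x. ennreal ((Ds (- (snd p * fst p / U) + 1 * x))\<^sup>2) \<partial>lborel) = ?J"
      unfolding J by (subst (2) nn_integral_real_affine[where c = 1 and t = "- (snd p * fst p / U)"]) auto
    finally show "(\<integral>\<^sup>+x. ?b x p \<partial>lborel) = ennreal (?a (fst p)) * indicator {0..1} (snd p) * ?J" .
  qed
  also have "\<dots> = (\<integral>\<^sup>+p. ennreal (?a (fst p)) * indicator {0..1} (snd p) \<partial>?P) * ?J"
    by (rule nn_integral_multc) measurable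
  also have "(\<integral>\<^sup>+p. ennreal (?a (fst p)) * indicator {0..1} (snd p) \<partial>?P) = (\<integral>\<^sup>+y. \<integral>\<^sup>+t. ennreal (?a y) * indicator {0..1::real} t \<partial>lborel \<partial>lborel)"
    by (subst lborel.nn_integral_fst[symmetric]) auto
  also have "\<dots> = (\<integral>\<^sup>+y. ennreal (?a y) \<partial>lborel)"
    by (simp add: nn_integral_cmult_indicator)
  also have "ennreal (m / U ^ s) * (\<dots> * ?J) \<le> ennreal (m / U ^ s) * (ennreal (m / U ^ s) * ?J)"
    by (intro mult_left_mono mult_right_mono a_int) auto
  \<comment> \<open>A negative \<open>m\<close> is truncated to 0 by \<open>ennreal\<close>, hence
    the case distinction.\<close>
  also have "\<dots> \<le> ennreal ((m / U ^ s)\<^sup>2) * ?J"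
  proof (cases "0 \<le> m")
    case True
    then have "ennreal ((m / U ^ s)\<^sup>2) = ennreal (m / U ^ s) * ennreal (m / U ^ s)"
      unfolding power2_eq_square using U by (intro ennreal_mult) auto
    then show ?thesis
      by (simp only: mult.assoc order_refl)
  next
    case False
    then have "ennreal (m / U ^ s) = 0"
      using U by (simp add: ennreal_neg divide_nonpos_pos)
    then show ?thesis
      by simp
  qed
  finally show ?thesis .
qed


section \<open>Inverse transforms of scaled kernels and products\<close>

lemma inv_fourier_scaled_kernel:
  assumes U: "0 < U"
  shows "inv_fourier (\<lambda>u. G (u / U)) x = of_real U * inv_fourier G (U * x)"
  unfolding inv_fourier_def using U
  by (subst lborel_integral_real_affine[where c = U and t = 0]) (auto simp: scaleR_conv_of_real mult_ac)

lemma inv_fourier_add: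
  assumes "integrable lborel f" "integrable lborel g"
  shows "inv_fourier (\<lambda>u. f u + g u) x = inv_fourier f x + inv_fourier g x"
  unfolding inv_fourier_def
  using inv_fourier_integrable[OF assms(1)] inv_fourier_integrable[OF assms(2)]
  by (simp add: distrib_left add_divide_distrib)

lemma inv_fourier_cmult: "inv_fourier (\<lambda>u. c * f u) x = c * inv_fourier f x"
  unfolding inv_fourier_def by (simp add: mult.left_commute)

lemma integrable_fourier_mult:
  assumes K: "integrable lborel K" and G: "integrable lborel G"
  shows "integrable lborel (\<lambda>u. fourier K u * G u)"
proof (rule Bochner_Integration.integrable_bound)
  have [measurable]: "K \<in> borel_measurable borel" "G \<in> borel_measurable borel"
    using borel_measurable_integrable[OF K] borel_measurable_integrable[OF G] by simp_all
  show "integrable lborel (\<lambda>u. (LINT x|lborel. cmod (K x)) * cmod (G u))"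
    using G by simp
  show "(\<lambda>u. fourier K u * G u) \<in> borel_measurable lborel"
    by measurable
  show "AE u in lborel. cmod (fourier K u * G u) \<le> norm ((LINT x|lborel. cmod (K x)) * cmod (G u))"
    using fourier_norm_le[OF K] by (intro AE_I2) (simp add: norm_mult mult_right_mono)
qed

lemma inv_fourier_fourier_mult:
  assumes K: "integrable lborel K" and G: "integrable lborel G"
  shows "inv_fourier (\<lambda>u. fourier K u * G u) x = (CLINT y|lborel. K y * inv_fourier G (x - y))"
proof -
  have [measurable]: "K \<in> borel_measurable borel" "G \<in> borel_measurable borel"
    using borel_measurable_integrable[OF K] borel_measurable_integrable[OF G] by simp_all
  let ?E = "\<lambda>u y. exp (- \<i> * of_real (u * x)) * (exp (\<i> * of_real (u * y)) * K y * G u)"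
  have int: "integrable (lborel \<Otimes>\<^sub>M lborel) (\<lambda>(u, y). ?E u y)"
  proof (rule lborel_pair.Fubini_integrable)
    show "AE u in lborel. integrable lborel (\<lambda>y. case (u, y) of (u, y) \<Rightarrow> ?E u y)"
      using fourier_integrable[OF K] by (intro AE_I2) simp
  qed (use G in \<open>simp_all add: norm_mult del: of_real_mult\<close>)
  have "(CLINT u|lborel. exp (- \<i> * of_real (u * x)) * (fourier K u * G u)) = (CLINT u|lborel. CLINT y|lborel. ?E u y)"
    unfolding fourier_def by simp
  also have "\<dots> = (CLINT y|lborel. CLINT u|lborel. ?E u y)"
    using lborel_pair.Fubini_integral[OF int] by simp
  also have "\<dots> = (CLINT y|lborel. K y * (CLINT u|lborel. exp (- \<i> * of_real (u * (x - y))) * G u))"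
  proof (rule Bochner_Integration.integral_cong)
    fix y
    have "?E u y = K y * (exp (- \<i> * of_real (u * (x - y))) * G u)" for u
      by (simp add: algebra_simps exp_diff exp_minus divide_inverse)
    then show "(CLINT u|lborel. ?E u y) = K y * (CLINT u|lborel. exp (- \<i> * of_real (u * (x - y))) * G u)"
      by (simp only: integral_mult_right_zero)
  qed simp
  finally show ?thesis
    by (simp add: inv_fourier_def)
qed

lemma norm_add_square_le: "(norm (a + b))\<^sup>2 \<le> 2 * (norm a)\<^sup>2 + 2 * (norm b)\<^sup>2"
  for a b :: "'a::real_normed_vector"
proof -
  have "(norm (a + b))\<^sup>2 \<le> (norm a + norm b)\<^sup>2"
    by (intro power_mono norm_triangle_ineq) auto
  then show ?thesis
    using sum_squares_bound[of "norm a" "norm b"] by (simp add: power2_sum)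
qed

text \<open>The three summands of \<open>q\<close> contribute separately on \<open>x > 0\<close>:
  the constant produces a multiple of the scaled kernel, which vanishes there; the transform of
  \<open>K\<close> gives the kernel-smoothed \<open>K\<close>, controlled by
  \<open>one_sided_bias\<close>; the remainder is measured by Plancherel. The constant
  \<open>c\<close> thus leaves no trace in the bound.\<close>

lemma one_sided_estimate:
  fixes D :: "nat \<Rightarrow> real \<Rightarrow> real" and K W :: "real \<Rightarrow> real" and c :: complex
  assumes s: "0 < s" and U: "0 < U"
    and D: "\<And>l x. l < s \<Longrightarrow> 0 < x \<Longrightarrow> (D l has_real_derivative D (Suc l) x) (at x)"
    and cont: "continuous_on {0<..} (D s)"
    and D0: "\<And>x. 0 < x \<Longrightarrow> D 0 x = K x"
    and K: "integrable lborel K"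
    and W: "integrable lborel W" "\<And>x. 0 < x \<Longrightarrow> W x = 0" "(LINT x|lborel. W x) = 1"
    and moments: "\<And>l. l < s \<Longrightarrow> integrable lborel (\<lambda>x. x ^ l * W x)"
      "\<And>l. l \<in> {1..<s} \<Longrightarrow> (LINT x|lborel. x ^ l * W x) = 0"
    and m: "(\<integral>\<^sup>+y. ennreal (\<bar>y\<bar> ^ s * \<bar>W y\<bar>) \<partial>lborel) \<le> ennreal m"
    and FW: "integrable lborel (kernel_fourier W)"
    and r: "integrable lborel (\<lambda>u. r u * kernel_fourier W (u / U))"
    and q: "\<And>u. q u = c + fourier (\<lambda>x. of_real (K x)) u + r u"
  shows "(\<integral>\<^sup>+x. ennreal ((cmod (inv_fourier (\<lambda>u. q u * kernel_fourier W (u / U)) x - of_real (K x)))\<^sup>2) * indicator {0<..} x \<partial>lborel)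
    \<le> 2 * (ennreal ((m / U ^ s)\<^sup>2) * (\<integral>\<^sup>+x. ennreal ((D s x)\<^sup>2) * indicator {0<..} x \<partial>lborel)) +
      2 * (ennreal (1 / (2 * pi)) * (\<integral>\<^sup>+u. ennreal ((cmod (r u * kernel_fourier W (u / U)))\<^sup>2) \<partial>lborel))"
proof -
  have K_meas [measurable]: "K \<in> borel_measurable borel" and [measurable]: "W \<in> borel_measurable borel"
    using borel_measurable_integrable[OF K] borel_measurable_integrable[OF W(1)] by simp_all
  let ?W = "\<lambda>x. complex_of_real (W x)"
  let ?K = "\<lambda>x. complex_of_real (K x)"
  let ?G = "\<lambda>u. kernel_fourier W (u / U)"
  let ?w = "inv_fourier (kernel_fourier W)"
  let ?R = "inv_fourier (\<lambda>u. r u * ?G u)"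
  have [measurable]: "kernel_fourier W \<in> borel_measurable borel"
    using borel_measurable_integrable[OF FW] by simp
  have R_meas [measurable]: "?R \<in> borel_measurable borel"
    using borel_measurable_integrable[OF r] by (intro inv_fourier_measurable) simp
  have G_int: "integrable lborel ?G"
    using lborel_integrable_real_affine[OF FW, of "1 / U" 0] U by simp
  have Kc: "integrable lborel ?K"
    using K by simp
  \<comment> \<open>Inversion recovers the kernel almost everywhere only, so what follows about
    \<open>?w\<close> is stated almost everywhere or under an integral.\<close>
  have w_eq: "AE x in lborel. ?w x = ?W x"
    using fourier_inversion[of ?W] W(1) FW by (simp add: kernel_fourier_def)
  have G_inv: "inv_fourier ?G x = of_real U * ?w (U * x)" for x
    using U by (rule inv_fourier_scaled_kernel)
  have split: "inv_fourier (\<lambda>u. q u * ?G u) x = c * inv_fourier ?G x + inv_fourier (\<lambda>u. fourier ?K u * ?G u) x + ?R x" for x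
  proof -
    have "(\<lambda>u. q u * ?G u) = (\<lambda>u. (c * ?G u + fourier ?K u * ?G u) + r u * ?G u)"
      by (simp add: q algebra_simps)
    then show ?thesis
      using G_int integrable_fourier_mult[OF Kc G_int] r by (simp add: inv_fourier_add inv_fourier_cmult)
  qed
  have smooth: "inv_fourier (\<lambda>u. fourier ?K u * ?G u) x = of_real (LINT y|lborel. K (x - y / U) * W y)" for x
  proof -
    have "inv_fourier (\<lambda>u. fourier ?K u * ?G u) x = (CLINT y|lborel. ?K y * (of_real U * ?w (U * (x - y))))"
      unfolding inv_fourier_fourier_mult[OF Kc G_int] G_inv ..
    also have "\<dots> = (CLINT y|lborel. ?K (x - y / U) * ?w y)"
      using U by (subst lborel_integral_real_affine[where c = "- 1 / U" and t = x])
        (auto simp: scaleR_conv_of_real simp flip: integral_mult_right_zero)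
    also have "\<dots> = (CLINT y|lborel. ?K (x - y / U) * ?W y)"
      by (rule integral_cong_AE) (use w_eq in \<open>auto elim!: eventually_mono\<close>)
    also have "\<dots> = of_real (LINT y|lborel. K (x - y / U) * W y)"
      by (simp flip: of_real_mult)
    finally show ?thesis .
  qed
  have vanish: "AE x in lborel. 0 < x \<longrightarrow> inv_fourier ?G x = 0"
  proof -
    have "AE x in lborel. ?w (0 + U * x) = ?W (0 + U * x)"
      using U by (intro AE_borel_affine[OF _ _ w_eq]) auto
    then show ?thesis
      by eventually_elim (use U W(2) in \<open>auto simp: G_inv\<close>)
  qed
  define b where "b x = (LINT y|lborel. K (x - y / U) * W y) - K x" for x
  have [measurable]: "b \<in> borel_measurable borel"
    unfolding b_def by measurable
  have "(\<integral>\<^sup>+x. ennreal ((cmod (inv_fourier (\<lambda>u. q u * ?G u) x - ?K x))\<^sup>2) * indicator {0<..} x \<partial>lborel)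
     \<le> (\<integral>\<^sup>+x. 2 * (ennreal ((b x)\<^sup>2) * indicator {0<..} x) + 2 * ennreal ((cmod (?R x))\<^sup>2) \<partial>lborel)"
  proof (rule nn_integral_mono_AE, rule AE_mp[OF vanish], intro AE_I2 impI)
    fix x :: real assume van: "0 < x \<longrightarrow> inv_fourier ?G x = 0"
    show "ennreal ((cmod (inv_fourier (\<lambda>u. q u * ?G u) x - ?K x))\<^sup>2) * indicator {0<..} x
       \<le> 2 * (ennreal ((b x)\<^sup>2) * indicator {0<..} x) + 2 * ennreal ((cmod (?R x))\<^sup>2)"
    proof (cases "0 < x")
      case True
      then have "inv_fourier (\<lambda>u. q u * ?G u) x - ?K x = of_real (b x) + ?R x"
        using van by (simp add: split smooth b_def)
      then have "(cmod (inv_fourier (\<lambda>u. q u * ?G u) x - ?K x))\<^sup>2 \<le> 2 * (b x)\<^sup>2 + 2 * (cmod (?R x))\<^sup>2"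
        using norm_add_square_le[of "complex_of_real (b x)" "?R x"] by simp
      then have "ennreal ((cmod (inv_fourier (\<lambda>u. q u * ?G u) x - ?K x))\<^sup>2) \<le> ennreal (2 * (b x)\<^sup>2 + 2 * (cmod (?R x))\<^sup>2)"
        by (rule ennreal_leI)
      also have "\<dots> = 2 * ennreal ((b x)\<^sup>2) + 2 * ennreal ((cmod (?R x))\<^sup>2)"
        by (simp add: ennreal_mult)
      finally show ?thesis
        using True by simp
    qed simp
  qed
  also have "\<dots> = 2 * (\<integral>\<^sup>+x. ennreal ((b x)\<^sup>2) * indicator {0<..} x \<partial>lborel) + 2 * (\<integral>\<^sup>+x. ennreal ((cmod (?R x))\<^sup>2) \<partial>lborel)"
    by (simp add: nn_integral_add nn_integral_cmult)
  also have "\<dots> \<le> 2 * (ennreal ((m / U ^ s)\<^sup>2) * (\<integral>\<^sup>+x. ennreal ((D s x)\<^sup>2) * indicator {0<..} x \<partial>lborel)) +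
      2 * (ennreal (1 / (2 * pi)) * (\<integral>\<^sup>+u. ennreal ((cmod (r u * ?G u))\<^sup>2) \<partial>lborel))"
    unfolding b_def
    by (intro add_mono mult_left_mono plancherel_le[OF r] one_sided_bias[OF s U D cont D0 K_meas W moments m]) auto
  finally show ?thesis .
qed

section \<open>Exponents of Levy type on a strip\<close>

text \<open>Differentiation under the integral sign by dominated convergence of the normalised
  remainder, with dominator \<open>2 * g\<close>. The parameter ranges over a normed space because
  both complex arguments (holomorphy on the strip) and real frequencies occur.\<close>

lemma has_derivative_integral:
  fixes f :: "'k::real_normed_vector \<Rightarrow> 'a \<Rightarrow> complex"
  assumes d: "0 < d"
    and int: "\<And>h. norm h < d \<Longrightarrow> integrable M (f (z + h))"
    and int': "\<And>h. integrable M (\<lambda>x. f' x h)"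
    and lin: "bounded_linear (\<lambda>h. LINT x|M. f' x h)"
    and der: "\<And>x. ((\<lambda>z. f z x) has_derivative f' x) (at z)"
    and lip: "\<And>x h. norm h < d \<Longrightarrow> cmod (f (z + h) x - f z x) \<le> g x * norm h"
    and lip': "\<And>x h. cmod (f' x h) \<le> g x * norm h"
    and g: "integrable M g"
  shows "((\<lambda>z. LINT x|M. f z x) has_derivative (\<lambda>h. LINT x|M. f' x h)) (at z)"
  unfolding has_derivative_at
proof
  let ?e = "\<lambda>h x. norm (f (z + h) x - f z x - f' x h) / norm h"
  have int0: "integrable M (f z)"
    using int[of 0] d by simp
  have e_int: "integrable M (?e h)" if "norm h < d" for h
    using int[OF that] int0 int'[of h] by auto
  have "((\<lambda>h. LINT x|M. ?e h x) \<longlongrightarrow> 0) (at 0 within ball 0 d)"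
    unfolding tendsto_at_iff_sequentially
  proof (intro allI impI)
    fix X :: "nat \<Rightarrow> 'k"
    assume X: "\<forall>i. X i \<in> ball 0 d - {0}" and lim: "X \<longlonglongrightarrow> 0"
    have Xd: "norm (X n) < d" "X n \<noteq> 0" for n
      using X[rule_format, of n] by auto
    have "(\<lambda>n. LINT x|M. ?e (X n) x) \<longlonglongrightarrow> (LINT x|M. 0)"
    proof (rule integral_dominated_convergence[where w = "\<lambda>x. 2 * g x"])
      show "AE x in M. (\<lambda>n. ?e (X n) x) \<longlonglongrightarrow> 0"
      proof (rule AE_I2)
        fix x
        have "((\<lambda>h. ?e h x) \<longlongrightarrow> 0) (at 0)"
          using der[of x] unfolding has_derivative_at by blast
        moreover have "filterlim X (at 0) sequentially"
          using lim Xd(2) by (intro filterlim_atI) auto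
        ultimately show "(\<lambda>n. ?e (X n) x) \<longlonglongrightarrow> 0"
          by (rule filterlim_compose)
      qed
      show "AE x in M. norm (?e (X n) x) \<le> 2 * g x" for n
      proof (rule AE_I2)
        fix x
        have "norm (f (z + X n) x - f z x - f' x (X n)) \<le> 2 * g x * norm (X n)"
          using norm_triangle_ineq4[of "f (z + X n) x - f z x" "f' x (X n)"] lip[where h = "X n" and x = x, OF Xd(1)] lip'[where h = "X n" and x = x] by linarith
        then show "norm (?e (X n) x) \<le> 2 * g x"
          using Xd(2)[of n] by (simp add: divide_le_eq)
      qed
      show "integrable M (\<lambda>x. 2 * g x)"
        using g by simp
      show "?e (X n) \<in> borel_measurable M" for n
        using e_int[OF Xd(1)[of n]] by (rule borel_measurable_integrable)
    qed simp
    then show "((\<lambda>h. LINT x|M. ?e h x) \<circ> X) \<longlonglongrightarrow> 0"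
      by (simp add: o_def)
  qed
  then have e_lim: "((\<lambda>h. LINT x|M. ?e h x) \<longlongrightarrow> 0) (at 0)"
    using d by (simp add: at_within_open[OF _ open_ball])
  show "(\<lambda>h. norm ((LINT x|M. f (z + h) x) - (LINT x|M. f z x) - (LINT x|M. f' x h)) / norm h) \<midarrow>0\<rightarrow> 0"
  proof (rule Lim_null_comparison[OF _ e_lim])
    have "norm (norm ((LINT x|M. f (z + h) x) - (LINT x|M. f z x) - (LINT x|M. f' x h)) / norm h) \<le> (LINT x|M. ?e h x)"
      if "norm h < d" for h
    proof -
      have "(LINT x|M. f (z + h) x) - (LINT x|M. f z x) - (LINT x|M. f' x h) = (LINT x|M. f (z + h) x - f z x - f' x h)"
        using int[OF that] int0 int'[of h] by simp
      also have "norm \<dots> \<le> (LINT x|M. norm (f (z + h) x - f z x - f' x h))"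
        by (rule integral_norm_bound)
      finally show ?thesis
        by (simp add: divide_right_mono)
    qed
    then show "\<forall>\<^sub>F h in at 0. norm (norm ((LINT x|M. f (z + h) x) - (LINT x|M. f z x) - (LINT x|M. f' x h)) / norm h) \<le> (LINT x|M. ?e h x)"
      unfolding eventually_at using d by (intro exI[of _ d]) auto
  qed
qed (rule lin)

lemma norm_exp_diff_one_le: "cmod (exp z - 1) \<le> cmod z * exp (cmod z)"
proof -
  have "cmod (exp z - exp 0) \<le> exp (cmod z) * cmod (z - 0)"
  proof (rule field_differentiable_bound[where S = "cball 0 (cmod z)" and f' = exp])
    show "(exp has_field_derivative exp x) (at x within cball 0 (cmod z))" for x :: complex
      by (rule DERIV_subset[OF DERIV_exp]) simp
    fix x :: complex assume "x \<in> cball 0 (cmod z)"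
    then show "cmod (exp x) \<le> exp (cmod z)"
      using norm_exp[of x] by (meson exp_le_cancel_iff mem_cball_0 order_trans)
  qed auto
  then show ?thesis
    by (simp add: mult.commute)
qed

text \<open>Common setting for the Levy measure and for the law of the log-price: the object studied
  is the integral of \<open>(exp (- \<i> * z * x) - 1) * w x\<close>. The sign puts the strip
  \<open>0 \<le> Im z \<le> 1\<close> into the upper half-plane, ready for reflection at the real
  line. There \<open>|exp (- \<i> * z * x)| = exp (Im z * x)\<close>, so the exponential moment
  concerns the right tail only.\<close>

locale levy_density =
  fixes M :: "real measure" and w :: "real \<Rightarrow> real"
  assumes sets_M: "sets M = sets borel"
    and w_meas: "w \<in> borel_measurable borel" and w_nonneg: "\<And>x. 0 \<le> w x"
    and w_int: "integrable M (\<lambda>x. min 1 \<bar>x\<bar> * w x)"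
    and w_exp: "integrable M (\<lambda>x. indicator {1<..} x * exp x * w x)"
begin

definition H :: "real \<Rightarrow> real" where
  "H x = min 1 \<bar>x\<bar> * w x + indicator {1<..} x * exp x * w x"

lemma levy_dominator_int: "integrable M H"
  unfolding H_def[abs_def] using w_int w_exp by simp

lemma levy_integrand_measurable: "(\<lambda>x. (exp (- \<i> * z * of_real x) - 1) * of_real (w x)) \<in> borel_measurable M"
  using w_meas by (simp add: measurable_cong_sets[OF sets_M refl])

text \<open>Small jumps use \<open>|exp v - 1| \<le> |v| * exp |v|\<close>, large ones the triangle
  inequality. One dominator serves all \<open>z\<close> of bounded modulus in the closed strip,
  which gives continuity up to the edges.\<close>

lemma levy_integrand_bound:
  assumes z: "0 \<le> Im z" "Im z \<le> 1" "cmod z \<le> \<rho>"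
  shows "cmod ((exp (- \<i> * z * of_real x) - 1) * of_real (w x)) \<le> (\<rho> * exp \<rho> + 2) * H x"
proof -
  have \<rho>: "0 \<le> \<rho>"
    using z(3) norm_ge_zero order_trans by blast
  have "cmod (exp (- \<i> * z * of_real x) - 1) \<le> (\<rho> * exp \<rho> + 2) * (min 1 \<bar>x\<bar> + indicator {1<..} x * exp x)"
  proof (cases "\<bar>x\<bar> \<le> 1")
    case True
    have zx: "cmod (- \<i> * z * of_real x) \<le> \<rho> * \<bar>x\<bar>"
      using z by (simp add: norm_mult mult_right_mono)
    have "\<rho> * \<bar>x\<bar> \<le> \<rho>"
      using True \<rho> by (simp add: mult_left_le)
    then have "exp (cmod (- \<i> * z * of_real x)) \<le> exp \<rho>"
      using zx by simp
    then have "cmod (exp (- \<i> * z * of_real x) - 1) \<le> (\<rho> * \<bar>x\<bar>) * exp \<rho>"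
      using zx \<rho> by (intro order_trans[OF norm_exp_diff_one_le] mult_mono) auto
    also have "\<dots> \<le> (\<rho> * exp \<rho> + 2) * \<bar>x\<bar>"
      by (simp add: algebra_simps)
    finally show ?thesis
      using True by (cases "1 < x") auto
  next
    case False
    have "cmod (exp (- \<i> * z * of_real x) - 1) \<le> exp (Im z * x) + 1"
      using norm_triangle_ineq4[of "exp (- \<i> * z * of_real x)" 1] by (simp add: norm_exp_eq_Re)
    also have "\<dots> \<le> 2 * (min 1 \<bar>x\<bar> + indicator {1<..} x * exp x)"
    proof (cases "1 < x")
      case True
      then have "Im z * x \<le> x"
        using z by (simp add: mult_left_le_one_le)
      then have "exp (Im z * x) \<le> exp x" by simp
      moreover have "e + 1 \<le> 2 * (1 + E)" if "e \<le> E" "0 \<le> E" for e E :: real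
        using that by (simp add: distrib_left)
      ultimately have "exp (Im z * x) + 1 \<le> 2 * (1 + exp x)"
        using exp_ge_zero by blast
      moreover have "min 1 \<bar>x\<bar> + indicator {1<..} x * exp x = 1 + exp x"
        using True by simp
      ultimately show ?thesis
        by (simp only:)
    next
      case False
      then have "x < -1"
        using \<open>\<not> \<bar>x\<bar> \<le> 1\<close> by linarith
      then have "exp (Im z * x) \<le> 1"
        unfolding exp_le_one_iff using z by (intro mult_nonneg_nonpos) auto
      then have "exp (Im z * x) + 1 \<le> 2"
        by (rule order_trans[OF add_right_mono]) simp
      then show ?thesis
        using \<open>x < -1\<close> by simp
    qed
    also have "\<dots> \<le> (\<rho> * exp \<rho> + 2) * (min 1 \<bar>x\<bar> + indicator {1<..} x * exp x)"
    proof (rule mult_right_mono)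
      show "2 \<le> \<rho> * exp \<rho> + 2"
        using mult_nonneg_nonneg[OF \<rho> exp_ge_zero[of \<rho>]] by simp
    qed auto
    finally show ?thesis .
  qed
  note mult_right_mono[OF this w_nonneg[of x]]
  moreover have "(\<rho> * exp \<rho> + 2) * (min 1 \<bar>x\<bar> + indicator {1<..} x * exp x) * w x = (\<rho> * exp \<rho> + 2) * H x"
    by (simp add: H_def distrib_right)
  moreover have "cmod (of_real (w x)) = w x"
    by (simp add: w_nonneg)
  ultimately show ?thesis
    unfolding norm_mult by (simp only:)
qed

lemma levy_integrable:
  assumes "0 \<le> Im z" "Im z \<le> 1"
  shows "integrable M (\<lambda>x. (exp (- \<i> * z * of_real x) - 1) * of_real (w x))"
proof (rule Bochner_Integration.integrable_bound)
  show "integrable M (\<lambda>x. (cmod z * exp (cmod z) + 2) * H x)"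
    using levy_dominator_int by simp
  show "AE x in M. cmod ((exp (- \<i> * z * of_real x) - 1) * of_real (w x)) \<le> norm ((cmod z * exp (cmod z) + 2) * H x)"
    by (intro AE_I2, unfold real_norm_def, rule order_trans[OF levy_integrand_bound[OF assms order_refl] abs_ge_self])
qed (rule levy_integrand_measurable)

lemma levy_continuous:
  "continuous_on {z. 0 \<le> Im z \<and> Im z \<le> 1} (\<lambda>z. CLINT x|M. (exp (- \<i> * z * of_real x) - 1) * of_real (w x))"
  unfolding continuous_on_sequentially
proof (intro allI impI ballI)
  fix X and z assume z: "z \<in> {z. 0 \<le> Im z \<and> Im z \<le> 1}"
    and X: "(\<forall>n. X n \<in> {z. 0 \<le> Im z \<and> Im z \<le> 1}) \<and> X \<longlonglongrightarrow> z"
  from X have "Bseq X"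
    using convergentI convergent_imp_Bseq by blast
  then obtain \<rho> where \<rho>: "\<And>n. cmod (X n) \<le> \<rho>"
    by (auto simp: Bseq_def)
  have "(\<lambda>n. CLINT x|M. (exp (- \<i> * X n * of_real x) - 1) * of_real (w x)) \<longlonglongrightarrow> (CLINT x|M. (exp (- \<i> * z * of_real x) - 1) * of_real (w x))"
  proof (rule integral_dominated_convergence[where w = "\<lambda>x. (\<rho> * exp \<rho> + 2) * H x"])
    show "integrable M (\<lambda>x. (\<rho> * exp \<rho> + 2) * H x)"
      using levy_dominator_int by simp
    show "AE x in M. (\<lambda>n. (exp (- \<i> * X n * of_real x) - 1) * of_real (w x)) \<longlonglongrightarrow> (exp (- \<i> * z * of_real x) - 1) * of_real (w x)"
      using X by (intro AE_I2 tendsto_intros) auto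
    show "AE x in M. cmod ((exp (- \<i> * X n * of_real x) - 1) * of_real (w x)) \<le> (\<rho> * exp \<rho> + 2) * H x" for n
      using X levy_integrand_bound[of "X n" \<rho>] \<rho> by (intro AE_I2) auto
  qed (rule levy_integrand_measurable)+
  then show "((\<lambda>z. CLINT x|M. (exp (- \<i> * z * of_real x) - 1) * of_real (w x)) \<circ> X) \<longlonglongrightarrow>
      (CLINT x|M. (exp (- \<i> * z * of_real x) - 1) * of_real (w x))"
    by (simp add: o_def)
qed


text \<open>Differentiation brings down a factor \<open>|x|\<close>. At distance \<open>a\<close>
  from both edges it is absorbed by the spare exponential decay,
  \<open>t * exp (- (a * t)) \<le> 1 / a\<close>; the constant blows up at the edges, so holomorphy
  is claimed for the open strip.\<close>

lemma levy_deriv_bound: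
  assumes a: "0 < a" "a \<le> Im z" "Im z \<le> 1 - a"
  shows "cmod (- \<i> * of_real x * exp (- \<i> * z * of_real x) * of_real (w x)) \<le> (exp 1 + 1 / a) * H x"
proof -
  have xe: "t * exp (- (a * t)) \<le> 1 / a" if "0 \<le> t" for t
  proof -
    have "a * t \<le> exp (a * t)"
      using exp_ge_add_one_self[of "a * t"] by linarith
    then show ?thesis
      using a by (simp add: exp_minus field_simps)
  qed
  have "\<bar>x\<bar> * exp (Im z * x) \<le> (exp 1 + 1 / a) * (min 1 \<bar>x\<bar> + indicator {1<..} x * exp x)"
  proof -
    consider "\<bar>x\<bar> \<le> 1" | "1 < x" | "x < -1"
      by linarith
    then show ?thesis
    proof cases
      case 1
      have "Im z * x \<le> \<bar>Im z * x\<bar>" by simp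
      also have "\<dots> \<le> 1 * 1"
        unfolding abs_mult using a 1 by (intro mult_mono) auto
      finally have "\<bar>x\<bar> * exp (Im z * x) \<le> \<bar>x\<bar> * exp 1"
        by (intro mult_left_mono) auto
      also have "\<dots> \<le> (exp 1 + 1 / a) * \<bar>x\<bar>"
        using a by (simp add: algebra_simps)
      finally show ?thesis
        using 1 by (cases "1 < x") auto
    next
      case 2
      have "\<bar>x\<bar> * exp (Im z * x) \<le> x * exp ((1 - a) * x)"
        using 2 a by (auto intro!: mult_left_mono mult_right_mono)
      also have "\<dots> = x * exp (- (a * x)) * exp x"
        by (simp add: algebra_simps flip: exp_add)
      also have "\<dots> \<le> 1 / a * exp x"
        using 2 by (intro mult_right_mono xe) auto
      also have "\<dots> \<le> (exp 1 + 1 / a) * (1 + exp x)"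
        using a by (intro mult_mono) auto
      finally show ?thesis
        using 2 by simp
    next
      case 3
      have "Im z * x \<le> - (a * - x)"
        using 3 a mult_right_mono_neg[of a "Im z" x] by simp
      then have "\<bar>x\<bar> * exp (Im z * x) \<le> - x * exp (- (a * - x))"
        using 3 by simp
      also have "\<dots> \<le> 1 / a"
        using 3 by (intro xe) auto
      also have "\<dots> \<le> (exp 1 + 1 / a)"
        by simp
      finally show ?thesis
        using 3 by simp
    qed
  qed
  from mult_right_mono[OF this w_nonneg[of x]] show ?thesis
    by (simp add: norm_mult norm_exp_eq_Re H_def algebra_simps abs_of_nonneg[OF w_nonneg])
qed

lemma levy_holomorphic:
  "(\<lambda>z. CLINT x|M. (exp (- \<i> * z * of_real x) - 1) * of_real (w x)) holomorphic_on {z. 0 < Im z \<and> Im z < 1}"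
proof -
  let ?f = "\<lambda>z x. (exp (- \<i> * z * of_real x) - 1) * of_real (w x)"
  let ?p = "\<lambda>z x. - \<i> * of_real x * exp (- \<i> * z * of_real x) * of_real (w x)"
  have "((\<lambda>z. CLINT x|M. ?f z x) has_field_derivative (CLINT x|M. ?p z x)) (at z)" if z: "0 < Im z" "Im z < 1" for z
  proof -
    \<comment> \<open>Half the distance to the edges: the ball of radius \<open>a\<close> around
      \<open>z\<close> then keeps distance \<open>a\<close> from them.\<close>
    define a where "a = min (Im z) (1 - Im z) / 2"
    have a: "0 < a" "2 * a \<le> Im z" "Im z \<le> 1 - 2 * a"
      using z by (auto simp: a_def)
    have ball: "a \<le> Im y \<and> Im y \<le> 1 - a" if "y \<in> ball z a" for y
      using abs_Im_le_cmod[of "z - y"] that a by (auto simp: dist_norm)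
    have der: "((\<lambda>z. ?f z x) has_field_derivative ?p y x) (at y within A)" for y x A
      by (auto intro!: derivative_eq_intros)
    have p_meas: "?p y \<in> borel_measurable M" for y
      using w_meas by (simp add: measurable_cong_sets[OF sets_M refl])
    have p_int: "integrable M (?p z)"
    proof (rule Bochner_Integration.integrable_bound)
      show "integrable M (\<lambda>x. (exp 1 + 1 / a) * H x)"
        using levy_dominator_int by simp
      show "AE x in M. cmod (?p z x) \<le> norm ((exp 1 + 1 / a) * H x)"
        by (intro AE_I2, unfold real_norm_def, rule order_trans[OF levy_deriv_bound abs_ge_self]) (use a in auto)
    qed (rule p_meas)
    have "((\<lambda>z. CLINT x|M. ?f z x) has_derivative (\<lambda>h. CLINT x|M. ?p z x * h)) (at z)"
    proof (rule has_derivative_integral[where d = a and g = "\<lambda>x. (exp 1 + 1 / a) * H x"])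
      show "integrable M (?f (z + h))" if "norm h < a" for h
        using ball[of "z + h"] that a by (intro levy_integrable) (auto simp: dist_norm)
      show "((\<lambda>z. ?f z x) has_derivative (\<lambda>h. ?p z x * h)) (at z)" for x
        using der[of x z UNIV] unfolding has_field_derivative_def .
      show "cmod (?f (z + h) x - ?f z x) \<le> (exp 1 + 1 / a) * H x * norm h" if "norm h < a" for h x
      proof -
        have "cmod (?f (z + h) x - ?f z x) \<le> (exp 1 + 1 / a) * H x * cmod (z + h - z)"
        proof (rule field_differentiable_bound[where S = "ball z a" and f' = "\<lambda>y. ?p y x"])
          show "cmod (?p y x) \<le> (exp 1 + 1 / a) * H x" if "y \<in> ball z a" for y
            using ball[OF that] a by (intro levy_deriv_bound) auto
          show "z + h \<in> ball z a" "z \<in> ball z a"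
            using that a by (simp_all add: dist_norm)
        qed (rule convex_ball, rule der)
        then show ?thesis by simp
      qed
      show "cmod (?p z x * h) \<le> (exp 1 + 1 / a) * H x * norm h" for h x
        unfolding norm_mult[of _ h] using a by (intro mult_right_mono levy_deriv_bound) auto
      show "bounded_linear (\<lambda>h. CLINT x|M. ?p z x * h)"
        unfolding integral_mult_left_zero by (rule bounded_linear_mult_right)
    qed (use a p_int levy_dominator_int in auto)
    then show ?thesis
      unfolding integral_mult_left_zero has_field_derivative_def .
  qed
  moreover have "open {z. 0 < Im z \<and> Im z < 1}"
    unfolding Collect_conj_eq by (intro open_Int open_halfspace_Im_gt open_halfspace_Im_lt)
  ultimately show ?thesis
    by (subst holomorphic_on_open) blast+
qed

end

text \<open>Two functions that agree on the lower edge of the strip agree on its closure: by reflection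
  their difference is holomorphic across the real line, where it vanishes.\<close>

lemma strip_uniqueness:
  assumes hol: "f holomorphic_on {z. 0 < Im z \<and> Im z < 1}"
    and cont: "continuous_on {z. 0 \<le> Im z \<and> Im z \<le> 1} f"
    and zero: "\<And>z. Im z = 0 \<Longrightarrow> f z = 0"
    and z: "0 \<le> Im z" "Im z \<le> 1"
  shows "f z = 0"
proof -
  let ?S = "{z. -1 < Im z} \<inter> {z. Im z < 1}"
  define F where "F z = (if 0 \<le> Im z then f z else cnj (f (cnj z)))" for z
  have op: "open ?S"
    by (intro open_Int open_halfspace_Im_gt open_halfspace_Im_lt)
  have F_hol: "F holomorphic_on ?S"
    unfolding F_def[abs_def]
  proof (rule Schwarz_reflection[OF op])
    show "cnj ` ?S \<subseteq> ?S" by auto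
    show "f holomorphic_on ?S \<inter> {z. 0 < Im z}"
      by (rule holomorphic_on_subset[OF hol]) auto
    show "continuous_on (?S \<inter> {z. 0 \<le> Im z}) f"
      by (rule continuous_on_subset[OF cont]) auto
    show "f z \<in> \<real>" if "z \<in> \<real>" for z
      using zero[of z] that by (simp add: complex_is_Real_iff)
  qed
  have inner: "f z = 0" if "0 \<le> Im z" "Im z < 1" for z
  proof -
    have "F z = 0"
    proof (rule analytic_continuation[OF F_hol op])
      show "connected ?S"
        by (intro convex_connected convex_Int convex_halfspace_Im_gt convex_halfspace_Im_lt)
      show "{z. Im z = 0} \<subseteq> ?S" by auto
      show "0 islimpt {z. Im z = 0}"
        unfolding islimpt_approachable
      proof (intro allI impI)
        fix e :: real assume "0 < e"
        then show "\<exists>x'\<in>{z. Im z = 0}. x' \<noteq> 0 \<and> dist x' 0 < e"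
          by (intro bexI[of _ "of_real (e / 2)"]) auto
      qed
      show "F z = 0" if "z \<in> {z. Im z = 0}" for z
        using zero that by (simp add: F_def)
    qed (use that in auto)
    then show ?thesis
      using that by (simp add: F_def)
  qed
  show ?thesis
  proof (cases "Im z < 1")
    case True
    then show ?thesis using inner z by simp
  next
    case False
    \<comment> \<open>The upper edge lies outside the domain of reflection and is reached by
      continuity from below.\<close>
    let ?X = "\<lambda>n. z - \<i> * of_real (1 / real (Suc n))"
    have X: "?X \<longlonglongrightarrow> z - \<i> * of_real 0"
      by (intro tendsto_intros LIMSEQ_Suc[OF lim_1_over_n])
    have "(f \<circ> ?X) \<longlonglongrightarrow> f z"
      by (rule cont[unfolded continuous_on_sequentially, rule_format]) (use X False z in auto)
    moreover have "f (?X n) = 0" for n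
      using False z by (intro inner) auto
    ultimately have "(\<lambda>n::nat. 0) \<longlonglongrightarrow> f z"
      by (simp only: o_def)
    then show ?thesis
      by (simp add: LIMSEQ_const_iff)
  qed
qed

lemma norm_iexp_diff_le: "cmod (exp (\<i> * of_real a) - exp (\<i> * of_real b)) \<le> \<bar>a - b\<bar>"
proof -
  have "exp (\<i> * of_real a) - exp (\<i> * of_real b) = exp (\<i> * of_real b) * (iexp (a - b) - 1)"
    by (simp add: algebra_simps exp_diff)
  then have "cmod (exp (\<i> * of_real a) - exp (\<i> * of_real b)) = cmod (iexp (a - b) - 1)"
    by (simp add: norm_mult)
  also have "\<dots> \<le> \<bar>a - b\<bar>"
    using iexp_approx1[of "a - b" 0] by simp
  finally show ?thesis .
qed

section \<open>The law of the log-price\<close>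

lemma exp_le_one_plus: "exp y \<le> 1 + exp (2 * y)" for y :: real
proof -
  have "exp (2 * y) = exp y * exp y"
    by (simp flip: exp_add)
  moreover have "t \<le> 1 + t * t" if "0 \<le> t" for t :: real
    using sum_squares_bound[of 1 t] that by (simp add: power2_eq_square)
  ultimately show ?thesis
    using exp_ge_zero[of y] by metis
qed

text \<open>Moving the argument by \<open>- u\<close> from the point \<open>\<i>\<close> tilts the
  measure: the difference of the two integrands is an ordinary exponent integrand for the density
  \<open>exp x * n\<close>.\<close>

lemma tilt_identity:
  "(exp (- \<i> * (\<i> - of_real u) * of_real x) - 1) * of_real n - (exp (- \<i> * \<i> * of_real x) - 1) * of_real n =
    (exp (\<i> * of_real (u * x)) - 1) * complex_of_real (exp x * n)"
proof -
  have "exp (- \<i> * (\<i> - of_real u) * of_real x) = exp (\<i> * of_real (u * x) + of_real x)"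
    by (simp add: algebra_simps)
  also have "\<dots> = exp (\<i> * of_real (u * x)) * of_real (exp x)"
    by (simp add: exp_add exp_of_real)
  finally have "exp (- \<i> * (\<i> - of_real u) * of_real x) = exp (\<i> * of_real (u * x)) * of_real (exp x)" .
  moreover have "exp (- \<i> * \<i> * of_real x) = complex_of_real (exp x)"
    by (simp add: exp_of_real)
  ultimately show ?thesis
    by (simp only: of_real_mult) (simp add: algebra_simps)
qed

locale exp_levy =
  fixes T R \<alpha>max \<gamma> :: real and k :: "real \<Rightarrow> real"
  assumes T_pos: "0 < T" and in_class: "(\<gamma>, k) \<in> class_G0 T R \<alpha>max"
begin

abbreviation law :: "real measure" where "law \<equiv> levy_law T (\<gamma>, k)"

abbreviation \<nu> :: "real \<Rightarrow> real" where "\<nu> x \<equiv> k x / \<bar>x\<bar>"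

lemma k_nonneg: "0 \<le> k x"
  using in_class by (simp add: class_G0_def levy_pair_def)

lemma law_and_levy_measure:
  shows law_distribution: "real_distribution law"
    and law_char: "char law u = exp (of_real T * (\<i> * of_real (\<gamma> * u) +
          (CLINT x|lborel. (exp (\<i> * of_real (u * x)) - 1) * of_real (\<nu> x))))"
    and \<nu>_int: "integrable lborel (\<lambda>x. min 1 \<bar>x\<bar> * \<nu> x)"
proof -
  obtain N :: "(real \<Rightarrow> real) measure" and X where N: "levy_process N X" "has_levy_triplet N X \<gamma> k"
    using in_class unfolding class_G0_def levy_pair_def by auto
  have law: "law = distr N borel (X T)"
    using T_pos by (intro levy_law_eq N) auto
  show "real_distribution law"
    unfolding law using N(1) T_pos
    by (intro prob_space.real_distribution_distr) (auto simp: levy_process_def)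
  show "char law u = exp (of_real T * (\<i> * of_real (\<gamma> * u) +
          (CLINT x|lborel. (exp (\<i> * of_real (u * x)) - 1) * of_real (\<nu> x))))"
    unfolding law using N(2) T_pos by (simp add: has_levy_triplet_def)
  show "integrable lborel (\<lambda>x. min 1 \<bar>x\<bar> * \<nu> x)"
    using N(2) by (simp add: has_levy_triplet_def)
qed

text \<open>Measurability is extracted from the integrability in the triplet: off the origin
  \<open>k\<close> is a measurable multiple of \<open>min 1 |x| * \<nu> x\<close>.\<close>

lemma k_measurable [measurable]: "k \<in> borel_measurable borel"
proof -
  have [measurable]: "(\<lambda>x. min 1 \<bar>x\<bar> * \<nu> x) \<in> borel_measurable borel"
    using borel_measurable_integrable[OF \<nu>_int] by simp
  have "k = (\<lambda>x. if x = 0 then k 0 else \<bar>x\<bar> / min 1 \<bar>x\<bar> * (min 1 \<bar>x\<bar> * \<nu> x))"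
    by (auto simp: fun_eq_iff min_def)
  also have "\<dots> \<in> borel_measurable borel"
    by measurable
  finally show ?thesis .
qed

lemma law_exp2_bound: "(\<integral>\<^sup>+ y. ennreal (exp (2 * y)) \<partial>law) \<le> ennreal R"
  using in_class by (simp add: class_G0_def)

lemma sets_law [measurable_cong]: "sets law = sets borel"
  using law_distribution by (simp add: real_distribution_def real_distribution_axioms_def)

lemma prob_law: "prob_space law"
  using law_distribution by (simp add: real_distribution_def)

lemma law_exp2_int: "integrable law (\<lambda>y. exp (2 * y))"
  using law_exp2_bound by (intro integrableI_bounded) (auto simp: le_less_trans)

lemma law_int_bounded: 
  fixes f :: "real \<Rightarrow> 'b::{banach, second_countable_topology}"
  assumes "f \<in> borel_measurable borel" "\<And>y. norm (f y) \<le> B + exp (2 * y)"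
  shows "integrable law f"
proof -
  interpret prob_space law by (rule prob_law)
  show ?thesis
  proof (rule Bochner_Integration.integrable_bound)
    show "integrable law (\<lambda>y. B + exp (2 * y))"
      using law_exp2_int by simp
    show "AE y in law. norm (f y) \<le> norm (B + exp (2 * y))"
      by (intro AE_I2, unfold real_norm_def, rule order_trans[OF assms(2) abs_ge_self])
    show "f \<in> borel_measurable law"
      using assms(1) by measurable
  qed
qed

lemma law_exp_int: "integrable law exp"
  using exp_le_one_plus by (intro law_int_bounded[where B = 1]) auto

lemma k_exp_int: "integrable lborel (k_exp k)"
  and k_exp_bound: "(LINT x|lborel. \<bar>k_exp k x\<bar>) \<le> R"
proof -
  have [measurable]: "k_exp k \<in> borel_measurable borel"
    unfolding k_exp_def[abs_def] by measurable
  have L1: "(\<integral>\<^sup>+ x. ennreal \<bar>k_exp k x\<bar> \<partial>lborel) \<le> ennreal R"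
    using in_class by (simp add: class_G0_def L1norm_def)
  show int: "integrable lborel (k_exp k)"
    using L1 by (intro integrableI_bounded) (auto simp: le_less_trans)
  \<comment> \<open>\<open>ennreal\<close> truncates a negative \<open>R\<close> to 0, and a
    positive function cannot have integral 0 against a probability measure.\<close>
  have R: "0 \<le> R"
  proof (rule ccontr)
    interpret prob_space law by (rule prob_law)
    assume "\<not> 0 \<le> R"
    then have "(\<integral>\<^sup>+ y. ennreal (exp (2 * y)) \<partial>law) = 0"
      using law_exp2_bound by (simp add: ennreal_neg)
    then have "AE y in law. False"
      by (subst (asm) nn_integral_0_iff_AE) auto
    then show False by simp
  qed
  have eq: "ennreal (LINT x|lborel. \<bar>k_exp k x\<bar>) = (\<integral>\<^sup>+ x. ennreal \<bar>k_exp k x\<bar> \<partial>lborel)"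
    using int by (intro nn_integral_eq_integral[symmetric]) auto
  then show "(LINT x|lborel. \<bar>k_exp k x\<bar>) \<le> R"
    using L1 R unfolding eq[symmetric] by (simp only: ennreal_le_iff)
qed

lemma fourier_k_exp_bound: "cmod (fourier (\<lambda>x. of_real (k_exp k x)) u) \<le> R"
  using fourier_norm_le[of "\<lambda>x. of_real (k_exp k x)" u] k_exp_int k_exp_bound by simp

sublocale jumps: levy_density lborel \<nu>
proof
  show "integrable lborel (\<lambda>x. indicator {1<..} x * exp x * \<nu> x)"
  proof (rule Bochner_Integration.integrable_bound[OF k_exp_int])
    show "AE x in lborel. norm (indicator {1<..} x * exp x * \<nu> x) \<le> norm (k_exp k x)"
    proof (intro AE_I2)
      fix x
      have "exp x * k x / x \<le> exp x * k x" if "1 < x"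
        using that mult_left_mono[of 1 x "exp x * k x"] k_nonneg[of x] by (simp add: divide_le_eq)
      then show "norm (indicator {1<..} x * exp x * \<nu> x) \<le> norm (k_exp k x)"
        using k_nonneg[of x] by (auto simp: k_exp_def indicator_def abs_mult)
    qed
  qed measurable
qed (use \<nu>_int k_nonneg in auto)

text \<open>With unit density the integral of the locale is the extended characteristic function
  minus one, so both sides of the Levy-Khinchine formula rest on the same analysis.\<close>

sublocale law: levy_density law "\<lambda>_. 1"
proof
  show "integrable law (\<lambda>x. min 1 \<bar>x\<bar> * 1)"
    by (rule law_int_bounded[where B = 1]) (auto simp: min_def add_nonneg_nonneg intro: add_increasing2)
  show "integrable law (\<lambda>x. indicator {1<..} x * exp x * 1)"
    by (rule law_int_bounded[where B = 1]) (auto simp: indicator_def exp_le_one_plus add_nonneg_nonneg)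
qed (auto simp: sets_law)

text \<open>Jump part of the Levy exponent after the Esscher transform, i.e. for the tilted Levy
  density \<open>exp x * \<nu> x\<close>.\<close>

definition \<xi> :: "real \<Rightarrow> complex" where
  "\<xi> u = (CLINT x|lborel. (exp (\<i> * of_real (u * x)) - 1) * of_real (exp x * \<nu> x))"

abbreviation \<phi> :: "real \<Rightarrow> complex" where
  "\<phi> u \<equiv> char_ext T (\<gamma>, k) (of_real u - \<i>)"

lemma char_ext_int:
  assumes "0 \<le> Im z" "Im z \<le> 1"
  shows "integrable law (\<lambda>y. exp (- \<i> * z * of_real y))"
proof -
  interpret prob_space law by (rule prob_law)
  have "integrable law (\<lambda>y. (exp (- \<i> * z * of_real y) - 1) * of_real 1 + 1)"
    using law.levy_integrable[OF assms] by (intro Bochner_Integration.integrable_add) auto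
  then show ?thesis by simp
qed

text \<open>Levy-Khinchine formula extended from the real line, where it is part of the model: both
  sides are holomorphic in the open strip and continuous on its closure, so
  \<open>strip_uniqueness\<close> applies to their difference.\<close>

lemma law_strip_formula:
  assumes z: "0 \<le> Im z" "Im z \<le> 1"
  shows "(CLINT y|law. exp (- \<i> * z * of_real y)) =
    exp (of_real T * (- \<i> * of_real \<gamma> * z + (CLINT x|lborel. (exp (- \<i> * z * of_real x) - 1) * of_real (\<nu> x))))"
proof -
  interpret prob_space law by (rule prob_law)
  let ?A = "\<lambda>z. (CLINT y|law. (exp (- \<i> * z * of_real y) - 1) * of_real 1)"
  let ?B = "\<lambda>z. exp (of_real T * (- \<i> * of_real \<gamma> * z + (CLINT x|lborel. (exp (- \<i> * z * of_real x) - 1) * of_real (\<nu> x))))"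
  have A: "?A z = (CLINT y|law. exp (- \<i> * z * of_real y)) - 1" if "0 \<le> Im z" "Im z \<le> 1" for z
    using char_ext_int[OF that] by (simp add: prob_space)
  have "?A z + 1 - ?B z = 0"
  proof (rule strip_uniqueness[OF _ _ _ z])
    show "(\<lambda>z. ?A z + 1 - ?B z) holomorphic_on {z. 0 < Im z \<and> Im z < 1}"
      by (intro holomorphic_intros law.levy_holomorphic jumps.levy_holomorphic)
    show "continuous_on {z. 0 \<le> Im z \<and> Im z \<le> 1} (\<lambda>z. ?A z + 1 - ?B z)"
      by (intro continuous_intros law.levy_continuous jumps.levy_continuous)
    fix z assume z0: "Im z = 0"
    define t where "t = - Re z"
    have t: "z = of_real (- t)"
      using z0 by (simp add: complex_eq_iff t_def)
    have "?A z + 1 = char law t"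
      by (subst A) (auto simp: t char_def mult.assoc)
    also have "\<dots> = ?B z"
      unfolding law_char by (simp add: t mult.assoc)
    finally show "?A z + 1 - ?B z = 0" by simp
  qed
  then show ?thesis
    unfolding A[OF z] by (simp only: diff_add_cancel right_minus_eq)
qed

lemma \<phi>_alt: "\<phi> u = (CLINT y|law. exp (- \<i> * (\<i> - of_real u) * of_real y))"
  by (simp add: char_ext_def algebra_simps)

text \<open>At \<open>z = \<i>\<close> the exponent is \<open>T\<close> times the left side of the
  martingale condition, hence zero.\<close>

lemma law_exp_mean: "(LINT y|law. exp y) = 1"
proof -
  have mart: "(LINT x|lborel. (exp x - 1) * \<nu> x) = - \<gamma>"
    using in_class by (simp add: class_G0_def martingale_condition_def)
  have "complex_of_real (LINT y|law. exp y) = (CLINT y|law. exp (- \<i> * \<i> * of_real y))"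
    by (simp add: exp_of_real)
  also have "\<dots> = exp (of_real T * (of_real \<gamma> + (CLINT x|lborel. (exp (of_real x) - 1) * of_real (\<nu> x))))"
    by (subst law_strip_formula) (auto simp: algebra_simps)
  also have "(CLINT x|lborel. (exp (of_real x) - 1) * complex_of_real (\<nu> x)) = (CLINT x|lborel. complex_of_real ((exp x - 1) * \<nu> x))"
    by (simp add: exp_of_real)
  also have "\<dots> = - of_real \<gamma>"
    unfolding integral_complex_of_real mart by simp
  finally have "complex_of_real (LINT y|law. exp y) = of_real 1"
    by simp
  then show ?thesis
    by (simp only: of_real_eq_iff)
qed

lemma \<xi>_int: "integrable lborel (\<lambda>x. (exp (\<i> * of_real (u * x)) - 1) * of_real (exp x * \<nu> x))"
proof -
  have "integrable lborel (\<lambda>x. (exp (- \<i> * (\<i> - of_real u) * of_real x) - 1) * of_real (\<nu> x) - (exp (- \<i> * \<i> * of_real x) - 1) * of_real (\<nu> x))"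
    by (intro Bochner_Integration.integrable_diff jumps.levy_integrable) auto
  also have "(\<lambda>x. (exp (- \<i> * (\<i> - of_real u) * of_real x) - 1) * of_real (\<nu> x) - (exp (- \<i> * \<i> * of_real x) - 1) * of_real (\<nu> x)) =
    (\<lambda>x. (exp (\<i> * of_real (u * x)) - 1) * of_real (exp x * \<nu> x))"
    by (intro ext tilt_identity)
  finally show ?thesis .
qed

text \<open>The exponent at \<open>\<i> - u\<close> is compared with that at \<open>\<i>\<close>:
  the martingale condition makes the jump integral at \<open>\<i>\<close> equal to
  \<open>- \<gamma>\<close>, which cancels the real drift term, and \<open>tilt_identity\<close>
  identifies the difference as \<open>\<xi> u\<close>.\<close>

lemma \<phi>_formula: "\<phi> u = exp (of_real T * (\<i> * of_real (\<gamma> * u) + \<xi> u))"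
proof -
  let ?L = "\<lambda>z. (CLINT x|lborel. (exp (- \<i> * z * of_real x) - 1) * of_real (\<nu> x))"
  have 1: "\<phi> u = exp (of_real T * (- \<i> * of_real \<gamma> * (\<i> - of_real u) + ?L (\<i> - of_real u)))"
    unfolding \<phi>_alt by (rule law_strip_formula) auto
  have mart: "(LINT x|lborel. (exp x - 1) * \<nu> x) = - \<gamma>"
    using in_class by (simp add: class_G0_def martingale_condition_def)
  have L_i: "?L \<i> = - of_real \<gamma>"
  proof -
    have "?L \<i> = (CLINT x|lborel. complex_of_real ((exp x - 1) * \<nu> x))"
      by (simp add: exp_of_real)
    then show ?thesis
      unfolding integral_complex_of_real mart by simp
  qed
  have "?L (\<i> - of_real u) - ?L \<i> = (CLINT x|lborel. (exp (- \<i> * (\<i> - of_real u) * of_real x) - 1) * of_real (\<nu> x) - (exp (- \<i> * \<i> * of_real x) - 1) * of_real (\<nu> x))"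
    by (rule Bochner_Integration.integral_diff[symmetric]) (rule jumps.levy_integrable; simp)+
  also have "\<dots> = \<xi> u"
    unfolding \<xi>_def by (intro Bochner_Integration.integral_cong refl tilt_identity)
  finally have "?L (\<i> - of_real u) = \<xi> u - of_real \<gamma>"
    unfolding L_i by (simp only: diff_minus_eq_add eq_diff_eq)
  then show ?thesis
    unfolding 1 by (simp only:) (simp add: algebra_simps)
qed

lemma k_exp_alt: "k_exp k x = x * (exp x * \<nu> x)"
  by (cases "x = 0") (auto simp: k_exp_def sgn_if)

lemma \<xi>_lipschitz_pointwise:
  "cmod ((exp (\<i> * of_real (v * x)) - 1) * of_real (exp x * \<nu> x) - (exp (\<i> * of_real (u * x)) - 1) * of_real (exp x * \<nu> x))
    \<le> \<bar>k_exp k x\<bar> * \<bar>v - u\<bar>"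
proof -
  have "(exp (\<i> * of_real (v * x)) - 1) * of_real (exp x * \<nu> x) - (exp (\<i> * of_real (u * x)) - 1) * of_real (exp x * \<nu> x) =
    (exp (\<i> * of_real (v * x)) - exp (\<i> * of_real (u * x))) * of_real (exp x * \<nu> x)"
    by (simp only: left_diff_distrib) simp
  also have "cmod \<dots> \<le> \<bar>v * x - u * x\<bar> * \<bar>exp x * \<nu> x\<bar>"
    unfolding norm_mult norm_of_real by (intro mult_right_mono norm_iexp_diff_le) auto
  also have "\<dots> = \<bar>k_exp k x\<bar> * \<bar>v - u\<bar>"
    unfolding k_exp_alt abs_mult[symmetric] by (simp add: algebra_simps)
  finally show ?thesis .
qed

text \<open>The derivative brings down \<open>\<i> * x\<close>, which cancels the
  \<open>1 / |x|\<close> of the Levy density: \<open>x * exp x * \<nu> x\<close> is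
  \<open>k_exp k x\<close>. The absolute value of \<open>k_exp k\<close> is also the
  dominator.\<close>

lemma \<xi>_deriv: "(\<xi> has_vector_derivative \<i> * fourier (\<lambda>x. of_real (k_exp k x)) u) (at u)"
proof -
  let ?f = "\<lambda>u x. (exp (\<i> * of_real (u * x)) - 1) * complex_of_real (exp x * \<nu> x)"
  let ?p = "\<lambda>x. \<i> * (exp (\<i> * of_real (u * x)) * of_real (k_exp k x))"
  have p_int: "integrable lborel ?p"
    using fourier_integrable[of "\<lambda>x. of_real (k_exp k x)" u] k_exp_int by (intro integrable_mult_right) auto
  have "((\<lambda>u. CLINT x|lborel. ?f u x) has_derivative (\<lambda>h. CLINT x|lborel. h *\<^sub>R ?p x)) (at u)"
  proof (rule has_derivative_integral[where d = 1 and g = "\<lambda>x. \<bar>k_exp k x\<bar>"])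
    show "((\<lambda>u. ?f u x) has_derivative (\<lambda>h. h *\<^sub>R ?p x)) (at u)" for x
    proof -
      have "((\<lambda>u. exp (\<i> * of_real (u * x))) has_vector_derivative (\<i> * of_real x) * exp (\<i> * of_real (u * x))) (at u)"
      proof -
        have "((\<lambda>z. exp (\<i> * (z * of_real x))) has_field_derivative (\<i> * of_real x) * exp (\<i> * (of_real u * of_real x))) (at (of_real u))"
          by (auto intro!: derivative_eq_intros simp: mult_ac)
        from has_vector_derivative_real_field[OF this] show ?thesis
          by simp
      qed
      then have "((\<lambda>u. ?f u x) has_vector_derivative ((\<i> * of_real x) * exp (\<i> * of_real (u * x)) - 0) * complex_of_real (exp x * \<nu> x)) (at u)"
        by (intro has_vector_derivative_mult_left has_vector_derivative_diff has_vector_derivative_const)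
      also have "((\<i> * of_real x) * exp (\<i> * of_real (u * x)) - 0) * complex_of_real (exp x * \<nu> x) = ?p x"
        unfolding k_exp_alt by simp
      finally show ?thesis
        by (simp add: has_vector_derivative_def)
    qed
    show "cmod (h *\<^sub>R ?p x) \<le> \<bar>k_exp k x\<bar> * norm h" for h x
      by (simp add: norm_mult del: of_real_mult)
    show "cmod (?f (u + h) x - ?f u x) \<le> \<bar>k_exp k x\<bar> * norm h" for h x
      using \<xi>_lipschitz_pointwise[of "u + h" x u] by simp
    show "bounded_linear (\<lambda>h. CLINT x|lborel. h *\<^sub>R ?p x)"
      unfolding integral_scaleR_right by (rule bounded_linear_scaleR_left)
    show "integrable lborel (?f (u + h))" for h
      by (rule \<xi>_int)
    show "integrable lborel (\<lambda>x. h *\<^sub>R ?p x)" for h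
      using p_int by (intro integrable_scaleR_right)
    show "integrable lborel (\<lambda>x. \<bar>k_exp k x\<bar>)"
      using k_exp_int by (rule integrable_abs)
  qed simp
  then show ?thesis
    unfolding integral_scaleR_right integral_mult_right_zero has_vector_derivative_def \<xi>_def[abs_def] fourier_def .
qed

lemma \<xi>_bound: "cmod (\<xi> u) \<le> \<bar>u\<bar> * R"
proof -
  have "cmod (\<xi> u) \<le> (LINT x|lborel. cmod ((exp (\<i> * of_real (u * x)) - 1) * of_real (exp x * \<nu> x)))"
    unfolding \<xi>_def by (rule integral_norm_bound)
  also have "\<dots> \<le> (LINT x|lborel. \<bar>k_exp k x\<bar> * \<bar>u\<bar>)"
    using \<xi>_int[of u] k_exp_int \<xi>_lipschitz_pointwise[of u _ 0] by (intro integral_mono) auto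
  also have "\<dots> \<le> R * \<bar>u\<bar>"
    using k_exp_bound by (simp add: mult_right_mono)
  finally show ?thesis by (simp add: mult.commute)
qed

text \<open>Near frequency zero this replaces the power-law lower bound and matches the branch
  \<open>|u| < 1\<close> of \<open>trim_level\<close>.\<close>

lemma \<phi>_lower_bound: "exp (- T * \<bar>u\<bar> * R) \<le> cmod (\<phi> u)"
proof -
  have "- (\<bar>u\<bar> * R) \<le> Re (\<xi> u)"
    using \<xi>_bound[of u] abs_Re_le_cmod[of "\<xi> u"] by linarith
  then have "T * - (\<bar>u\<bar> * R) \<le> T * Re (\<xi> u)"
    using T_pos by (intro mult_left_mono) auto
  then show ?thesis
    unfolding \<phi>_formula norm_exp_eq_Re by simp
qed

text \<open>Dividing by \<open>T * \<phi> u\<close> shows that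
  \<open>- \<gamma> - \<i> * \<psi>'\<close> is the transform of \<open>k_exp k\<close>, where
  \<open>\<psi>'\<close> is the logarithmic derivative of \<open>\<phi>\<close> divided by
  \<open>T\<close>. This is the identity that the estimator imitates.\<close>

lemma \<phi>_deriv: "(\<phi> has_vector_derivative
    \<phi> u * (of_real T * (\<i> * (of_real \<gamma> + fourier (\<lambda>x. of_real (k_exp k x)) u)))) (at u)"
proof -
  let ?h = "\<lambda>u. of_real T * (\<i> * of_real (\<gamma> * u) + \<xi> u)"
  let ?h' = "of_real T * (\<i> * (of_real \<gamma> + fourier (\<lambda>x. of_real (k_exp k x)) u))"
  have "((\<lambda>u. of_real T * (\<i> * of_real (\<gamma> * u) + \<xi> u)) has_vector_derivative
      of_real T * (\<i> * (of_real \<gamma> + fourier (\<lambda>x. of_real (k_exp k x)) u))) (at u)"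
  proof -
    have "((\<lambda>z. \<i> * (of_real \<gamma> * z)) has_field_derivative \<i> * of_real \<gamma>) (at (of_real u))"
      by (auto intro!: derivative_eq_intros)
    from has_vector_derivative_real_field[OF this]
    have "((\<lambda>u. \<i> * of_real (\<gamma> * u)) has_vector_derivative \<i> * of_real \<gamma>) (at u)"
      by simp
    from has_vector_derivative_mult_right[OF has_vector_derivative_add[OF this \<xi>_deriv[of u]], of "of_real T"]
    show ?thesis
      by (simp add: distrib_left)
  qed
  from field_vector_diff_chain_at[OF this DERIV_exp]
  have "((\<lambda>u. exp (?h u)) has_vector_derivative ?h' * exp (?h u)) (at u)"
    unfolding o_def .
  then show ?thesis
    unfolding \<phi>_formula mult.commute[of "exp (?h u)"] .
qed

end

section \<open>The option function\<close>

text \<open>\<open>- (2 + x) * exp (- x)\<close> is an antiderivative of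
  \<open>(1 + x) * exp (- x)\<close>. The tail form is needed beyond the design range, the value at
  \<open>A = 0\<close> for integrability and for the curvature error.\<close>

lemma nn_integral_laplace_tail:
  assumes A: "0 \<le> A"
  shows "(\<integral>\<^sup>+x. ennreal ((1 + \<bar>x\<bar>) * exp (- \<bar>x\<bar>)) * indicator {x. A \<le> \<bar>x\<bar>} x \<partial>lborel) \<le> ennreal (2 * (2 + A) * exp (- A))"
proof -
  let ?h = "\<lambda>x::real. ennreal ((1 + \<bar>x\<bar>) * exp (- \<bar>x\<bar>))"
  have "(\<integral>\<^sup>+x. ennreal ((1 + x) * exp (- x)) * indicator {A..} x \<partial>lborel) = ennreal (0 - (- (2 + A) * exp (- A)))"
  proof (rule nn_integral_FTC_atLeast[where F = "\<lambda>x. - (2 + x) * exp (- x)"])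
    show "((\<lambda>x::real. - (2 + x) * exp (- x)) \<longlongrightarrow> 0) at_top"
      by real_asymp
    show "DERIV (\<lambda>x. - (2 + x) * exp (- x)) x :> (1 + x) * exp (- x)" for x
      by (auto intro!: derivative_eq_intros simp: algebra_simps)
  qed (use A in auto)
  also have "(\<integral>\<^sup>+x. ennreal ((1 + x) * exp (- x)) * indicator {A..} x \<partial>lborel) = (\<integral>\<^sup>+x. ?h x * indicator {A..} x \<partial>lborel)"
    using A by (intro nn_integral_cong) (auto simp: indicator_def)
  finally have right: "(\<integral>\<^sup>+x. ?h x * indicator {A..} x \<partial>lborel) = ennreal ((2 + A) * exp (- A))"
    by (simp add: algebra_simps)
  have left: "(\<integral>\<^sup>+x. ?h x * indicator {..- A} x \<partial>lborel) = ennreal ((2 + A) * exp (- A))"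
    unfolding right[symmetric]
    by (subst nn_integral_real_affine[where c = "-1" and t = 0]) (auto intro!: nn_integral_cong simp: indicator_def)
  have "(\<integral>\<^sup>+x. ?h x * indicator {x. A \<le> \<bar>x\<bar>} x \<partial>lborel) \<le> (\<integral>\<^sup>+x. ?h x * indicator {A..} x + ?h x * indicator {..- A} x \<partial>lborel)"
    by (intro nn_integral_mono) (auto simp: indicator_def)
  also have "\<dots> = ennreal ((2 + A) * exp (- A)) + ennreal ((2 + A) * exp (- A))"
    by (subst nn_integral_add) (auto simp: left right)
  also have "\<dots> = ennreal (2 * (2 + A) * exp (- A))"
    using A by (simp flip: ennreal_plus add: algebra_simps)
  finally show ?thesis .
qed

lemma integrable_laplace: "integrable lborel (\<lambda>x::real. (1 + \<bar>x\<bar>) * exp (- \<bar>x\<bar>))"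
  using nn_integral_laplace_tail[of 0]
  by (intro integrableI_bounded) (auto simp: abs_mult top.not_eq_extremum[symmetric] top_unique)

lemma fourier_deriv:
  fixes f :: "real \<Rightarrow> complex"
  assumes f: "integrable lborel f" and xf: "integrable lborel (\<lambda>x. of_real x * f x)"
  shows "(fourier f has_vector_derivative \<i> * fourier (\<lambda>x. of_real x * f x) u) (at u)"
proof -
  let ?f = "\<lambda>u x. exp (\<i> * of_real (u * x)) * f x"
  let ?p = "\<lambda>x. \<i> * (exp (\<i> * of_real (u * x)) * (of_real x * f x))"
  have p_int: "integrable lborel ?p"
    using fourier_integrable[OF xf] by (intro integrable_mult_right) auto
  have "((\<lambda>u. CLINT x|lborel. ?f u x) has_derivative (\<lambda>h. CLINT x|lborel. h *\<^sub>R ?p x)) (at u)"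
  proof (rule has_derivative_integral[where d = 1 and g = "\<lambda>x. cmod (of_real x * f x)"])
    show "((\<lambda>u. ?f u x) has_derivative (\<lambda>h. h *\<^sub>R ?p x)) (at u)" for x
    proof -
      have "((\<lambda>z. exp (\<i> * (z * of_real x)) * f x) has_field_derivative ?p x) (at (of_real u))"
        by (auto intro!: derivative_eq_intros simp: mult_ac)
      from has_vector_derivative_real_field[OF this] show ?thesis
        by (simp add: has_vector_derivative_def)
    qed
    show "cmod (h *\<^sub>R ?p x) \<le> cmod (of_real x * f x) * norm h" for h x
      by (simp add: norm_mult del: of_real_mult)
    show "cmod (?f (u + h) x - ?f u x) \<le> cmod (of_real x * f x) * norm h" for h x
    proof -
      have "cmod (?f (u + h) x - ?f u x) = cmod (exp (\<i> * of_real ((u + h) * x)) - exp (\<i> * of_real (u * x))) * cmod (f x)"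
        by (simp only: left_diff_distrib[symmetric] norm_mult)
      also have "\<dots> \<le> \<bar>(u + h) * x - u * x\<bar> * cmod (f x)"
        by (intro mult_right_mono norm_iexp_diff_le) auto
      finally show ?thesis
        by (simp add: norm_mult abs_mult algebra_simps)
    qed
    show "bounded_linear (\<lambda>h. CLINT x|lborel. h *\<^sub>R ?p x)"
      unfolding integral_scaleR_right by (rule bounded_linear_scaleR_left)
    show "integrable lborel (?f (u + h))" for h
      using f by (rule fourier_integrable)
    show "integrable lborel (\<lambda>x. h *\<^sub>R ?p x)" for h
      using p_int by (intro integrable_scaleR_right)
    show "integrable lborel (\<lambda>x. cmod (of_real x * f x))"
      using xf by (rule integrable_norm)
  qed simp
  then show ?thesis
    unfolding integral_scaleR_right integral_mult_right_zero has_vector_derivative_def fourier_def[abs_def] .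
qed

section \<open>Transform of a single payoff\<close>

definition payoff :: "real \<Rightarrow> real \<Rightarrow> real" where
  "payoff y x = (if 0 \<le> x then max 0 (exp y - exp x) else max 0 (exp x - exp y))"

lemma payoff_measurable [measurable]: "(\<lambda>(y, x). payoff y x) \<in> borel_measurable (borel \<Otimes>\<^sub>M borel)"
  unfolding payoff_def by measurable

lemma payoff_nonneg: "0 \<le> payoff y x"
  by (simp add: payoff_def)

text \<open>\<open>G\<close> is an antiderivative of the payoff's Fourier integrand multiplied by
  \<open>\<i> * u * (1 + \<i> * u)\<close>; with this factor no frequency has to be excluded. For
  \<open>y < 0\<close> the put changes both the sign of the integrand and the orientation of the
  interval, so either case gives \<open>G y - G 0\<close>.\<close>

lemma payoff_fourier:
  "\<i> * of_real u * (1 + \<i> * of_real u) * fourier (\<lambda>x. of_real (payoff y x)) u =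
    exp ((1 + \<i> * of_real u) * of_real y) - (1 + \<i> * of_real u) * of_real (exp y) + \<i> * of_real u"
proof -
  define G where "G x = exp (\<i> * of_real (u * x)) * (of_real (exp y) * (1 + \<i> * of_real u) - \<i> * of_real u * exp (of_real x))" for x
  let ?c = "\<i> * of_real u * (1 + \<i> * of_real u)"
  let ?g = "\<lambda>x. ?c * (exp (\<i> * of_real (u * x)) * of_real (exp y - exp x))"
  have G': "(G has_vector_derivative ?g x) (at x within S)" for x S
  proof -
    have "((\<lambda>z. exp (\<i> * (of_real u * z)) * (of_real (exp y) * (1 + \<i> * of_real u) - \<i> * of_real u * exp z)) has_field_derivative ?g x) (at (of_real x))"
      by (auto intro!: derivative_eq_intros simp: algebra_simps exp_of_real)
    from has_vector_derivative_real_field[OF this] show ?thesis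
      unfolding G_def[abs_def] by (auto intro: has_vector_derivative_at_within)
  qed
  have cont: "continuous_on S ?g" for S
    by (intro continuous_intros)
  have FTC: "(CLINT x|lborel. indicator {a..b} x *\<^sub>R ?g x) = G b - G a" if "a \<le> b" for a b
    by (rule integral_FTC_Icc[OF that G' cont])
  have "?c * fourier (\<lambda>x. of_real (payoff y x)) u = G y - G 0"
  proof (cases "0 \<le> y")
    case True
    have "?c * fourier (\<lambda>x. of_real (payoff y x)) u = (CLINT x|lborel. ?c * (exp (\<i> * of_real (u * x)) * of_real (payoff y x)))"
      by (simp add: fourier_def)
    also have "\<dots> = (CLINT x|lborel. indicator {0..y} x *\<^sub>R ?g x)"
      using True by (intro Bochner_Integration.integral_cong) (auto simp: payoff_def indicator_def max_def)
    finally show ?thesis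
      unfolding FTC[OF True] .
  next
    case False
    have "?c * fourier (\<lambda>x. of_real (payoff y x)) u = (CLINT x|lborel. ?c * (exp (\<i> * of_real (u * x)) * of_real (payoff y x)))"
      by (simp add: fourier_def)
    also have "\<dots> = (CLINT x|lborel. - (indicator {y..0} x *\<^sub>R ?g x))"
    proof (rule integral_cong_AE)
      \<comment> \<open>At \<open>x = 0\<close> the payoff is that of the call, so for negative
        \<open>y\<close> the formula fails at this single point.\<close>
      show "AE x in lborel. ?c * (exp (\<i> * of_real (u * x)) * of_real (payoff y x)) = - (indicator {y..0} x *\<^sub>R ?g x)"
        using AE_lborel_singleton[of "0::real"]
      proof eventually_elim
        fix x :: real assume "x \<noteq> 0"
        have "payoff y x = - (indicator {y..0} x * (exp y - exp x))"
          using False \<open>x \<noteq> 0\<close> by (auto simp: payoff_def indicator_def max_def)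
        then show "?c * (exp (\<i> * of_real (u * x)) * of_real (payoff y x)) = - (indicator {y..0} x *\<^sub>R ?g x)"
          by (simp add: indicator_def)
      qed
    qed (unfold payoff_def, measurable)
    also have "\<dots> = - (CLINT x|lborel. indicator {y..0} x *\<^sub>R ?g x)"
      by (rule integral_minus)
    also have "\<dots> = G y - G 0"
      using False by (subst FTC) auto
    finally show ?thesis .
  qed
  also have "\<dots> = exp ((1 + \<i> * of_real u) * of_real y) - (1 + \<i> * of_real u) * of_real (exp y) + \<i> * of_real u"
    unfolding G_def by (simp add: algebra_simps exp_add exp_of_real)
  finally show ?thesis .
qed

context exp_levy
begin

lemma R_nonneg: "0 \<le> R"
  using fourier_k_exp_bound[of 0] norm_ge_zero order_trans by blast

abbreviation opt :: "real \<Rightarrow> real" where "opt \<equiv> option_fun T (\<gamma>, k)"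

lemma opt_eq: "opt x = (LINT y|law. payoff y x)"
  by (simp add: option_fun_def payoff_def)

text \<open>For \<open>x \<le> y\<close> one has \<open>exp y = exp (2 * y) * exp (- y) \<le> exp (2
  * y) * exp (- x)\<close>; this is where the second exponential moment is spent. On the negative
  side the put is at most \<open>exp x\<close>.\<close>

lemma payoff_le: "payoff y x \<le> (1 + exp (2 * y)) * exp (- \<bar>x\<bar>)"
proof (cases "0 \<le> x")
  case True
  show ?thesis
  proof (cases "x \<le> y")
    case True
    then have "exp y \<le> exp (2 * y) * exp (- x)"
      by (simp flip: exp_add)
    moreover have "payoff y x \<le> exp y"
      using \<open>0 \<le> x\<close> True by (simp add: payoff_def)
    moreover have "(1 + exp (2 * y)) * exp (- x) = exp (- x) + exp (2 * y) * exp (- x)"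
      by (simp add: distrib_right)
    ultimately show ?thesis
      using \<open>0 \<le> x\<close> exp_gt_zero[of "-x"] by (simp del: exp_gt_zero)
  next
    case False
    then show ?thesis
      using \<open>0 \<le> x\<close> by (simp add: payoff_def)
  qed
next
  case False
  have "payoff y x \<le> exp x"
    using False by (simp add: payoff_def)
  also have "\<dots> \<le> (1 + exp (2 * y)) * exp x"
    by simp
  finally show ?thesis
    using False by simp
qed

lemma payoff_int: "integrable law (\<lambda>y. payoff y x)"
proof (rule Bochner_Integration.integrable_bound)
  interpret prob_space law by (rule prob_law)
  show "integrable law (\<lambda>y. (1 + exp (2 * y)) * exp (- \<bar>x\<bar>))"
    using law_exp2_int by simp
  show "AE y in law. norm (payoff y x) \<le> norm ((1 + exp (2 * y)) * exp (- \<bar>x\<bar>))"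
    using payoff_le by (intro AE_I2) (simp add: payoff_nonneg abs_mult add_nonneg_nonneg)
qed measurable

lemma law_exp2_le: "(LINT y|law. exp (2 * y)) \<le> R"
proof -
  have "ennreal (LINT y|law. exp (2 * y)) = (\<integral>\<^sup>+ y. ennreal (exp (2 * y)) \<partial>law)"
    using law_exp2_int by (intro nn_integral_eq_integral[symmetric]) auto
  also have "\<dots> \<le> ennreal R"
    by (rule law_exp2_bound)
  finally show ?thesis
    using R_nonneg by (simp only: ennreal_le_iff)
qed

lemma opt_nonneg: "0 \<le> opt x"
  unfolding opt_eq by (intro integral_nonneg_AE) (simp add: payoff_nonneg)

lemma opt_le: "opt x \<le> (1 + R) * exp (- \<bar>x\<bar>)"
proof -
  interpret prob_space law by (rule prob_law)
  have "opt x \<le> (LINT y|law. (1 + exp (2 * y)) * exp (- \<bar>x\<bar>))"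
    unfolding opt_eq using law_exp2_int payoff_int payoff_le by (intro integral_mono) auto
  also have "\<dots> = (1 + (LINT y|law. exp (2 * y))) * exp (- \<bar>x\<bar>)"
    using law_exp2_int by (simp add: prob_space)
  also have "\<dots> \<le> (1 + R) * exp (- \<bar>x\<bar>)"
    using law_exp2_le by (intro mult_right_mono) auto
  finally show ?thesis .
qed

lemma opt_measurable [measurable]: "opt \<in> borel_measurable borel"
proof -
  interpret prob_space law by (rule prob_law)
  have "(\<lambda>x. LINT y|law. payoff y x) \<in> borel_measurable borel"
    by measurable
  then show ?thesis
    by (simp add: opt_eq[abs_def])
qed

lemma opt_weighted_le: "(1 + \<bar>x\<bar>) * opt x \<le> (1 + R) * ((1 + \<bar>x\<bar>) * exp (- \<bar>x\<bar>))"
  using mult_left_mono[OF opt_le[of x], of "1 + \<bar>x\<bar>"] by (simp add: mult_ac)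

lemma opt_int: "integrable lborel opt"
  and x_opt_int: "integrable lborel (\<lambda>x. x * opt x)"
proof -
  have int: "integrable lborel (\<lambda>x::real. (1 + R) * ((1 + \<bar>x\<bar>) * exp (- \<bar>x\<bar>)))"
    using integrable_laplace by simp
  have *: "0 \<le> \<bar>x\<bar> * opt x" for x
    using opt_nonneg by simp
  have le: "opt x \<le> \<bar>(1 + R) * ((1 + \<bar>x\<bar>) * exp (- \<bar>x\<bar>))\<bar>" "\<bar>x\<bar> * opt x \<le> \<bar>(1 + R) * ((1 + \<bar>x\<bar>) * exp (- \<bar>x\<bar>))\<bar>" for x
    using order_trans[OF opt_weighted_le[of x] abs_ge_self] opt_nonneg[of x] *[of x]
    by (simp_all only: distrib_right mult_1 add_increasing2 add_le_same_cancel1)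
  show "integrable lborel opt"
  proof (rule Bochner_Integration.integrable_bound[OF int])
    show "AE x in lborel. norm (opt x) \<le> norm ((1 + R) * ((1 + \<bar>x\<bar>) * exp (- \<bar>x\<bar>)))"
      by (intro AE_I2) (simp only: real_norm_def abs_of_nonneg[OF opt_nonneg] le)
  qed simp
  show "integrable lborel (\<lambda>x. x * opt x)"
  proof (rule Bochner_Integration.integrable_bound[OF int])
    show "AE x in lborel. norm (x * opt x) \<le> norm ((1 + R) * ((1 + \<bar>x\<bar>) * exp (- \<bar>x\<bar>)))"
      by (intro AE_I2) (simp only: real_norm_def abs_mult[of _ "opt _"] abs_of_nonneg[OF opt_nonneg] le)
  qed simp
qed

text \<open>The average of \<open>payoff_fourier\<close> over the law. The terms linear in
  \<open>\<i> * u\<close> and the constant add up to \<open>-1\<close> because \<open>exp\<close>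
  has mean one.\<close>

lemma option_fourier:
  "\<phi> u = 1 + \<i> * of_real u * (1 + \<i> * of_real u) * fourier (\<lambda>x. of_real (opt x)) u"
proof -
  interpret prob_space law by (rule prob_law)
  interpret P: pair_sigma_finite lborel law
    by unfold_locales
  let ?E = "\<lambda>x y. exp (\<i> * of_real (u * x)) * complex_of_real (payoff y x)"
  let ?c = "\<i> * of_real u * (1 + \<i> * of_real u)"
  have int: "integrable (lborel \<Otimes>\<^sub>M law) (\<lambda>(x, y). ?E x y)"
  proof (rule P.Fubini_integrable)
    show "AE x in lborel. integrable law (\<lambda>y. case (x, y) of (x, y) \<Rightarrow> ?E x y)"
      using payoff_int by (intro AE_I2) (simp del: of_real_mult)
    have "(\<lambda>x. LINT y|law. norm (case (x, y) of (x, y) \<Rightarrow> ?E x y)) = opt"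
      by (simp add: norm_mult payoff_nonneg opt_eq[abs_def] del: of_real_mult)
    then show "integrable lborel (\<lambda>x. LINT y|law. norm (case (x, y) of (x, y) \<Rightarrow> ?E x y))"
      using opt_int by simp
  qed measurable
  have "fourier (\<lambda>x. of_real (opt x)) u = (CLINT x|lborel. CLINT y|law. ?E x y)"
    unfolding fourier_def opt_eq by simp
  also have "\<dots> = (CLINT y|law. fourier (\<lambda>x. of_real (payoff y x)) u)"
    using P.Fubini_integral[OF int] by (simp add: fourier_def)
  finally have "?c * fourier (\<lambda>x. of_real (opt x)) u = (CLINT y|law. ?c * fourier (\<lambda>x. of_real (payoff y x)) u)"
    by simp
  also have "\<dots> = (CLINT y|law. exp (- \<i> * (\<i> - of_real u) * of_real y) - (1 + \<i> * of_real u) * of_real (exp y) + \<i> * of_real u)"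
    unfolding payoff_fourier by (simp add: algebra_simps)
  also have "\<dots> = \<phi> u - (1 + \<i> * of_real u) * of_real (LINT y|law. exp y) + \<i> * of_real u"
    using char_ext_int[of "\<i> - of_real u"] law_exp_int unfolding \<phi>_alt by (simp add: prob_space)
  finally show ?thesis
    by (simp add: law_exp_mean)
qed

text \<open>Both sides are the derivative of \<open>\<phi>\<close>, once through the option function
  and once through the exponent. The left side is the numerator of \<open>empirical_deriv\<close> at
  the true option function.\<close>

lemma option_fourier_deriv:
  "(\<i> - 2 * of_real u) * fourier (\<lambda>x. of_real (opt x)) u
      - (of_real u + \<i> * of_real (u\<^sup>2)) * fourier (\<lambda>x. of_real (x * opt x)) u
    = \<phi> u * (of_real T * (\<i> * (of_real \<gamma> + fourier (\<lambda>x. of_real (k_exp k x)) u)))"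
proof -
  let ?f0 = "fourier (\<lambda>x. complex_of_real (opt x))" and ?f1 = "fourier (\<lambda>x. complex_of_real (x * opt x))"
  have f0: "(?f0 has_vector_derivative \<i> * ?f1 u) (at u)"
    using fourier_deriv[of "\<lambda>x. of_real (opt x)" u] opt_int x_opt_int by (simp flip: of_real_mult)
  have "((\<lambda>z. \<i> * z * (1 + \<i> * z)) has_field_derivative (\<i> - 2 * of_real u)) (at (of_real u))"
    by (auto intro!: derivative_eq_intros simp: algebra_simps)
  from has_vector_derivative_real_field[OF this]
  have "((\<lambda>u. \<i> * of_real u * (1 + \<i> * of_real u)) has_vector_derivative (\<i> - 2 * of_real u)) (at u)"
    by simp
  from has_vector_derivative_add[OF has_vector_derivative_const[of 1] has_vector_derivative_mult[OF this f0]]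
  have "(\<phi> has_vector_derivative 0 + (\<i> * of_real u * (1 + \<i> * of_real u) * (\<i> * ?f1 u) + (\<i> - 2 * of_real u) * ?f0 u)) (at u)"
    unfolding option_fourier[symmetric] .
  from vector_derivative_unique_at[OF this \<phi>_deriv] show ?thesis
    by (simp add: algebra_simps power2_eq_square)
qed

end

section \<open>Piecewise linear interpolation\<close>

lemma exp_le_quadratic:
  fixes s :: real
  assumes "\<bar>s\<bar> \<le> 1"
  shows "exp s \<le> 1 + s + s\<^sup>2"
proof (cases "0 \<le> s")
  case True
  then show ?thesis
    using assms by (intro exp_bound) auto
next
  case False
  define t where "t = - s"
  have t: "0 < t" "t \<le> 1"
    using False assms by (auto simp: t_def)
  have "1 + t + t\<^sup>2 / 2 \<le> exp t"
    using t by (intro exp_lower_Taylor_quadratic) auto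
  moreover have "0 < 1 - t + t\<^sup>2"
    using t by (intro add_nonneg_pos) auto
  moreover have "1 \<le> (1 - t + t\<^sup>2) * (1 + t + t\<^sup>2 / 2)"
  proof -
    have "(1 - t + t\<^sup>2) * (1 + t + t\<^sup>2 / 2) = 1 + (t^2 + t^3 + t^4) / 2"
      by (simp add: algebra_simps power2_eq_square power3_eq_cube power4_eq_xxxx field_simps)
    then show ?thesis
      using t by simp
  qed
  ultimately have "1 \<le> (1 - t + t\<^sup>2) * exp t"
    by (meson mult_left_mono order_less_imp_le order_trans)
  then have "exp (- t) \<le> 1 - t + t\<^sup>2"
    by (simp add: exp_minus inverse_eq_divide divide_le_eq)
  then show ?thesis
    by (simp add: t_def)
qed

text \<open>Unlike \<open>payoff\<close> it does not switch at log-strike 0, so its only kink is at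
  \<open>x = y\<close>.\<close>

definition call_payoff :: "real \<Rightarrow> real \<Rightarrow> real" where
  "call_payoff y x = max 0 (exp y - exp x)"

text \<open>The first term bounds the interpolation error caused by curvature, the second one the error
  in the cell that contains the kink of the payoff.\<close>

definition interp_kernel :: "real \<Rightarrow> real \<Rightarrow> real" where
  "interp_kernel d t = d\<^sup>2 * exp (- \<bar>t\<bar>) + d * indicator {- d..d} t"

lemma interp_kernel_nonneg: "0 \<le> d \<Longrightarrow> 0 \<le> interp_kernel d t"
  by (simp add: interp_kernel_def)

lemma interp_kernel_measurable [measurable]: "interp_kernel d \<in> borel_measurable borel"
  unfolding interp_kernel_def[abs_def] by measurable

text \<open>The payoff vanishes on a cell to the right of the kink. To its left the error is that of
  interpolating \<open>exp\<close>: of one sign by convexity and at most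
  \<open>exp x * d\<^sup>2\<close> by a second-order bound, with
  \<open>exp x = exp y * exp (- |x - y|)\<close>. In the cell of the kink all values lie between 0
  and \<open>exp y - exp a \<le> exp y * d\<close>.\<close>

lemma call_interp_error:
  assumes l: "0 \<le> l" "l \<le> 1" and d: "b - a \<le> d" "d \<le> 1" and ab: "a \<le> b" and x: "x = (1 - l) * a + l * b"
  shows "\<bar>(1 - l) * call_payoff y a + l * call_payoff y b - call_payoff y x\<bar> \<le> exp y * interp_kernel d (x - y)"
proof -
  have xa: "x - a = l * (b - a)" and xb: "b - x = (1 - l) * (b - a)"
    by (simp_all add: x algebra_simps)
  have "0 \<le> l * (b - a)" "l * (b - a) \<le> b - a" "0 \<le> (1 - l) * (b - a)" "(1 - l) * (b - a) \<le> b - a"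
    using l ab by (auto intro!: mult_nonneg_nonneg mult_left_le_one_le)
  then have xa': "a \<le> x" "x - a \<le> b - a" and xb': "x \<le> b" "b - x \<le> b - a"
    using xa xb by linarith+
  have d0: "0 \<le> d"
    using d ab by linarith
  consider "y \<le> a" | "b \<le> y" | "a < y" "y < b"
    by linarith
  then show ?thesis
  proof cases
    case 1
    then have "call_payoff y a = 0" "call_payoff y b = 0" "call_payoff y x = 0"
      using ab xa' by (auto simp: call_payoff_def)
    then show ?thesis
      using interp_kernel_nonneg[OF d0] by simp
  next
    case 2
    let ?e = "(1 - l) * exp a + l * exp b - exp x"
    have "(1 - l) * call_payoff y a + l * call_payoff y b - call_payoff y x = - ?e"
      using 2 ab xb' by (simp add: call_payoff_def algebra_simps)
    moreover have "0 \<le> ?e"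
    proof -
      have "exp x * (1 + (a - x)) \<le> exp x * exp (a - x)" "exp x * (1 + (b - x)) \<le> exp x * exp (b - x)"
        by (intro mult_left_mono exp_ge_add_one_self; simp)+
      then have "exp x * (1 + (a - x)) \<le> exp a" "exp x * (1 + (b - x)) \<le> exp b"
        by (simp_all flip: exp_add)
      then have "(1 - l) * (exp x * (1 + (a - x))) + l * (exp x * (1 + (b - x))) \<le> (1 - l) * exp a + l * exp b"
        using l by (intro add_mono mult_left_mono) auto
      moreover have "(1 - l) * (exp x * (1 + (a - x))) + l * (exp x * (1 + (b - x))) = exp x * (1 + ((1 - l) * a + l * b - x))"
        by (simp add: algebra_simps)
      ultimately show ?thesis
        by (simp add: x)
    qed
    moreover have "?e \<le> exp x * d\<^sup>2"
    proof -
      have "exp (a - x) \<le> 1 + (a - x) + d\<^sup>2" "exp (b - x) \<le> 1 + (b - x) + d\<^sup>2"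
      proof -
        have le: "\<bar>a - x\<bar> \<le> d" "\<bar>b - x\<bar> \<le> d"
          using xa' xb' d d0 by auto
        have "(a - x)\<^sup>2 \<le> d\<^sup>2" "(b - x)\<^sup>2 \<le> d\<^sup>2"
          unfolding power2_le_iff_abs_le[OF d0] by (fact le)+
        moreover have "exp (a - x) \<le> 1 + (a - x) + (a - x)\<^sup>2" "exp (b - x) \<le> 1 + (b - x) + (b - x)\<^sup>2"
          using le d by (intro exp_le_quadratic; simp)+
        ultimately show "exp (a - x) \<le> 1 + (a - x) + d\<^sup>2" "exp (b - x) \<le> 1 + (b - x) + d\<^sup>2"
          by linarith+
      qed
      then have "exp x * exp (a - x) \<le> exp x * (1 + (a - x) + d\<^sup>2)" "exp x * exp (b - x) \<le> exp x * (1 + (b - x) + d\<^sup>2)"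
        by (intro mult_left_mono; simp)+
      then have "exp a \<le> exp x * (1 + (a - x) + d\<^sup>2)" "exp b \<le> exp x * (1 + (b - x) + d\<^sup>2)"
        by (simp_all flip: exp_add)
      then have "(1 - l) * exp a + l * exp b \<le> (1 - l) * (exp x * (1 + (a - x) + d\<^sup>2)) + l * (exp x * (1 + (b - x) + d\<^sup>2))"
        using l by (intro add_mono mult_left_mono) auto
      also have "\<dots> = exp x * (1 + d\<^sup>2 + ((1 - l) * a + l * b - x))"
        by (simp add: algebra_simps)
      also have "\<dots> = exp x + exp x * d\<^sup>2"
        by (simp add: x distrib_left)
      finally show ?thesis by simp
    qed
    moreover have "exp x * d\<^sup>2 \<le> exp y * interp_kernel d (x - y)"
    proof -
      have "exp x = exp y * exp (- \<bar>x - y\<bar>)"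
        using 2 xb' by (simp flip: exp_add)
      then have "exp x * d\<^sup>2 = exp y * (d\<^sup>2 * exp (- \<bar>x - y\<bar>))"
        by simp
      also have "\<dots> \<le> exp y * interp_kernel d (x - y)"
        using d0 by (intro mult_left_mono) (auto simp: interp_kernel_def)
      finally show ?thesis .
    qed
    ultimately show ?thesis
      by simp
  next
    case 3
    let ?B = "exp y - exp a"
    have range: "0 \<le> call_payoff y t \<and> call_payoff y t \<le> ?B" if "a \<le> t" for t
      using that 3 by (auto simp: call_payoff_def)
    have "0 \<le> (1 - l) * call_payoff y a + l * call_payoff y b"
      using l range[of a] range[of b] ab by simp
    moreover have "(1 - l) * call_payoff y a + l * call_payoff y b \<le> (1 - l) * ?B + l * ?B"
      using l range[of a] range[of b] ab by (intro add_mono mult_left_mono) auto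
    moreover have "(1 - l) * ?B + l * ?B = ?B"
      by (simp add: algebra_simps)
    ultimately have "\<bar>(1 - l) * call_payoff y a + l * call_payoff y b - call_payoff y x\<bar> \<le> ?B"
      using range[OF xa'(1)] by (simp add: abs_le_iff)
    also have "?B \<le> exp y * d"
    proof -
      have "exp y * (1 + (a - y)) \<le> exp y * exp (a - y)"
        by (intro mult_left_mono exp_ge_add_one_self) simp
      then have "exp y * (1 + (a - y)) \<le> exp a"
        by (simp flip: exp_add)
      then have "?B \<le> exp y * (y - a)"
        by (simp add: algebra_simps)
      also have "\<dots> \<le> exp y * d"
        using 3 d by (intro mult_left_mono) auto
      finally show ?thesis .
    qed
    also have "\<dots> \<le> exp y * interp_kernel d (x - y)"
    proof -
      have "x - y \<in> {- d..d}"
        using 3 xa' xb' d by auto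
      then show ?thesis
        using d0 by (intro mult_left_mono) (auto simp: interp_kernel_def)
    qed
    finally show ?thesis .
  qed
qed

text \<open>The constant is \<open>4 + 4\<close>: the Laplace integral contributes
  \<open>2 * 2\<close>, and the window of length \<open>2 * d\<close> has weighted height at most
  \<open>2 * d\<close>.\<close>

lemma interp_kernel_weighted:
  assumes d: "0 \<le> d" "d \<le> 1"
  shows "(\<integral>\<^sup>+t. ennreal ((1 + \<bar>t\<bar>) * interp_kernel d t) \<partial>lborel) \<le> ennreal (8 * d\<^sup>2)"
proof -
  have "(\<integral>\<^sup>+t. ennreal ((1 + \<bar>t\<bar>) * interp_kernel d t) \<partial>lborel) \<le>
    (\<integral>\<^sup>+t. ennreal (d\<^sup>2) * (ennreal ((1 + \<bar>t\<bar>) * exp (- \<bar>t\<bar>)) * indicator {t. 0 \<le> \<bar>t\<bar>} t) + ennreal (2 * d) * indicator {- d..d} t \<partial>lborel)"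
  proof (rule nn_integral_mono)
    fix t :: real
    have "(1 + \<bar>t\<bar>) * interp_kernel d t \<le> d\<^sup>2 * ((1 + \<bar>t\<bar>) * exp (- \<bar>t\<bar>)) + 2 * d * indicator {- d..d} t"
    proof (cases "t \<in> {- d..d}")
      case True
      then have "(1 + \<bar>t\<bar>) * d \<le> 2 * d"
        using d by (intro mult_right_mono) auto
      then show ?thesis
        using True by (simp add: interp_kernel_def algebra_simps)
    next
      case False
      then show ?thesis
        by (simp add: interp_kernel_def algebra_simps)
    qed
    then have "ennreal ((1 + \<bar>t\<bar>) * interp_kernel d t) \<le> ennreal (d\<^sup>2 * ((1 + \<bar>t\<bar>) * exp (- \<bar>t\<bar>)) + 2 * d * indicator {- d..d} t)"
      by (rule ennreal_leI)
    also have "\<dots> = ennreal (d\<^sup>2) * ennreal ((1 + \<bar>t\<bar>) * exp (- \<bar>t\<bar>)) + ennreal (2 * d) * indicator {- d..d} t"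
      using d by (simp add: ennreal_plus ennreal_mult indicator_def)
    finally show "ennreal ((1 + \<bar>t\<bar>) * interp_kernel d t) \<le> ennreal (d\<^sup>2) * (ennreal ((1 + \<bar>t\<bar>) * exp (- \<bar>t\<bar>)) * indicator {t. 0 \<le> \<bar>t\<bar>} t) + ennreal (2 * d) * indicator {- d..d} t"
      by simp
  qed
  also have "\<dots> = ennreal (d\<^sup>2) * (\<integral>\<^sup>+t. ennreal ((1 + \<bar>t\<bar>) * exp (- \<bar>t\<bar>)) * indicator {t. 0 \<le> \<bar>t\<bar>} t \<partial>lborel) + ennreal (2 * d) * emeasure lborel {- d..d}"
    by (subst nn_integral_add) (auto simp: nn_integral_cmult nn_integral_cmult_indicator)
  also have "\<dots> \<le> ennreal (d\<^sup>2) * ennreal (2 * (2 + 0) * exp (- 0)) + ennreal (2 * d) * ennreal (2 * d)"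
    using d by (intro add_mono mult_left_mono nn_integral_laplace_tail) auto
  also have "\<dots> = ennreal (d\<^sup>2 * (2 * (2 + 0) * exp (- 0))) + ennreal (2 * d * (2 * d))"
  proof -
    have m: "ennreal a * ennreal b = ennreal (a * b)" if "0 \<le> a" "0 \<le> b" for a b
      using that by (simp add: ennreal_mult)
    show ?thesis
      using d by (subst (1 2) m) auto
  qed
  also have "\<dots> = ennreal (8 * d\<^sup>2)"
    using d by (subst ennreal_plus[symmetric]) (auto simp: power2_eq_square)
  finally show ?thesis .
qed

text \<open>The weight is submultiplicative, \<open>1 + |y + t| \<le> (1 + |y|) * (1 + |t|)\<close>.
  Averaging over \<open>y\<close> then asks for \<open>E[exp X * (1 + |X|)]\<close>, which the bound
  on \<open>E[|X * exp X|]\<close> provides.\<close>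

lemma interp_kernel_shifted:
  assumes d: "0 \<le> d" "d \<le> 1"
  shows "(\<integral>\<^sup>+x. ennreal ((1 + \<bar>x\<bar>) * (exp y * interp_kernel d (x - y))) \<partial>lborel) \<le> ennreal (exp y * (1 + \<bar>y\<bar>)) * ennreal (8 * d\<^sup>2)"
proof -
  have "(\<integral>\<^sup>+x. ennreal ((1 + \<bar>x\<bar>) * (exp y * interp_kernel d (x - y))) \<partial>lborel)
     = (\<integral>\<^sup>+t. ennreal ((1 + \<bar>y + 1 * t\<bar>) * (exp y * interp_kernel d (y + 1 * t - y))) \<partial>lborel)"
    by (subst nn_integral_real_affine[where c = 1 and t = y]) auto
  also have "\<dots> \<le> (\<integral>\<^sup>+t. ennreal (exp y * (1 + \<bar>y\<bar>)) * ennreal ((1 + \<bar>t\<bar>) * interp_kernel d t) \<partial>lborel)"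
  proof (rule nn_integral_mono)
    fix t :: real
    have "1 + \<bar>y + t\<bar> \<le> 1 + \<bar>y\<bar> + \<bar>t\<bar>"
      using abs_triangle_ineq[of y t] by simp
    also have "\<dots> \<le> 1 + \<bar>y\<bar> + \<bar>t\<bar> + \<bar>y\<bar> * \<bar>t\<bar>"
      by simp
    also have "\<dots> = (1 + \<bar>y\<bar>) * (1 + \<bar>t\<bar>)"
      by (simp add: algebra_simps)
    finally have "1 + \<bar>y + t\<bar> \<le> (1 + \<bar>y\<bar>) * (1 + \<bar>t\<bar>)" .
    then have "(1 + \<bar>y + t\<bar>) * (exp y * interp_kernel d t) \<le> (1 + \<bar>y\<bar>) * (1 + \<bar>t\<bar>) * (exp y * interp_kernel d t)"
      using interp_kernel_nonneg[OF d(1)] by (intro mult_right_mono) auto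
    then show "ennreal ((1 + \<bar>y + 1 * t\<bar>) * (exp y * interp_kernel d (y + 1 * t - y))) \<le> ennreal (exp y * (1 + \<bar>y\<bar>)) * ennreal ((1 + \<bar>t\<bar>) * interp_kernel d t)"
      using interp_kernel_nonneg[OF d(1)] by (simp add: ennreal_mult[symmetric] ennreal_leI mult_ac)
  qed
  also have "\<dots> = ennreal (exp y * (1 + \<bar>y\<bar>)) * (\<integral>\<^sup>+t. ennreal ((1 + \<bar>t\<bar>) * interp_kernel d t) \<partial>lborel)"
    by (rule nn_integral_cmult) measurable
  also have "\<dots> \<le> ennreal (exp y * (1 + \<bar>y\<bar>)) * ennreal (8 * d\<^sup>2)"
    using interp_kernel_weighted[OF d] by (intro mult_left_mono) auto
  finally show ?thesis .
qed

section \<open>The grid and its hat functions\<close>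

locale option_design =
  fixes N :: nat and x \<delta> :: "nat \<Rightarrow> real"
  assumes design: "design N x \<delta>" and mesh_le: "mesh N x \<le> 1" and range_ge: "1 \<le> design_range N x"
begin

abbreviation \<Delta> :: real where "\<Delta> \<equiv> mesh N x"

lemma N2: "2 \<le> N"
  using design by (simp add: design_def)

lemma node_less_Suc: "j \<le> N \<Longrightarrow> x j < x (Suc j)"
  using design by (simp add: design_def)

lemma node_step: "j \<le> N \<Longrightarrow> x (Suc j) - x j \<le> \<Delta>"
proof -
  assume j: "j \<le> N"
  consider "j = 0" | "j = N" | "1 \<le> j" "j < N"
    using j by linarith
  then show ?thesis
  proof cases
    case 3
    have "x (Suc j) - x (Suc j - 1) \<in> (\<lambda>j. x j - x (j - 1)) ` {2..N}"
      using 3 by (intro imageI) auto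
    then show ?thesis
      unfolding mesh_def by (subst Max_ge) auto
  qed (use design in \<open>auto simp: design_def\<close>)
qed

lemma mesh_pos: "0 < \<Delta>"
  using node_less_Suc[of 0] node_step[of 0] by linarith

lemma node_mono: "i \<le> j \<Longrightarrow> j \<le> Suc N \<Longrightarrow> x i \<le> x j"
proof (induction j rule: dec_induct)
  case (step n)
  then show ?case
    using node_less_Suc[of n] by simp
qed simp

lemma node_strict_mono: "i < j \<Longrightarrow> j \<le> Suc N \<Longrightarrow> x i < x j"
  using node_less_Suc[of i] node_mono[of "Suc i" j] by simp

lemma node_ends: "x 1 \<le> - design_range N x" "design_range N x \<le> x N"
  by (auto simp: design_range_def)

lemma j_zero_props: "j_zero N x \<in> {1..N}" "x (j_zero N x - 1) < 0" "0 \<le> x (j_zero N x)"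
proof -
  define j where "j = (LEAST j. 0 \<le> x j \<and> 1 \<le> j)"
  have N: "0 \<le> x N \<and> 1 \<le> N"
    using node_ends range_ge N2 by auto
  then have j: "0 \<le> x j" "1 \<le> j" "j \<le> N"
    unfolding j_def by (metis (mono_tags, lifting) LeastI_ex, metis (mono_tags, lifting) LeastI_ex, rule Least_le)
  \<comment> \<open>The design range is at least 1, so the first node is negative and the crossing
    index has an observed predecessor.\<close>
  have "j \<noteq> 1"
    using j node_ends range_ge by auto
  then have "x (j - 1) < 0"
    using not_less_Least[of "j - 1" "\<lambda>j. 0 \<le> x j \<and> 1 \<le> j"] j unfolding j_def[symmetric] by auto
  then have "\<exists>!j. j \<in> {1..N} \<and> x (j - 1) < 0 \<and> 0 \<le> x j"
  proof (intro ex1I[of _ j])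
    fix i assume i: "i \<in> {1..N} \<and> x (i - 1) < 0 \<and> 0 \<le> x i"
    show "i = j"
    proof (rule ccontr)
      assume "i \<noteq> j"
      then consider "i \<le> j - 1" "j - 1 \<le> Suc N" | "j \<le> i - 1" "i - 1 \<le> Suc N"
        using i j by fastforce
      then show False
      proof cases
        case 1
        from node_mono[OF this] show False
          using i \<open>x (j - 1) < 0\<close> by linarith
      next
        case 2
        from node_mono[OF this] show False
          using i j by linarith
      qed
    qed
  qed (use j in auto)
  from theI'[OF this] show "j_zero N x \<in> {1..N}" "x (j_zero N x - 1) < 0" "0 \<le> x (j_zero N x)"
    unfolding j_zero_def by auto
qed

abbreviation kink0 :: "real \<Rightarrow> real" where
  "kink0 \<equiv> kink (x (j_zero N x - 1)) (x (j_zero N x))"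

text \<open>Height and width of the kink correction are both of order \<open>\<Delta>\<close>, so
  its integral is of the order of the interpolation error.\<close>

lemma kink0_bounds: "0 \<le> kink0 y" "kink0 y \<le> \<Delta> * indicator {- \<Delta>..\<Delta>} y"
proof -
  let ?a = "x (j_zero N x - 1)" and ?b = "x (j_zero N x)"
  have ab: "?a < 0" "0 \<le> ?b" "?b - ?a \<le> \<Delta>"
    using j_zero_props node_step[of "j_zero N x - 1"] by auto
  have le: "p * q / (?b - ?a) \<le> p" if "0 \<le> p" "q \<le> ?b - ?a" for p q
    using mult_left_mono[OF that(2,1)] ab by (simp add: divide_le_eq)
  have pos: "0 \<le> ?b - ?a" using ab by simp
  have "0 \<le> ?b * (y - ?a) / (?b - ?a)" if "?a \<le> y"
    using that ab by (intro divide_nonneg_nonneg mult_nonneg_nonneg) auto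
  moreover have "0 \<le> - ?a * (?b - y) / (?b - ?a)" if "y \<le> ?b"
    using that ab by (intro divide_nonneg_nonneg mult_nonneg_nonneg) auto
  ultimately show "0 \<le> kink0 y"
    unfolding kink_def by (cases "?a \<le> y \<and> y \<le> 0"; cases "0 < y \<and> y \<le> ?b") (simp_all only: if_True if_False simp_thms order_refl)
  have 1: "?b * (y - ?a) / (?b - ?a) \<le> \<Delta>" if "y \<le> 0"
    using le[of ?b "y - ?a"] that ab by linarith
  have 2: "- ?a * (?b - y) / (?b - ?a) \<le> \<Delta>" if "0 < y"
    using le[of "- ?a" "?b - y"] that ab by linarith
  show "kink0 y \<le> \<Delta> * indicator {- \<Delta>..\<Delta>} y"
    using ab 1 2 mesh_pos by (auto simp: kink_def indicator_def)
qed

lemma hat_outside: "1 \<le> j \<Longrightarrow> j \<le> N \<Longrightarrow> y \<notin> {x (j - 1)..x (j + 1)} \<Longrightarrow> hat_fun x j y = 0"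
  using node_mono[of "j - 1" j] node_mono[of j "j + 1"] by (auto simp: hat_fun_def indicator_def)

lemma hat_left: "1 \<le> j \<Longrightarrow> j \<le> N \<Longrightarrow> x (j - 1) \<le> y \<Longrightarrow> y < x j \<Longrightarrow> hat_fun x j y = (y - x (j - 1)) / (x j - x (j - 1))"
  by (auto simp: hat_fun_def indicator_def)

lemma hat_right: "x j \<le> y \<Longrightarrow> y \<le> x (j + 1) \<Longrightarrow> hat_fun x j y = (x (j + 1) - y) / (x (j + 1) - x j)"
  by (auto simp: hat_fun_def indicator_def)

lemma hat_bounds: "1 \<le> j \<Longrightarrow> j \<le> N \<Longrightarrow> 0 \<le> hat_fun x j y \<and> hat_fun x j y \<le> 1"
proof -
  assume j: "1 \<le> j" "j \<le> N"
  have lt: "x (j - 1) < x j" "x j < x (j + 1)"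
    using j node_less_Suc[of "j - 1"] node_less_Suc[of j] by auto
  consider "y \<notin> {x (j - 1)..x (j + 1)}" | "x (j - 1) \<le> y" "y < x j" | "x j \<le> y" "y \<le> x (j + 1)"
    unfolding atLeastAtMost_iff by linarith
  then show ?thesis
  proof cases
    case 1 then show ?thesis using hat_outside[OF j 1] by simp
  next
    case 2 then show ?thesis unfolding hat_left[OF j 2] using lt by auto
  next
    case 3 then show ?thesis unfolding hat_right[OF 3] using lt by auto
  qed
qed

lemma hat_zero_cell:
  assumes i: "i \<le> N" "x i \<le> y" "y < x (Suc i)" and j: "1 \<le> j" "j \<le> N" "j \<noteq> i" "j \<noteq> Suc i"
  shows "hat_fun x j y = 0"
proof (cases "j < i")
  case True
  then have "x (j + 1) \<le> x i"
    using i node_mono[of "j + 1" i] by simp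
  show ?thesis
  \<comment> \<open>The support interval is closed; at the node it may share with the cell the hat
    is 0 by its linear formula.\<close>
  proof (cases "y = x (j + 1)")
    case True
    then show ?thesis
      using hat_right[of j y] node_mono[of j "j + 1"] j by simp
  next
    case False
    then show ?thesis
      using \<open>x (j + 1) \<le> x i\<close> i by (intro hat_outside j) auto
  qed
next
  case False
  then have "x (Suc i) \<le> x (j - 1)"
    using j i node_mono[of "Suc i" "j - 1"] by auto
  then show ?thesis
    using i by (intro hat_outside j) auto
qed

lemma cell_exists:
  assumes "x 0 \<le> y" "y < x (Suc N)"
  obtains i where "i \<le> N" "x i \<le> y" "y < x (Suc i)"
proof -
  have "\<exists>i\<le>n. x i \<le> y \<and> y < x (Suc i)" if "n \<le> N" "y < x (Suc n)" for n
    using that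
  proof (induction n)
    case (Suc n)
    then show ?case
      by (cases "y < x (Suc n)") (auto intro: le_SucI)
  qed (use assms in auto)
  then show ?thesis
    using assms that by blast
qed

lemma sum_hat_cell:
  assumes i: "1 \<le> i" "i < N" "x i \<le> y" "y < x (Suc i)"
  defines "l \<equiv> (y - x i) / (x (Suc i) - x i)"
  shows "(\<Sum>j=1..N. v j * hat_fun x j y) = (1 - l) * v i + l * v (Suc i)"
    and "0 \<le> l" "l \<le> 1" "y = (1 - l) * x i + l * x (Suc i)"
proof -
  have lt: "x i < x (Suc i)"
    using i node_less_Suc by simp
  show l: "0 \<le> l" "l \<le> 1"
    using i lt by (auto simp: l_def)
  have ly: "l * (x (Suc i) - x i) = y - x i"
    using lt by (simp add: l_def)
  then show "y = (1 - l) * x i + l * x (Suc i)"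
    by (simp add: algebra_simps)
  have "(\<Sum>j=1..N. v j * hat_fun x j y) = (\<Sum>j\<in>{i, Suc i}. v j * hat_fun x j y)"
    using i hat_zero_cell[of i y] by (intro sum.mono_neutral_right) auto
  also have "\<dots> = v i * hat_fun x i y + v (Suc i) * hat_fun x (Suc i) y"
    by simp
  also have "hat_fun x (Suc i) y = l"
    using i by (subst hat_left) (auto simp: l_def)
  also have "hat_fun x i y = 1 - l"
    using i lt by (subst hat_right) (auto simp: l_def field_simps)
  finally show "(\<Sum>j=1..N. v j * hat_fun x j y) = (1 - l) * v i + l * v (Suc i)"
    by (simp add: mult.commute)
qed

lemma inner_cell:
  assumes "x 1 \<le> y" "y < x N"
  obtains i where "1 \<le> i" "i < N" "x i \<le> y" "y < x (Suc i)"
proof -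
  have "x 0 \<le> y" "y < x (Suc N)"
    using assms node_mono[of 0 1] node_mono[of N "Suc N"] by auto
  then obtain i where i: "i \<le> N" "x i \<le> y" "y < x (Suc i)"
    by (rule cell_exists)
  have "i \<noteq> 0"
    using i(3) assms(1) by (metis One_nat_def not_le)
  moreover have "i \<noteq> N"
    using i(2) assms(2) by auto
  ultimately  show ?thesis
    using i that[of i] by simp
qed

lemma sum_hat_right_end:
  assumes "x N \<le> y"
  shows "(\<Sum>j=1..N. v j * hat_fun x j y) = v N * hat_fun x N y"
proof -
  have "hat_fun x j y = 0" if "1 \<le> j" "j < N" for j
  proof (cases "y < x (Suc N)")
    case True
    then show ?thesis
      using assms that by (intro hat_zero_cell[of N y]) auto
  next
    case False
    then show ?thesis
      using that node_strict_mono[of "j + 1" "Suc N"] by (intro hat_outside) auto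
  qed
  then have "(\<Sum>j=1..N. v j * hat_fun x j y) = (\<Sum>j\<in>{N}. v j * hat_fun x j y)"
    using N2 by (intro sum.mono_neutral_right) auto
  then show ?thesis by simp
qed

lemma sum_hat_left_end:
  assumes "y < x 1"
  shows "(\<Sum>j=1..N. v j * hat_fun x j y) = v 1 * hat_fun x 1 y"
proof -
  have "hat_fun x j y = 0" if "1 < j" "j \<le> N" for j
  proof -
    have "x 1 \<le> x (j - 1)"
      using that by (intro node_mono) auto
    then show ?thesis
      using assms that by (intro hat_outside) auto
  qed
  then have "(\<Sum>j=1..N. v j * hat_fun x j y) = (\<Sum>j\<in>{1}. v j * hat_fun x j y)"
    using N2 by (intro sum.mono_neutral_right) (auto simp: order_le_less)
  then show ?thesis by simp
qed

end

section \<open>Interpolation bias of the option function\<close>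

locale option_model = exp_levy T R \<alpha>max \<gamma> k + option_design N x \<delta>
  for T R \<alpha>max \<gamma> k N x \<delta> +
  assumes log_moment: "(\<integral>\<^sup>+ y. ennreal \<bar>y * exp y\<bar> \<partial>law) \<le> ennreal R"
begin

lemma call_payoff_int: "integrable law (\<lambda>y. call_payoff y t)"
proof (rule Bochner_Integration.integrable_bound[OF law_exp_int])
  show "(\<lambda>y. call_payoff y t) \<in> borel_measurable law"
    unfolding call_payoff_def by measurable
qed (auto simp: call_payoff_def)

text \<open>Put-call parity, using that \<open>exp\<close> has mean one. The option function becomes
  a mixture of call payoffs minus the call payoff at \<open>y = 0\<close>, each with a single
  kink.\<close>

lemma opt_call: "opt t = (LINT y|law. call_payoff y t) - call_payoff 0 t"
proof -
  interpret prob_space law by (rule prob_law)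
  show ?thesis
  proof (cases "0 \<le> t")
    case True
    then show ?thesis
      by (simp add: opt_eq payoff_def call_payoff_def)
  next
    case False
    have "payoff y t = call_payoff y t - exp y + exp t" for y
      using False by (auto simp: payoff_def call_payoff_def)
    then have "opt t = (LINT y|law. call_payoff y t - exp y + exp t)"
      by (simp add: opt_eq)
    also have "\<dots> = (LINT y|law. call_payoff y t) - 1 + exp t"
      using call_payoff_int law_exp_int by (simp add: law_exp_mean prob_space)
    finally show ?thesis
      using False by (simp add: call_payoff_def)
  qed
qed

lemma law_weight: "(\<integral>\<^sup>+ y. ennreal (exp y * (1 + \<bar>y\<bar>)) \<partial>law) \<le> ennreal (1 + R)"
proof -
  have "(\<integral>\<^sup>+ y. ennreal (exp y * (1 + \<bar>y\<bar>)) \<partial>law) = (\<integral>\<^sup>+ y. ennreal (exp y) + ennreal \<bar>y * exp y\<bar> \<partial>law)"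
    by (intro nn_integral_cong) (simp add: ennreal_plus[symmetric] abs_mult distrib_left mult.commute del: ennreal_plus)
  also have "\<dots> = (\<integral>\<^sup>+ y. ennreal (exp y) \<partial>law) + (\<integral>\<^sup>+ y. ennreal \<bar>y * exp y\<bar> \<partial>law)"
    by (rule nn_integral_add) measurable
  also have "(\<integral>\<^sup>+ y. ennreal (exp y) \<partial>law) = ennreal 1"
    unfolding law_exp_mean[symmetric] using law_exp_int by (intro nn_integral_eq_integral) auto
  also have "ennreal 1 + (\<integral>\<^sup>+ y. ennreal \<bar>y * exp y\<bar> \<partial>law) \<le> ennreal 1 + ennreal R"
    by (intro add_left_mono log_moment)
  finally show ?thesis
    using R_nonneg by (simp add: ennreal_plus)
qed

abbreviation opt_interp :: "real \<Rightarrow> real" where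
  "opt_interp t \<equiv> (\<Sum>j=1..N. opt (x j) * hat_fun x j t)"

text \<open>Interpolation is linear, so the error is the mixture of the errors of the calls
  \<open>y\<close> minus that of the call \<open>y = 0\<close>.\<close>

lemma inner_error:
  assumes "x 1 \<le> t" "t < x N"
  shows "ennreal \<bar>opt_interp t - opt t\<bar> \<le>
    (\<integral>\<^sup>+ y. ennreal (exp y * interp_kernel \<Delta> (t - y)) \<partial>law) + ennreal (interp_kernel \<Delta> t)"
proof -
  obtain i where i: "1 \<le> i" "i < N" "x i \<le> t" "t < x (Suc i)"
    using assms by (rule inner_cell)
  define l where "l = (t - x i) / (x (Suc i) - x i)"
  have l: "0 \<le> l" "l \<le> 1" "t = (1 - l) * x i + l * x (Suc i)"
    and sum: "(\<Sum>j=1..N. v j * hat_fun x j t) = (1 - l) * v i + l * v (Suc i)" for v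
    using sum_hat_cell[OF i] by (simp_all add: l_def)
  let ?E = "\<lambda>y. (1 - l) * call_payoff y (x i) + l * call_payoff y (x (Suc i)) - call_payoff y t"
  have step: "x (Suc i) - x i \<le> \<Delta>" "x i \<le> x (Suc i)"
    using i node_step node_less_Suc[of i] by auto
  have E: "\<bar>?E y\<bar> \<le> exp y * interp_kernel \<Delta> (t - y)" for y
    using l step mesh_le by (intro call_interp_error) auto
  have E_int: "integrable law ?E"
    using call_payoff_int by auto
  have "opt_interp t - opt t = (LINT y|law. ?E y) - ?E 0"
    unfolding sum opt_call using call_payoff_int by (simp add: algebra_simps)
  then have "\<bar>opt_interp t - opt t\<bar> \<le> \<bar>LINT y|law. ?E y\<bar> + \<bar>?E 0\<bar>"
    by simp
  also have "\<dots> \<le> \<bar>LINT y|law. ?E y\<bar> + interp_kernel \<Delta> t"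
    using E[of 0] by simp
  finally have "ennreal \<bar>opt_interp t - opt t\<bar> \<le> ennreal \<bar>LINT y|law. ?E y\<bar> + ennreal (interp_kernel \<Delta> t)"
    using mesh_pos interp_kernel_nonneg by (simp add: ennreal_plus[symmetric] ennreal_leI del: ennreal_plus)
  also have "ennreal \<bar>LINT y|law. ?E y\<bar> \<le> (\<integral>\<^sup>+ y. ennreal \<bar>?E y\<bar> \<partial>law)"
    using integral_norm_bound_ennreal[OF E_int] by simp
  also have "\<dots> \<le> (\<integral>\<^sup>+ y. ennreal (exp y * interp_kernel \<Delta> (t - y)) \<partial>law)"
    using E by (intro nn_integral_mono ennreal_leI) auto
  finally show ?thesis
    by (simp add: add_right_mono)
qed

text \<open>Only the hat of an end node survives here. Where it is nonzero the node lies within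
  distance 1 of \<open>t\<close>, which costs a factor \<open>exp 1 \<le> 3\<close> in the
  exponential decay; the option function itself adds one more, hence \<open>4\<close>.\<close>

lemma outer_error:
  assumes "\<not> (x 1 \<le> t \<and> t < x N)"
  shows "\<bar>opt_interp t - opt t\<bar> \<le> 4 * (1 + R) * exp (- \<bar>t\<bar>)" and "design_range N x \<le> \<bar>t\<bar>"
proof -
  have exp3: "exp (1::real) \<le> 3"
    by (rule exp_le)
  have node: "(1 + R) * exp (- \<bar>p\<bar>) \<le> 3 * (1 + R) * exp (- \<bar>t\<bar>)" if "\<bar>t\<bar> \<le> \<bar>p\<bar> + 1" for p
  proof -
    have "exp (- \<bar>p\<bar>) \<le> exp (1 + - \<bar>t\<bar>)"
      using that by simp
    also have "\<dots> = exp 1 * exp (- \<bar>t\<bar>)"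
      by (rule exp_add)
    also have "\<dots> \<le> 3 * exp (- \<bar>t\<bar>)"
      by (intro mult_right_mono exp3) simp
    finally have "(1 + R) * exp (- \<bar>p\<bar>) \<le> (1 + R) * (3 * exp (- \<bar>t\<bar>))"
      using R_nonneg by (intro mult_left_mono) auto
    then show ?thesis by (simp only: mult_ac)
  qed
  have 3: "0 \<le> 3 * (1 + R) * exp (- \<bar>t\<bar>)"
    using R_nonneg by simp
  have "\<bar>opt_interp t\<bar> \<le> 3 * (1 + R) * exp (- \<bar>t\<bar>) \<and> design_range N x \<le> \<bar>t\<bar>"
  proof (cases "x 1 \<le> t")
    case True
    then have t: "x N \<le> t"
      using assms by simp
    have b: "0 \<le> hat_fun x N t" "hat_fun x N t \<le> 1"
      using hat_bounds[of N t] N2 by auto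
    have "\<bar>opt_interp t\<bar> = opt (x N) * hat_fun x N t"
      unfolding sum_hat_right_end[OF t] using opt_nonneg b by simp
    also have "\<dots> \<le> 3 * (1 + R) * exp (- \<bar>t\<bar>)"
    proof (cases "t \<le> x (Suc N)")
      case True
      have "\<bar>t\<bar> \<le> \<bar>x N\<bar> + 1"
        using True node_step[of N] mesh_le node_ends range_ge t by simp
      then have "opt (x N) \<le> 3 * (1 + R) * exp (- \<bar>t\<bar>)"
        using opt_le[of "x N"] node[of "x N"] by linarith
      moreover have "opt (x N) * hat_fun x N t \<le> opt (x N)"
        using opt_nonneg b by (intro mult_left_le) auto
      ultimately show ?thesis by linarith
    next
      case False
      then have "hat_fun x N t = 0"
        using N2 by (intro hat_outside) auto
      then show ?thesis using 3 by simp
    qed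
    finally show ?thesis
      using t node_ends range_ge by simp
  next
    case False
    then have t: "t < x 1" by simp
    have b: "0 \<le> hat_fun x 1 t" "hat_fun x 1 t \<le> 1"
      using hat_bounds[of 1 t] N2 by auto
    have "\<bar>opt_interp t\<bar> = opt (x 1) * hat_fun x 1 t"
      unfolding sum_hat_left_end[OF t] using opt_nonneg b by simp
    also have "\<dots> \<le> 3 * (1 + R) * exp (- \<bar>t\<bar>)"
    proof (cases "x 0 \<le> t")
      case True
      have "\<bar>t\<bar> \<le> \<bar>x 1\<bar> + 1"
        using True node_step[of 0] mesh_le node_ends range_ge t by simp
      then have "opt (x 1) \<le> 3 * (1 + R) * exp (- \<bar>t\<bar>)"
        using opt_le[of "x 1"] node[of "x 1"] by linarith
      moreover have "opt (x 1) * hat_fun x 1 t \<le> opt (x 1)"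
        using opt_nonneg b by (intro mult_left_le) auto
      ultimately show ?thesis by linarith
    next
      case False
      then have "hat_fun x 1 t = 0"
        using N2 by (intro hat_outside) auto
      then show ?thesis using 3 by simp
    qed
    finally show ?thesis
      using t node_ends range_ge by simp
  qed
  then show "\<bar>opt_interp t - opt t\<bar> \<le> 4 * (1 + R) * exp (- \<bar>t\<bar>)" "design_range N x \<le> \<bar>t\<bar>"
    using opt_le[of t] opt_nonneg[of t] by (auto simp: abs_le_iff algebra_simps)
qed

definition bias :: "real \<Rightarrow> real" where
  "bias t = kink0 t + opt_interp t - opt t"

lemma hat_measurable [measurable]: "hat_fun x j \<in> borel_measurable borel"
  unfolding hat_fun_def[abs_def] by measurable

lemma kink_measurable [measurable]: "kink a b \<in> borel_measurable borel"
  unfolding kink_def[abs_def] by measurable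

lemma bias_measurable [measurable]: "bias \<in> borel_measurable borel"
  unfolding bias_def[abs_def] by measurable

text \<open>Four contributions: the kink gives \<open>4\<close>, the mixture of calls
  \<open>8 * (1 + R)\<close>, the call at 0 another \<open>8\<close>, and the region outside the
  nodes \<open>4 * (1 + R) * 6 * max 0 C1\<close>. The truncation at 0 makes the constant visibly
  nonnegative.\<close>

lemma bias_bound:
  assumes C1: "design_range N x * exp (- design_range N x) \<le> C1 * \<Delta>\<^sup>2"
  shows "(\<integral>\<^sup>+ t. ennreal ((1 + \<bar>t\<bar>) * \<bar>bias t\<bar>) \<partial>lborel) \<le> ennreal ((12 + 8 * (1 + R) + 24 * (1 + R) * max 0 C1) * \<Delta>\<^sup>2)"
proof -
  interpret prob_space law by (rule prob_law)
  interpret P: pair_sigma_finite lborel law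
    by unfold_locales
  let ?A = "design_range N x"
  let ?w = "\<lambda>t::real. 1 + \<bar>t\<bar>"
  let ?T1 = "\<lambda>t. ennreal (2 * \<Delta>) * indicator {- \<Delta>..\<Delta>} t"
  let ?T2 = "\<lambda>t. \<integral>\<^sup>+ y. ennreal (?w t * (exp y * interp_kernel \<Delta> (t - y))) \<partial>law"
  let ?T3 = "\<lambda>t. ennreal (?w t * interp_kernel \<Delta> t)"
  let ?T4 = "\<lambda>t. ennreal (4 * (1 + R)) * (ennreal (?w t * exp (- \<bar>t\<bar>)) * indicator {t. ?A \<le> \<bar>t\<bar>} t)"
  have \<Delta>: "0 \<le> \<Delta>" "\<Delta> \<le> 1"
    using mesh_pos mesh_le by auto
  have "(\<integral>\<^sup>+ t. ennreal (?w t * \<bar>bias t\<bar>) \<partial>lborel) \<le> (\<integral>\<^sup>+ t. ?T1 t + ?T2 t + ?T3 t + ?T4 t \<partial>lborel)"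
  proof (rule nn_integral_mono)
    fix t :: real
    have "?w t * kink0 t \<le> 2 * \<Delta> * indicator {- \<Delta>..\<Delta>} t"
    proof (cases "t \<in> {- \<Delta>..\<Delta>}")
      case True
      then have "?w t * kink0 t \<le> 2 * (\<Delta> * indicator {- \<Delta>..\<Delta>} t)"
        using \<Delta> kink0_bounds[of t] by (intro mult_mono) auto
      then show ?thesis by simp
    next
      case False
      then have "kink0 t = 0"
        using kink0_bounds[of t] by (simp add: order_antisym)
      then show ?thesis using \<Delta> by simp
    qed
    then have "ennreal (?w t * kink0 t) \<le> ennreal (2 * \<Delta> * indicator {- \<Delta>..\<Delta>} t)"
      by (rule ennreal_leI)
    also have "\<dots> = ?T1 t"
      by (simp add: indicator_def)
    finally have T1: "ennreal (?w t * kink0 t) \<le> ?T1 t" .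
    have T234: "ennreal (?w t * \<bar>opt_interp t - opt t\<bar>) \<le> ?T2 t + ?T3 t + ?T4 t"
    proof (cases "x 1 \<le> t \<and> t < x N")
      case True
      have "ennreal (?w t * \<bar>opt_interp t - opt t\<bar>) = ennreal (?w t) * ennreal \<bar>opt_interp t - opt t\<bar>"
        by (rule ennreal_mult) auto
      also have "\<dots> \<le> ennreal (?w t) * ((\<integral>\<^sup>+ y. ennreal (exp y * interp_kernel \<Delta> (t - y)) \<partial>law) + ennreal (interp_kernel \<Delta> t))"
        using True by (intro mult_left_mono inner_error) auto
      also have "\<dots> = ennreal (?w t) * (\<integral>\<^sup>+ y. ennreal (exp y * interp_kernel \<Delta> (t - y)) \<partial>law) + ?T3 t"
        using interp_kernel_nonneg[OF \<Delta>(1)] by (simp add: distrib_left ennreal_mult)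
      also have "ennreal (?w t) * (\<integral>\<^sup>+ y. ennreal (exp y * interp_kernel \<Delta> (t - y)) \<partial>law) = ?T2 t"
        using interp_kernel_nonneg[OF \<Delta>(1)]
        by (subst nn_integral_cmult[symmetric], measurable) (intro nn_integral_cong ennreal_mult[symmetric], auto)
      finally show ?thesis
        by (rule order_trans) simp
    next
      case False
      have "?w t * \<bar>opt_interp t - opt t\<bar> \<le> ?w t * (4 * (1 + R) * exp (- \<bar>t\<bar>))"
        using outer_error[OF False] by (intro mult_left_mono) auto
      then have "ennreal (?w t * \<bar>opt_interp t - opt t\<bar>) \<le> ennreal (4 * (1 + R) * (?w t * exp (- \<bar>t\<bar>)))"
        by (intro ennreal_leI) (simp add: mult_ac)
      also have "\<dots> = ?T4 t"
        using outer_error(2)[OF False] R_nonneg by (simp add: ennreal_mult)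
      also have "\<dots> \<le> ?T2 t + ?T3 t + ?T4 t"
        by simp
      finally show ?thesis .
    qed
    have "\<bar>bias t\<bar> \<le> kink0 t + \<bar>opt_interp t - opt t\<bar>"
      using kink0_bounds[of t] unfolding bias_def by linarith
    then have "?w t * \<bar>bias t\<bar> \<le> ?w t * (kink0 t + \<bar>opt_interp t - opt t\<bar>)"
      by (intro mult_left_mono) auto
    then have "ennreal (?w t * \<bar>bias t\<bar>) \<le> ennreal (?w t * kink0 t + ?w t * \<bar>opt_interp t - opt t\<bar>)"
      by (intro ennreal_leI) (simp add: distrib_left)
    also have "\<dots> = ennreal (?w t * kink0 t) + ennreal (?w t * \<bar>opt_interp t - opt t\<bar>)"
      using kink0_bounds[of t] by (intro ennreal_plus) auto
    also have "\<dots> \<le> ?T1 t + (?T2 t + ?T3 t + ?T4 t)"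
      by (intro add_mono T1 T234)
    finally show "ennreal (?w t * \<bar>bias t\<bar>) \<le> ?T1 t + ?T2 t + ?T3 t + ?T4 t"
      by (simp only: add.assoc)
  qed
  also have "\<dots> = (\<integral>\<^sup>+ t. ?T1 t \<partial>lborel) + (\<integral>\<^sup>+ t. ?T2 t \<partial>lborel) + (\<integral>\<^sup>+ t. ?T3 t \<partial>lborel) + (\<integral>\<^sup>+ t. ?T4 t \<partial>lborel)"
    by (simp add: nn_integral_add)
  also have "\<dots> \<le> ennreal (4 * \<Delta>\<^sup>2) + ennreal (8 * (1 + R) * \<Delta>\<^sup>2) + ennreal (8 * \<Delta>\<^sup>2) + ennreal (24 * (1 + R) * max 0 C1 * \<Delta>\<^sup>2)"
  proof (intro add_mono)
    have "(\<integral>\<^sup>+ t. ?T1 t \<partial>lborel) = ennreal (2 * \<Delta>) * ennreal (2 * \<Delta>)"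
      using \<Delta> by (simp add: nn_integral_cmult_indicator)
    then show "(\<integral>\<^sup>+ t. ?T1 t \<partial>lborel) \<le> ennreal (4 * \<Delta>\<^sup>2)"
      using \<Delta> by (simp add: ennreal_mult[symmetric] power2_eq_square)
    have "(\<integral>\<^sup>+ t. ?T2 t \<partial>lborel) = (\<integral>\<^sup>+ y. \<integral>\<^sup>+ t. ennreal (?w t * (exp y * interp_kernel \<Delta> (t - y))) \<partial>lborel \<partial>law)"
      by (rule P.Fubini'[symmetric]) measurable
    also have "\<dots> \<le> (\<integral>\<^sup>+ y. ennreal (exp y * (1 + \<bar>y\<bar>)) * ennreal (8 * \<Delta>\<^sup>2) \<partial>law)"
      using \<Delta> by (intro nn_integral_mono interp_kernel_shifted)
    also have "\<dots> = (\<integral>\<^sup>+ y. ennreal (exp y * (1 + \<bar>y\<bar>)) \<partial>law) * ennreal (8 * \<Delta>\<^sup>2)"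
      by (rule nn_integral_multc) measurable
    also have "\<dots> \<le> ennreal (1 + R) * ennreal (8 * \<Delta>\<^sup>2)"
      by (intro mult_right_mono law_weight) auto
    also have "\<dots> = ennreal (8 * (1 + R) * \<Delta>\<^sup>2)"
      using R_nonneg by (subst ennreal_mult[symmetric]) (auto simp: mult_ac)
    finally show "(\<integral>\<^sup>+ t. ?T2 t \<partial>lborel) \<le> ennreal (8 * (1 + R) * \<Delta>\<^sup>2)" .
    show "(\<integral>\<^sup>+ t. ?T3 t \<partial>lborel) \<le> ennreal (8 * \<Delta>\<^sup>2)"
      using interp_kernel_weighted[OF \<Delta>] .
    \<comment> \<open>\<open>?A \<ge> 1\<close> gives \<open>2 * (2 + ?A) \<le> 6 * ?A\<close>,
      which brings in the assumed bound on \<open>?A * exp (- ?A)\<close>.\<close>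
    have A: "2 * (2 + ?A) * exp (- ?A) \<le> 6 * (max 0 C1 * \<Delta>\<^sup>2)"
    proof -
      have "2 * (2 + ?A) * exp (- ?A) \<le> 6 * ?A * exp (- ?A)"
        using range_ge by (intro mult_right_mono) auto
      also have "\<dots> \<le> 6 * (C1 * \<Delta>\<^sup>2)"
        using C1 by simp
      also have "\<dots> \<le> 6 * (max 0 C1 * \<Delta>\<^sup>2)"
        by (intro mult_left_mono mult_right_mono) auto
      finally show ?thesis .
    qed
    have "(\<integral>\<^sup>+ t. ?T4 t \<partial>lborel) = ennreal (4 * (1 + R)) * (\<integral>\<^sup>+ t. ennreal (?w t * exp (- \<bar>t\<bar>)) * indicator {t. ?A \<le> \<bar>t\<bar>} t \<partial>lborel)"
      by (rule nn_integral_cmult) measurable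
    also have "\<dots> \<le> ennreal (4 * (1 + R)) * ennreal (6 * (max 0 C1 * \<Delta>\<^sup>2))"
      using range_ge by (intro mult_left_mono order_trans[OF nn_integral_laplace_tail] ennreal_leI[OF A]) auto
    also have "\<dots> = ennreal (24 * (1 + R) * max 0 C1 * \<Delta>\<^sup>2)"
      using R_nonneg by (subst ennreal_mult[symmetric]) (auto simp: mult_ac)
    finally show "(\<integral>\<^sup>+ t. ?T4 t \<partial>lborel) \<le> ennreal (24 * (1 + R) * max 0 C1 * \<Delta>\<^sup>2)" .
  qed
  also have "\<dots> = ennreal ((12 + 8 * (1 + R) + 24 * (1 + R) * max 0 C1) * \<Delta>\<^sup>2)"
    using R_nonneg by (simp add: ennreal_plus[symmetric] algebra_simps del: ennreal_plus)
  finally show ?thesis .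
qed

end

section \<open>Noise and the error of the interpolant\<close>

text \<open>Independence and zero means remove the mixed terms; unit variances leave the squared
  coefficients.\<close>

lemma noise_second_moment:
  fixes c :: "nat \<Rightarrow> complex"
  assumes noise: "noise M N e B"
  shows "(\<integral>\<^sup>+ \<omega>. ennreal ((cmod (\<Sum>j=1..N. c j * of_real (e j \<omega>)))\<^sup>2) \<partial>M) = ennreal (\<Sum>j=1..N. (cmod (c j))\<^sup>2)"
proof -
  interpret prob_space M
    using noise by (simp add: noise_def)
  have indep: "indep_vars (\<lambda>_. borel) e {1..N}"
    using noise by (simp add: noise_def)
  have meas [measurable]: "e j \<in> borel_measurable M" if "j \<in> {1..N}" for j
    using indep that by (auto simp: indep_vars_def)
  have e4: "integrable M (\<lambda>\<omega>. (e j \<omega>) ^ 4)" and mean: "(LINT \<omega>|M. e j \<omega>) = 0" and var: "(LINT \<omega>|M. (e j \<omega>)\<^sup>2) = 1"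
    if "j \<in> {1..N}" for j
    using noise that by (auto simp: noise_def)
  \<comment> \<open>\<open>noise\<close> states integrability for the fourth powers; these bounds
    pass it on to \<open>e j\<close> and its square.\<close>
  have poly: "\<bar>t\<bar> \<le> 2 + t ^ 4" "t\<^sup>2 \<le> 2 + t ^ 4" for t :: real
  proof -
    have "t ^ 4 = t\<^sup>2 * t\<^sup>2" by (simp flip: power_add)
    moreover have "2 * t\<^sup>2 \<le> 1 + t\<^sup>2 * t\<^sup>2"
      using sum_squares_bound[of 1 "t\<^sup>2"] by (simp add: power2_eq_square)
    moreover have "2 * \<bar>t\<bar> \<le> 1 + t\<^sup>2"
      using sum_squares_bound[of 1 "\<bar>t\<bar>"] by simp
    moreover have "a \<le> 2 + c \<and> b \<le> 2 + c" if "2 * b \<le> 1 + c" "2 * a \<le> 1 + b" "0 \<le> b" for a b c :: real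
      using that by linarith
    ultimately show "\<bar>t\<bar> \<le> 2 + t ^ 4" "t\<^sup>2 \<le> 2 + t ^ 4"
      using zero_le_power2[of t] by metis+
  qed
  have dom: "integrable M (\<lambda>\<omega>. 2 + (e j \<omega>) ^ 4)" if "j \<in> {1..N}" for j
    using e4[OF that] by simp
  have e1: "integrable M (e j)" and e2: "integrable M (\<lambda>\<omega>. (e j \<omega>)\<^sup>2)" if j: "j \<in> {1..N}" for j
  proof -
    note m = meas[OF j]
    show "integrable M (e j)"
      by (rule Bochner_Integration.integrable_bound[OF dom[OF j] m])
        (intro AE_I2, unfold real_norm_def, rule order_trans[OF poly(1) abs_ge_self])
    show "integrable M (\<lambda>\<omega>. (e j \<omega>)\<^sup>2)"
      by (rule Bochner_Integration.integrable_bound[OF dom[OF j] borel_measurable_power[OF m]])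
        (intro AE_I2, unfold real_norm_def abs_power2, rule order_trans[OF poly(2) abs_ge_self])
  qed
  have prod: "integrable M (\<lambda>\<omega>. e i \<omega> * e j \<omega>) \<and> (LINT \<omega>|M. e i \<omega> * e j \<omega>) = (if i = j then 1 else 0)"
    if i: "i \<in> {1..N}" and j: "j \<in> {1..N}" for i j
  proof (cases "i = j")
    case True
    then show ?thesis
      using e2[OF i] var[OF i] by (simp add: power2_eq_square)
  next
    case False
    have "indep_vars (\<lambda>_. borel) e {i, j}"
      using i j by (intro indep_vars_subset[OF indep]) auto
    then have "(LINT \<omega>|M. (\<Prod>l\<in>{i, j}. e l \<omega>)) = (\<Prod>l\<in>{i, j}. LINT \<omega>|M. e l \<omega>)"
      "integrable M (\<lambda>\<omega>. \<Prod>l\<in>{i, j}. e l \<omega>)"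
      using e1 i j by (auto intro!: indep_vars_lebesgue_integral indep_vars_integrable)
    then show ?thesis
      using False mean[OF i] by simp
  qed
  let ?Z = "\<lambda>\<omega>. \<Sum>j=1..N. c j * of_real (e j \<omega>)"
  have Z: "complex_of_real ((cmod (?Z \<omega>))\<^sup>2) = (\<Sum>i=1..N. \<Sum>j=1..N. c i * cnj (c j) * of_real (e i \<omega> * e j \<omega>))" for \<omega>
    unfolding complex_norm_square cnj_sum sum_product
    by (intro sum.cong refl) simp
  have term_int: "integrable M (\<lambda>\<omega>. c i * cnj (c j) * complex_of_real (e i \<omega> * e j \<omega>))"
    and term_val: "(LINT \<omega>|M. c i * cnj (c j) * complex_of_real (e i \<omega> * e j \<omega>)) = c i * cnj (c j) * (if i = j then 1 else 0)"
    if "i \<in> {1..N}" "j \<in> {1..N}" for i j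
    using prod[OF that] by (auto simp only: integral_mult_right_zero integral_complex_of_real of_real_1 of_real_0 intro!: integrable_mult_right integrable_of_real split: if_splits)
  have int: "integrable M (\<lambda>\<omega>. complex_of_real ((cmod (?Z \<omega>))\<^sup>2))"
    unfolding Z using term_int by (intro Bochner_Integration.integrable_sum) auto
  have "complex_of_real (LINT \<omega>|M. (cmod (?Z \<omega>))\<^sup>2) = (LINT \<omega>|M. complex_of_real ((cmod (?Z \<omega>))\<^sup>2))"
    by (rule integral_complex_of_real[symmetric])
  also have "\<dots> = (\<Sum>i=1..N. LINT \<omega>|M. (\<Sum>j=1..N. c i * cnj (c j) * of_real (e i \<omega> * e j \<omega>)))"
    unfolding Z using term_int by (intro Bochner_Integration.integral_sum Bochner_Integration.integrable_sum) auto
  also have "\<dots> = (\<Sum>i=1..N. \<Sum>j=1..N. c i * cnj (c j) * (if i = j then 1 else 0))"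
  proof (intro sum.cong refl)
    fix i assume i: "i \<in> {1..N}"
    have "(LINT \<omega>|M. (\<Sum>j=1..N. c i * cnj (c j) * of_real (e i \<omega> * e j \<omega>))) = (\<Sum>j=1..N. LINT \<omega>|M. c i * cnj (c j) * of_real (e i \<omega> * e j \<omega>))"
      using term_int i by (intro Bochner_Integration.integral_sum) auto
    also have "\<dots> = (\<Sum>j=1..N. c i * cnj (c j) * (if i = j then 1 else 0))"
      using term_val i by (intro sum.cong) auto
    finally show "(LINT \<omega>|M. (\<Sum>j=1..N. c i * cnj (c j) * of_real (e i \<omega> * e j \<omega>))) = (\<Sum>j=1..N. c i * cnj (c j) * (if i = j then 1 else 0))" .
  qed
  also have "\<dots> = of_real (\<Sum>j=1..N. (cmod (c j))\<^sup>2)"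
    unfolding of_real_sum complex_norm_square by (intro sum.cong refl) (simp add: if_distrib sum.delta cong: if_cong)
  finally have val: "(LINT \<omega>|M. (cmod (?Z \<omega>))\<^sup>2) = (\<Sum>j=1..N. (cmod (c j))\<^sup>2)"
    by (simp only: of_real_eq_iff)
  have "integrable M (\<lambda>\<omega>. (cmod (?Z \<omega>))\<^sup>2)"
    using int unfolding complex_of_real_integrable_eq .
  then show ?thesis
    unfolding val[symmetric] by (intro nn_integral_eq_integral) auto
qed

lemma fourier_square_integral_le:
  assumes f: "integrable lborel f"
  shows "(\<integral>\<^sup>+ u. ennreal ((cmod (fourier f u))\<^sup>2) \<partial>lborel) \<le> ennreal (2 * pi) * (\<integral>\<^sup>+ x. ennreal ((cmod (f x))\<^sup>2) \<partial>lborel)"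
proof -
  have [measurable]: "f \<in> borel_measurable borel"
    using borel_measurable_integrable[OF f] by simp
  have "(\<integral>\<^sup>+ u. ennreal ((cmod (fourier f u))\<^sup>2) \<partial>lborel) = (\<integral>\<^sup>+ u. ennreal ((2 * pi)\<^sup>2) * ennreal ((cmod (inv_fourier f (- u)))\<^sup>2) \<partial>lborel)"
    by (intro nn_integral_cong) (simp add: fourier_eq_inv_fourier norm_mult power_mult_distrib ennreal_mult)
  also have "\<dots> = ennreal ((2 * pi)\<^sup>2) * (\<integral>\<^sup>+ u. ennreal ((cmod (inv_fourier f (- u)))\<^sup>2) \<partial>lborel)"
    by (rule nn_integral_cmult) measurable
  also have "(\<integral>\<^sup>+ u. ennreal ((cmod (inv_fourier f (- u)))\<^sup>2) \<partial>lborel) = (\<integral>\<^sup>+ u. ennreal ((cmod (inv_fourier f u))\<^sup>2) \<partial>lborel)"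
    by (subst (2) nn_integral_real_affine[where c = "-1" and t = 0]) auto
  also have "ennreal ((2 * pi)\<^sup>2) * \<dots> \<le> ennreal ((2 * pi)\<^sup>2) * (ennreal (1 / (2 * pi)) * (\<integral>\<^sup>+ x. ennreal ((cmod (f x))\<^sup>2) \<partial>lborel))"
    by (intro mult_left_mono plancherel_le[OF f]) auto
  also have "\<dots> = ennreal ((2 * pi)\<^sup>2 * (1 / (2 * pi))) * (\<integral>\<^sup>+ x. ennreal ((cmod (f x))\<^sup>2) \<partial>lborel)"
    by (subst ennreal_mult) (auto simp: mult.assoc)
  also have "(2 * pi)\<^sup>2 * (1 / (2 * pi)) = 2 * pi"
    by (simp add: power2_eq_square)
  finally show ?thesis .
qed

text \<open>The exponents 0 and 1 stand for an error and its product with the argument; the weight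
  \<open>1 + |t|\<close> handles both at once.\<close>

lemma power_weight_le: "p \<le> 1 \<Longrightarrow> \<bar>t ^ p\<bar> \<le> 1 + \<bar>t\<bar>" for t :: real
  by (cases p) auto

lemma integrable_cmult_Icc: "integrable lborel (\<lambda>t. c * indicator {a..b} t :: real)" for a b c :: real
  by (intro integrable_mult_right integrable_real_indicator) (simp_all add: emeasure_lborel_Icc_eq)

context option_model
begin

lemma kink0_weighted_le: "(1 + \<bar>t\<bar>) * kink0 t \<le> 2 * indicator {- \<Delta>..\<Delta>} t"
proof (cases "t \<in> {- \<Delta>..\<Delta>}")
  case True
  then have "(1 + \<bar>t\<bar>) * kink0 t \<le> 2 * 1"
    using mesh_le kink0_bounds[of t] by (intro mult_mono) auto
  then show ?thesis
    using True by simp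
next
  case False
  then have "kink0 t = 0"
    using kink0_bounds[of t] by (simp add: order_antisym)
  then show ?thesis by simp
qed

lemma hat_weighted_le:
  assumes j: "1 \<le> j" "j \<le> N"
  shows "(1 + \<bar>t\<bar>) * hat_fun x j t \<le> (2 + \<bar>x j\<bar>) * indicator {x (j - 1)..x (j + 1)} t"
proof (cases "t \<in> {x (j - 1)..x (j + 1)}")
  case True
  have "x j - x (j - 1) \<le> \<Delta>" "x (j + 1) - x j \<le> \<Delta>"
    using node_step[of "j - 1"] node_step[of j] j by simp_all
  then have "\<bar>t\<bar> \<le> 1 + \<bar>x j\<bar>"
    using True mesh_le unfolding atLeastAtMost_iff by linarith
  then have "(1 + \<bar>t\<bar>) * hat_fun x j t \<le> (2 + \<bar>x j\<bar>) * 1"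
    using hat_bounds[OF j, of t] by (intro mult_mono) auto
  then show ?thesis
    using True by simp
next
  case False
  then show ?thesis
    using hat_outside[OF j] by simp
qed

lemma weighted_int:
  fixes f g :: "real \<Rightarrow> real"
  assumes p: "p \<le> 1" and g: "integrable lborel g" and [measurable]: "f \<in> borel_measurable borel"
    and f: "\<And>t. 0 \<le> f t" "\<And>t. (1 + \<bar>t\<bar>) * f t \<le> g t"
  shows "integrable lborel (\<lambda>t. t ^ p * f t)" and "(LINT t|lborel. \<bar>t ^ p * f t\<bar>) \<le> (LINT t|lborel. g t)"
proof -
  have le: "\<bar>t ^ p * f t\<bar> \<le> g t" for t
    using mult_right_mono[OF power_weight_le[OF p, of t] f(1)[of t]] f(1)[of t] f(2)[of t] by (simp add: abs_mult)
  show int: "integrable lborel (\<lambda>t. t ^ p * f t)"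
    by (rule Bochner_Integration.integrable_bound[OF g], measurable)
      (intro AE_I2, unfold real_norm_def, rule order_trans[OF le abs_ge_self])
  show "(LINT t|lborel. \<bar>t ^ p * f t\<bar>) \<le> (LINT t|lborel. g t)"
    using int g le by (intro integral_mono) auto
qed

lemma hat_power_int:
  assumes j: "1 \<le> j" "j \<le> N" and p: "p \<le> 1"
  shows "integrable lborel (\<lambda>t. t ^ p * hat_fun x j t)"
  by (rule weighted_int(1)[OF p integrable_cmult_Icc _ _ hat_weighted_le[OF j]]) (use hat_bounds[OF j] in auto)

text \<open>A hat has support of length at most \<open>2 * \<Delta>\<close>. For
  \<open>p = 1\<close> the position of the node enters; this is the origin of the terms
  \<open>x j * \<delta> j\<close> in the condition on the noise levels.\<close>

lemma hat_fourier_le: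
  assumes j: "1 \<le> j" "j \<le> N" and p: "p \<le> 1"
  shows "cmod (fourier (\<lambda>t. of_real (t ^ p * hat_fun x j t)) u) \<le> (2 + \<bar>x j\<bar>) * (2 * \<Delta>)"
proof -
  have "cmod (fourier (\<lambda>t. of_real (t ^ p * hat_fun x j t)) u) \<le> (LINT t|lborel. cmod (of_real (t ^ p * hat_fun x j t)))"
    using hat_power_int[OF assms] by (intro fourier_norm_le integrable_of_real)
  also have "\<dots> \<le> (LINT t|lborel. (2 + \<bar>x j\<bar>) * indicator {x (j - 1)..x (j + 1)} t)"
    unfolding norm_of_real
    by (rule weighted_int(2)[OF p integrable_cmult_Icc _ _ hat_weighted_le[OF j]]) (use hat_bounds[OF j] in auto)
  also have "\<dots> = (2 + \<bar>x j\<bar>) * (x (j + 1) - x (j - 1))"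
    using node_mono[of "j - 1" "j + 1"] j by (simp add: measure_lborel_Icc)
  also have "\<dots> \<le> (2 + \<bar>x j\<bar>) * (2 * \<Delta>)"
  proof (rule mult_left_mono)
    have "x j - x (j - 1) \<le> \<Delta>" "x (j + 1) - x j \<le> \<Delta>"
      using node_step[of "j - 1"] node_step[of j] j by simp_all
    then show "x (j + 1) - x (j - 1) \<le> 2 * \<Delta>"
      by linarith
  qed simp
  finally show ?thesis .
qed

text \<open>The error of the interpolant when the realised noise variables are \<open>z\<close>.\<close>

definition opt_error :: "(nat \<Rightarrow> real) \<Rightarrow> real \<Rightarrow> real" where
  "opt_error z t = bias t + (\<Sum>j=1..N. \<delta> j * z j * hat_fun x j t)"

lemma opt_error_eq: "opt_error z t = interpolant N x (\<lambda>j\<in>{1..N}. opt (x j) + \<delta> j * z j) t - opt t"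
proof -
  have "(\<Sum>j=1..N. (\<lambda>j\<in>{1..N}. opt (x j) + \<delta> j * z j) j * hat_fun x j t) = opt_interp t + (\<Sum>j=1..N. \<delta> j * z j * hat_fun x j t)"
    unfolding sum.distrib[symmetric] by (intro sum.cong) (auto simp: algebra_simps)
  then show ?thesis
    by (simp add: opt_error_def bias_def interpolant_def)
qed

lemma bias_power_int:
  assumes p: "p \<le> 1"
  shows "integrable lborel (\<lambda>t. t ^ p * bias t)"
proof -
  have k: "integrable lborel (\<lambda>t. t ^ p * kink0 t)"
    by (rule weighted_int(1)[OF p integrable_cmult_Icc _ _ kink0_weighted_le]) (use kink0_bounds in auto)
  have o: "integrable lborel (\<lambda>t. t ^ p * opt t)"
    using opt_int x_opt_int p by (cases p) auto
  have "integrable lborel (\<lambda>t. t ^ p * kink0 t + (\<Sum>j=1..N. opt (x j) * (t ^ p * hat_fun x j t)) - t ^ p * opt t)"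
    using k o hat_power_int[OF _ _ p] by (intro Bochner_Integration.integrable_diff Bochner_Integration.integrable_add Bochner_Integration.integrable_sum integrable_mult_right) auto
  also have "(\<lambda>t. t ^ p * kink0 t + (\<Sum>j=1..N. opt (x j) * (t ^ p * hat_fun x j t)) - t ^ p * opt t) = (\<lambda>t. t ^ p * bias t)"
    by (simp add: bias_def fun_eq_iff algebra_simps sum_distrib_left)
  finally show ?thesis .
qed

lemma opt_error_expand:
  "complex_of_real (t ^ p * opt_error z t) = of_real (t ^ p * bias t) + (\<Sum>j=1..N. of_real (\<delta> j * z j) * of_real (t ^ p * hat_fun x j t))"
  by (simp add: opt_error_def distrib_left sum_distrib_left mult_ac)

lemma opt_error_int:
  assumes p: "p \<le> 1"
  shows "integrable lborel (\<lambda>t. complex_of_real (t ^ p * opt_error z t))"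
  unfolding opt_error_expand using bias_power_int[OF p] hat_power_int[OF _ _ p]
  by (intro Bochner_Integration.integrable_add Bochner_Integration.integrable_sum integrable_mult_right integrable_of_real) auto

text \<open>Affine dependence on the noise with deterministic coefficients: it gives measurability
  in the noise and, by \<open>noise_second_moment\<close>, the second moment.\<close>

lemma opt_error_fourier:
  assumes p: "p \<le> 1"
  shows "fourier (\<lambda>t. of_real (t ^ p * opt_error z t)) u =
    fourier (\<lambda>t. of_real (t ^ p * bias t)) u + (\<Sum>j=1..N. (of_real (\<delta> j) * fourier (\<lambda>t. of_real (t ^ p * hat_fun x j t)) u) * of_real (z j))"
proof -
  have b: "integrable lborel (\<lambda>t. complex_of_real (t ^ p * bias t))"
    using bias_power_int[OF p] by (rule integrable_of_real)
  have h: "integrable lborel (\<lambda>t. of_real (\<delta> j * z j) * complex_of_real (t ^ p * hat_fun x j t))" if "j \<in> {1..N}" for j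
    using hat_power_int[OF _ _ p] that by (intro integrable_mult_right integrable_of_real) auto
  have "fourier (\<lambda>t. of_real (t ^ p * opt_error z t)) u =
    fourier (\<lambda>t. of_real (t ^ p * bias t)) u + fourier (\<lambda>t. \<Sum>j=1..N. of_real (\<delta> j * z j) * of_real (t ^ p * hat_fun x j t)) u"
    unfolding opt_error_expand by (rule fourier_add[OF b Bochner_Integration.integrable_sum[OF h]])
  also have "fourier (\<lambda>t. \<Sum>j=1..N. of_real (\<delta> j * z j) * of_real (t ^ p * hat_fun x j t)) u = (\<Sum>j=1..N. fourier (\<lambda>t. of_real (\<delta> j * z j) * of_real (t ^ p * hat_fun x j t)) u)"
    by (rule fourier_sum[OF h])
  finally show ?thesis
    by (simp only: fourier_cmult of_real_mult[of "\<delta> _"] mult_ac)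
qed

text \<open>A qualitative bound that may depend on the realised noise. Together with integrability
  it puts the error into L^2.\<close>

lemma opt_error_bounded:
  assumes p: "p \<le> 1"
  shows "\<exists>b. \<forall>t. \<bar>t ^ p * opt_error z t\<bar> \<le> b"
proof -
  let ?v = "\<lambda>j. opt (x j) + \<delta> j * z j"
  define b where "b = 2 + (\<Sum>j=1..N. \<bar>?v j\<bar> * (2 + \<bar>x j\<bar>)) + 2 * (1 + R)"
  have "\<bar>t ^ p * opt_error z t\<bar> \<le> b" for t
  proof -
    let ?S = "\<Sum>j=1..N. ?v j * hat_fun x j t"
    have k: "(1 + \<bar>t\<bar>) * kink0 t \<le> 2"
      by (rule order_trans[OF kink0_weighted_le]) (simp add: indicator_def)
    have o: "(1 + \<bar>t\<bar>) * opt t \<le> 2 * (1 + R)"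
    proof -
      have "1 + \<bar>t\<bar> \<le> exp \<bar>t\<bar>"
        by (rule exp_ge_add_one_self)
      then have "(1 + \<bar>t\<bar>) * exp (- \<bar>t\<bar>) \<le> 1"
        by (simp add: exp_minus divide_inverse[symmetric] divide_le_eq)
      then have "(1 + R) * ((1 + \<bar>t\<bar>) * exp (- \<bar>t\<bar>)) \<le> (1 + R) * 1"
        using R_nonneg by (intro mult_left_mono) auto
      also have "\<dots> \<le> 2 * (1 + R)"
        using R_nonneg by simp
      finally show ?thesis
        using opt_weighted_le[of t] by (rule order_trans[rotated])
    qed
    have h: "(1 + \<bar>t\<bar>) * \<bar>?S\<bar> \<le> (\<Sum>j=1..N. \<bar>?v j\<bar> * (2 + \<bar>x j\<bar>))"
    proof -
      have "(1 + \<bar>t\<bar>) * \<bar>?S\<bar> \<le> (1 + \<bar>t\<bar>) * (\<Sum>j=1..N. \<bar>?v j * hat_fun x j t\<bar>)"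
        by (intro mult_left_mono sum_abs) auto
      also have "\<dots> = (\<Sum>j=1..N. \<bar>?v j\<bar> * ((1 + \<bar>t\<bar>) * hat_fun x j t))"
        unfolding sum_distrib_left using hat_bounds by (intro sum.cong) (auto simp: abs_mult)
      also have "\<dots> \<le> (\<Sum>j=1..N. \<bar>?v j\<bar> * (2 + \<bar>x j\<bar>))"
      proof (intro sum_mono mult_left_mono)
        fix j assume "j \<in> {1..N}"
        then have "(1 + \<bar>t\<bar>) * hat_fun x j t \<le> (2 + \<bar>x j\<bar>) * indicator {x (j - 1)..x (j + 1)} t"
          by (intro hat_weighted_le) auto
        also have "\<dots> \<le> (2 + \<bar>x j\<bar>) * 1"
          by (intro mult_left_mono) (auto simp: indicator_def)
        finally show "(1 + \<bar>t\<bar>) * hat_fun x j t \<le> 2 + \<bar>x j\<bar>" by simp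
      qed auto
      finally show ?thesis .
    qed
    have "opt_error z t = kink0 t + ?S - opt t"
      by (simp add: opt_error_def bias_def distrib_right sum.distrib)
    then have "\<bar>opt_error z t\<bar> \<le> kink0 t + \<bar>?S\<bar> + opt t"
      using kink0_bounds[of t] opt_nonneg[of t] by linarith
    then have "(1 + \<bar>t\<bar>) * \<bar>opt_error z t\<bar> \<le> (1 + \<bar>t\<bar>) * (kink0 t + \<bar>?S\<bar> + opt t)"
      by (intro mult_left_mono) auto
    also have "\<dots> = (1 + \<bar>t\<bar>) * kink0 t + (1 + \<bar>t\<bar>) * \<bar>?S\<bar> + (1 + \<bar>t\<bar>) * opt t"
      by (simp only: distrib_left)
    also have "\<dots> \<le> b"
      unfolding b_def by (intro add_mono k o h)
    finally have "(1 + \<bar>t\<bar>) * \<bar>opt_error z t\<bar> \<le> b" .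
    moreover have "\<bar>t ^ p\<bar> * \<bar>opt_error z t\<bar> \<le> (1 + \<bar>t\<bar>) * \<bar>opt_error z t\<bar>"
      using power_weight_le[OF p] by (intro mult_right_mono) auto
    ultimately show ?thesis
      by (simp only: abs_mult)
  qed
  then show ?thesis
    by blast
qed

text \<open>Pathwise square integrability keeps the residual times the kernel transform integrable,
  so that Plancherel applies to each realisation.\<close>

lemma opt_error_fourier_L2:
  assumes p: "p \<le> 1"
  shows "integrable lborel (\<lambda>u. (cmod (fourier (\<lambda>t. of_real (t ^ p * opt_error z t)) u))\<^sup>2)"
proof -
  let ?f = "\<lambda>t. complex_of_real (t ^ p * opt_error z t)"
  obtain b where b: "\<And>t. \<bar>t ^ p * opt_error z t\<bar> \<le> b"
    using opt_error_bounded[OF p] by blast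
  have f_meas: "?f \<in> borel_measurable borel"
    using borel_measurable_integrable[OF opt_error_int[OF p]] by simp
  have int: "integrable lborel (\<lambda>t. b * cmod (?f t))"
    by (rule integrable_mult_right, rule integrable_norm, rule opt_error_int[OF p])
  have "integrable lborel (\<lambda>t. (cmod (?f t))\<^sup>2)"
  proof (rule Bochner_Integration.integrable_bound[OF int])
    show "(\<lambda>t. (cmod (?f t))\<^sup>2) \<in> borel_measurable lborel"
      using f_meas by (intro borel_measurable_power borel_measurable_norm) simp
    show "AE t in lborel. norm ((cmod (?f t))\<^sup>2) \<le> norm (b * cmod (?f t))"
    proof (rule AE_I2)
      fix t
      have "(cmod (?f t))\<^sup>2 \<le> b * cmod (?f t)"
        unfolding power2_eq_square norm_of_real by (intro mult_right_mono b) auto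
      then show "norm ((cmod (?f t))\<^sup>2) \<le> norm (b * cmod (?f t))"
        unfolding real_norm_def abs_power2 by linarith
    qed
  qed
  then have "(\<integral>\<^sup>+ t. ennreal ((cmod (?f t))\<^sup>2) \<partial>lborel) < \<infinity>"
    unfolding integrable_iff_bounded by simp
  then have "ennreal (2 * pi) * (\<integral>\<^sup>+ t. ennreal ((cmod (?f t))\<^sup>2) \<partial>lborel) < \<infinity>"
    by (simp add: ennreal_mult_less_top)
  then have fin: "(\<integral>\<^sup>+ u. ennreal ((cmod (fourier ?f u))\<^sup>2) \<partial>lborel) < \<infinity>"
    using fourier_square_integral_le[OF opt_error_int[OF p]] by (rule le_less_trans[rotated])
  have "(\<lambda>u. (cmod (fourier ?f u))\<^sup>2) \<in> borel_measurable lborel"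
    using fourier_measurable[OF f_meas] by (intro borel_measurable_power borel_measurable_norm) simp
  then show ?thesis
    using fin by (intro integrableI_bounded) simp_all
qed

end

section \<open>Trimming and the residual of the empirical derivative\<close>

definition bias_const :: "real \<Rightarrow> real \<Rightarrow> real" where
  "bias_const R C1 = 12 + 8 * (1 + R) + 24 * (1 + R) * max 0 C1"

text \<open>The doubling comes from \<open>norm_add_square_le\<close>; \<open>64 = 2 * 32\<close>
  with the constant of \<open>hat_variance_le\<close>.\<close>

definition error_const :: "real \<Rightarrow> real \<Rightarrow> real \<Rightarrow> real" where
  "error_const R C1 C2 = 2 * (bias_const R C1)\<^sup>2 + 64 * max 0 C2"

context option_model
begin

lemma linf_nonneg: "0 \<le> linf N \<delta>"
proof -
  have "\<bar>\<delta> 1\<bar> \<le> linf N \<delta>"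
    unfolding linf_def using N2 by (intro Max_ge) auto
  then show ?thesis by linarith
qed

lemma noise_level_power2: "\<Delta> ^ 3 + \<Delta> * (linf N \<delta>)\<^sup>2 \<le> (noise_level N x \<delta>)\<^sup>2"
proof -
  have a: "(\<Delta> powr (3/2))\<^sup>2 = \<Delta> ^ 3" "(\<Delta> powr (1/2))\<^sup>2 = \<Delta>"
    using mesh_pos by (simp_all add: powr_power powr_numeral)
  have "(a + b)\<^sup>2 \<ge> a\<^sup>2 + b\<^sup>2" if "0 \<le> a" "0 \<le> b" for a b :: real
    using that by (simp add: power2_sum)
  from this[of "\<Delta> powr (3/2)" "\<Delta> powr (1/2) * linf N \<delta>"] show ?thesis
    using linf_nonneg by (simp add: noise_level_def power_mult_distrib a)
qed

lemma bias_fourier_le: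
  assumes C1: "design_range N x * exp (- design_range N x) \<le> C1 * \<Delta>\<^sup>2" and p: "p \<le> 1"
  shows "cmod (fourier (\<lambda>t. of_real (t ^ p * bias t)) u) \<le> bias_const R C1 * \<Delta>\<^sup>2"
proof -
  have c: "0 \<le> bias_const R C1 * \<Delta>\<^sup>2"
    using R_nonneg by (simp add: bias_const_def)
  have "cmod (fourier (\<lambda>t. of_real (t ^ p * bias t)) u) \<le> (LINT t|lborel. cmod (of_real (t ^ p * bias t)))"
    using bias_power_int[OF p] by (intro fourier_norm_le integrable_of_real)
  also have "\<dots> = (LINT t|lborel. \<bar>t ^ p * bias t\<bar>)"
    by (simp only: norm_of_real)
  also have "\<dots> \<le> bias_const R C1 * \<Delta>\<^sup>2"
  proof -
    have "ennreal (LINT t|lborel. \<bar>t ^ p * bias t\<bar>) = (\<integral>\<^sup>+ t. ennreal \<bar>t ^ p * bias t\<bar> \<partial>lborel)"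
      using bias_power_int[OF p] by (intro nn_integral_eq_integral[symmetric] integrable_abs) auto
    also have "\<dots> \<le> (\<integral>\<^sup>+ t. ennreal ((1 + \<bar>t\<bar>) * \<bar>bias t\<bar>) \<partial>lborel)"
      unfolding abs_mult using power_weight_le[OF p] by (intro nn_integral_mono ennreal_leI mult_right_mono) auto
    also have "\<dots> \<le> ennreal (bias_const R C1 * \<Delta>\<^sup>2)"
      unfolding bias_const_def by (rule bias_bound[OF C1])
    finally show ?thesis
      unfolding ennreal_le_iff[OF c] .
  qed
  finally show ?thesis .
qed

text \<open>\<open>32\<close> is \<open>8 * 4\<close>, from
  \<open>(2 + |x j|)\<^sup>2 \<le> 8 * (1 + (x j)\<^sup>2)\<close> and
  \<open>(2 * \<Delta>)\<^sup>2\<close>. One factor \<open>\<Delta>\<close> is spent on the assumed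
  bound for the two \<open>l2\<close> norms, the other remains.\<close>

lemma hat_variance_le:
  assumes C2: "\<Delta> * ((l2 N \<delta>)\<^sup>2 + (l2 N (\<lambda>j. x j * \<delta> j))\<^sup>2) \<le> C2 * (linf N \<delta>)\<^sup>2" and p: "p \<le> 1"
  shows "(\<Sum>j=1..N. (cmod (of_real (\<delta> j) * fourier (\<lambda>t. of_real (t ^ p * hat_fun x j t)) u))\<^sup>2) \<le> 32 * max 0 C2 * (\<Delta> * (linf N \<delta>)\<^sup>2)"
proof -
  have "(\<Sum>j=1..N. (cmod (of_real (\<delta> j) * fourier (\<lambda>t. of_real (t ^ p * hat_fun x j t)) u))\<^sup>2)
      \<le> (\<Sum>j=1..N. 32 * \<Delta>\<^sup>2 * ((\<delta> j)\<^sup>2 + (x j * \<delta> j)\<^sup>2))"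
  proof (rule sum_mono)
    fix j assume j: "j \<in> {1..N}"
    have "(cmod (fourier (\<lambda>t. of_real (t ^ p * hat_fun x j t)) u))\<^sup>2 \<le> ((2 + \<bar>x j\<bar>) * (2 * \<Delta>))\<^sup>2"
      using j p by (intro power_mono hat_fourier_le) auto
    also have "\<dots> \<le> 32 * \<Delta>\<^sup>2 * (1 + (x j)\<^sup>2)"
    proof -
      have "(2 + \<bar>x j\<bar>)\<^sup>2 \<le> 8 * (1 + (x j)\<^sup>2)"
        using sum_squares_bound[of 2 "\<bar>x j\<bar>"] by (simp add: power2_sum) (smt (verit) zero_le_power2)
      then have "(2 + \<bar>x j\<bar>)\<^sup>2 * (4 * \<Delta>\<^sup>2) \<le> 8 * (1 + (x j)\<^sup>2) * (4 * \<Delta>\<^sup>2)"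
        by (intro mult_right_mono) auto
      moreover have "((2 + \<bar>x j\<bar>) * (2 * \<Delta>))\<^sup>2 = (2 + \<bar>x j\<bar>)\<^sup>2 * (4 * \<Delta>\<^sup>2)"
        by (simp only: power_mult_distrib) simp
      moreover have "8 * (1 + (x j)\<^sup>2) * (4 * \<Delta>\<^sup>2) = 32 * \<Delta>\<^sup>2 * (1 + (x j)\<^sup>2)"
        by (simp add: algebra_simps)
      ultimately show ?thesis
        by (simp only:)
    qed
    finally have "(\<delta> j)\<^sup>2 * (cmod (fourier (\<lambda>t. of_real (t ^ p * hat_fun x j t)) u))\<^sup>2 \<le> (\<delta> j)\<^sup>2 * (32 * \<Delta>\<^sup>2 * (1 + (x j)\<^sup>2))"
      by (intro mult_left_mono) auto
    then show "(cmod (of_real (\<delta> j) * fourier (\<lambda>t. of_real (t ^ p * hat_fun x j t)) u))\<^sup>2 \<le> 32 * \<Delta>\<^sup>2 * ((\<delta> j)\<^sup>2 + (x j * \<delta> j)\<^sup>2)"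
      unfolding norm_mult power_mult_distrib norm_of_real power2_abs by (simp add: algebra_simps)
  qed
  also have "\<dots> = 32 * \<Delta> * (\<Delta> * ((l2 N \<delta>)\<^sup>2 + (l2 N (\<lambda>j. x j * \<delta> j))\<^sup>2))"
    by (simp add: l2_def sum_nonneg sum.distrib sum_distrib_left[symmetric] power2_eq_square)
  also have "\<dots> \<le> 32 * \<Delta> * (max 0 C2 * (linf N \<delta>)\<^sup>2)"
  proof (rule mult_left_mono)
    have "C2 * (linf N \<delta>)\<^sup>2 \<le> max 0 C2 * (linf N \<delta>)\<^sup>2"
      by (intro mult_right_mono) auto
    then show "\<Delta> * ((l2 N \<delta>)\<^sup>2 + (l2 N (\<lambda>j. x j * \<delta> j))\<^sup>2) \<le> max 0 C2 * (linf N \<delta>)\<^sup>2"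
      using C2 by linarith
  qed (use mesh_pos in simp)
  finally show ?thesis
    by (simp add: mult_ac)
qed

text \<open>Squared bias is of order \<open>\<Delta> ^ 4 \<le> \<Delta> ^ 3\<close>, variance of
  order \<open>\<Delta> * (linf N \<delta>)\<^sup>2\<close>; both are parts of the squared noise
  level. The bound does not depend on the frequency, so all growth in \<open>U\<close> will come
  from the weight in front.\<close>

lemma opt_error_second_moment:
  assumes C1: "design_range N x * exp (- design_range N x) \<le> C1 * \<Delta>\<^sup>2"
    and C2: "\<Delta> * ((l2 N \<delta>)\<^sup>2 + (l2 N (\<lambda>j. x j * \<delta> j))\<^sup>2) \<le> C2 * (linf N \<delta>)\<^sup>2"
    and noise: "noise M N e B" and p: "p \<le> 1"
  shows "(\<integral>\<^sup>+ \<omega>. ennreal ((cmod (fourier (\<lambda>t. of_real (t ^ p * opt_error (\<lambda>j. e j \<omega>) t)) u))\<^sup>2) \<partial>M)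
    \<le> ennreal (error_const R C1 C2 * (noise_level N x \<delta>)\<^sup>2)"
proof -
  interpret prob_space M
    using noise by (simp add: noise_def)
  have meas [measurable]: "e j \<in> borel_measurable M" if "j \<in> {1..N}" for j
    using noise that by (auto simp: noise_def indep_vars_def)
  let ?b = "fourier (\<lambda>t. complex_of_real (t ^ p * bias t)) u"
  let ?c = "\<lambda>j. of_real (\<delta> j) * fourier (\<lambda>t. complex_of_real (t ^ p * hat_fun x j t)) u"
  let ?S = "\<lambda>\<omega>. \<Sum>j=1..N. ?c j * of_real (e j \<omega>)"
  have S_meas: "(\<lambda>\<omega>. ennreal ((cmod (?S \<omega>))\<^sup>2)) \<in> borel_measurable M"
    by measurable
  have "(\<integral>\<^sup>+ \<omega>. ennreal ((cmod (fourier (\<lambda>t. of_real (t ^ p * opt_error (\<lambda>j. e j \<omega>) t)) u))\<^sup>2) \<partial>M)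
     \<le> (\<integral>\<^sup>+ \<omega>. ennreal (2 * (cmod ?b)\<^sup>2) + 2 * ennreal ((cmod (?S \<omega>))\<^sup>2) \<partial>M)"
    unfolding opt_error_fourier[OF p]
  proof (rule nn_integral_mono)
    fix \<omega>
    have "ennreal ((cmod (?b + ?S \<omega>))\<^sup>2) \<le> ennreal (2 * (cmod ?b)\<^sup>2 + 2 * (cmod (?S \<omega>))\<^sup>2)"
      by (intro ennreal_leI norm_add_square_le)
    also have "\<dots> = ennreal (2 * (cmod ?b)\<^sup>2) + 2 * ennreal ((cmod (?S \<omega>))\<^sup>2)"
      by (subst ennreal_plus) (auto simp: ennreal_mult)
    finally show "ennreal ((cmod (?b + ?S \<omega>))\<^sup>2) \<le> ennreal (2 * (cmod ?b)\<^sup>2) + 2 * ennreal ((cmod (?S \<omega>))\<^sup>2)" .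
  qed
  also have "\<dots> = ennreal (2 * (cmod ?b)\<^sup>2) + 2 * (\<integral>\<^sup>+ \<omega>. ennreal ((cmod (?S \<omega>))\<^sup>2) \<partial>M)"
    using S_meas by (simp add: nn_integral_add nn_integral_cmult emeasure_space_1)
  also have "\<dots> = ennreal (2 * (cmod ?b)\<^sup>2) + 2 * ennreal (\<Sum>j=1..N. (cmod (?c j))\<^sup>2)"
    unfolding noise_second_moment[OF noise] ..
  also have "\<dots> = ennreal (2 * (cmod ?b)\<^sup>2 + 2 * (\<Sum>j=1..N. (cmod (?c j))\<^sup>2))"
    by (subst ennreal_plus) (auto simp: ennreal_mult sum_nonneg)
  also have "\<dots> \<le> ennreal (error_const R C1 C2 * (noise_level N x \<delta>)\<^sup>2)"
  proof (rule ennreal_leI)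
    have "(cmod ?b)\<^sup>2 \<le> (bias_const R C1 * \<Delta>\<^sup>2)\<^sup>2"
      by (intro power_mono bias_fourier_le C1 p) auto
    also have "\<dots> = (bias_const R C1)\<^sup>2 * \<Delta> ^ 4"
      by (simp add: power_mult_distrib flip: power_mult)
    also have "\<dots> \<le> (bias_const R C1)\<^sup>2 * \<Delta> ^ 3"
      using mesh_pos mesh_le by (intro mult_left_mono power_decreasing) auto
    finally have 1: "2 * (cmod ?b)\<^sup>2 \<le> 2 * (bias_const R C1)\<^sup>2 * \<Delta> ^ 3"
      by simp
    have "2 * (\<Sum>j=1..N. (cmod (?c j))\<^sup>2) \<le> 2 * (32 * max 0 C2 * (\<Delta> * (linf N \<delta>)\<^sup>2))"
      by (intro mult_left_mono hat_variance_le C2 p) simp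
    then have 2: "2 * (\<Sum>j=1..N. (cmod (?c j))\<^sup>2) \<le> 64 * max 0 C2 * (\<Delta> * (linf N \<delta>)\<^sup>2)"
      by (simp only: mult.assoc[symmetric])
    have E: "0 \<le> 2 * (bias_const R C1)\<^sup>2" "0 \<le> 64 * max 0 C2"
      by auto
    have D: "0 \<le> \<Delta> ^ 3" "0 \<le> \<Delta> * (linf N \<delta>)\<^sup>2"
      using mesh_pos by auto
    have "2 * (bias_const R C1)\<^sup>2 * \<Delta> ^ 3 + 64 * max 0 C2 * (\<Delta> * (linf N \<delta>)\<^sup>2) \<le> error_const R C1 C2 * (\<Delta> ^ 3 + \<Delta> * (linf N \<delta>)\<^sup>2)"
      unfolding error_const_def distrib_left using E D by (intro add_mono mult_right_mono) auto
    also have "\<dots> \<le> error_const R C1 C2 * (noise_level N x \<delta>)\<^sup>2"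
      using E by (intro mult_left_mono noise_level_power2) (auto simp: error_const_def)
    finally show "2 * (cmod ?b)\<^sup>2 + 2 * (\<Sum>j=1..N. (cmod (?c j))\<^sup>2) \<le> error_const R C1 C2 * (noise_level N x \<delta>)\<^sup>2"
      using 1 2 by linarith
  qed
  finally show ?thesis .
qed

end

text \<open>Because the trimmed denominator is bounded below by \<open>\<kappa>\<close>, the error of the quotient is linear
  in the errors of numerator and denominator; no quadratic remainder occurs.\<close>

lemma trimmed_quotient:
  assumes \<kappa>: "0 < \<kappa>" "3 * \<kappa> \<le> cmod \<phi>" and m: "cmod m \<le> B"
  shows "cmod (D' / trim \<kappa> \<phi>' - m) \<le> (cmod (D' - \<phi> * m) + 2 * B * cmod (\<phi>' - \<phi>)) / \<kappa>"
proof -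
  have B: "0 \<le> B"
    using m norm_ge_zero order_trans by blast
  have tri: "cmod \<phi> \<le> cmod (\<phi>' - \<phi>) + cmod \<phi>'"
    using norm_triangle_sub[of \<phi> \<phi>'] by (simp add: norm_minus_commute add.commute)
  show ?thesis
  proof (cases "\<phi>' = 0")
    case True
    \<comment> \<open>Here the trimmed value is 0 and so is the quotient;
      \<open>|\<phi>' - \<phi>| = |\<phi>| \<ge> 3 * \<kappa>\<close> is large enough to pay for
      \<open>m\<close>.\<close>
    then have "trim \<kappa> \<phi>' = 0"
      by (simp add: trim_def)
    then have "cmod (D' / trim \<kappa> \<phi>' - m) \<le> B"
      using m by simp
    moreover have "\<kappa> \<le> 2 * cmod (\<phi>' - \<phi>)"
      using tri \<kappa> True by simp
    then have "B * \<kappa> \<le> 2 * B * cmod (\<phi>' - \<phi>)"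
      using mult_left_mono[OF _ B] by fastforce
    then have "B \<le> (cmod (D' - \<phi> * m) + 2 * B * cmod (\<phi>' - \<phi>)) / \<kappa>"
      using \<kappa> by (simp add: le_divide_eq add_increasing)
    ultimately show ?thesis by linarith
  next
    case False
    define v where "v = trim \<kappa> \<phi>'"
    have v: "\<kappa> \<le> cmod v"
      using False \<kappa> by (auto simp: v_def trim_def norm_mult norm_divide)
    \<comment> \<open>Trimming moves \<open>\<phi>'\<close> by at most
      \<open>\<kappa> - |\<phi>'|\<close>, which \<open>3 * \<kappa> \<le> |\<phi>|\<close> bounds
      by \<open>|\<phi>' - \<phi>|\<close>; the error of the denominator is doubled at
      worst.\<close>
    have diff: "cmod (\<phi> - v) \<le> 2 * cmod (\<phi>' - \<phi>)"
    proof (cases "\<kappa> \<le> cmod \<phi>'")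
      case True
      then show ?thesis
        by (simp add: v_def trim_def norm_minus_commute)
    next
      case 2: False
      have "v - \<phi>' = of_real (\<kappa> / cmod \<phi>' - 1) * \<phi>'"
        using 2 by (simp add: v_def trim_def algebra_simps)
      then have "cmod (v - \<phi>') = (\<kappa> / cmod \<phi>' - 1) * cmod \<phi>'"
        using 2 False by (simp only: norm_mult norm_of_real) (simp add: abs_of_nonneg)
      also have "\<dots> = \<kappa> - cmod \<phi>'"
        using False by (simp add: left_diff_distrib)
      finally have "cmod (v - \<phi>') \<le> cmod (\<phi>' - \<phi>)"
        using tri \<kappa> by linarith
      moreover have "cmod (\<phi> - v) \<le> cmod (\<phi>' - \<phi>) + cmod (v - \<phi>')"
        using norm_triangle_ineq4[of "\<phi> - \<phi>'" "v - \<phi>'"] by (simp add: norm_minus_commute)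
      ultimately show ?thesis by linarith
    qed
    have v0: "v \<noteq> 0"
      using v \<kappa> by auto
    have "D' / v - m = ((D' - \<phi> * m) + m * (\<phi> - v)) / v"
      using v0 by (simp add: field_simps)
    then have "cmod (D' / v - m) = cmod ((D' - \<phi> * m) + m * (\<phi> - v)) / cmod v"
      by (simp only: norm_divide)
    also have "\<dots> \<le> (cmod (D' - \<phi> * m) + B * (2 * cmod (\<phi>' - \<phi>))) / cmod v"
    proof (intro divide_right_mono)
      have "cmod (m * (\<phi> - v)) \<le> B * (2 * cmod (\<phi>' - \<phi>))"
        unfolding norm_mult using m diff B by (intro mult_mono) auto
      then show "cmod ((D' - \<phi> * m) + m * (\<phi> - v)) \<le> cmod (D' - \<phi> * m) + B * (2 * cmod (\<phi>' - \<phi>))"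
        using norm_triangle_ineq[of "D' - \<phi> * m" "m * (\<phi> - v)"] by linarith
    qed auto
    also have "\<dots> \<le> (cmod (D' - \<phi> * m) + B * (2 * cmod (\<phi>' - \<phi>))) / \<kappa>"
      using v v0 \<kappa> B by (intro divide_left_mono mult_pos_pos) auto
    finally show ?thesis
      by (simp add: v_def mult_ac)
  qed
qed

text \<open>Sum of the reciprocal constants of the two branches of
  \<open>trim_level\<close>.\<close>

definition trim_const :: "real \<Rightarrow> real \<Rightarrow> real \<Rightarrow> real" where
  "trim_const T R C\<phi> = 3 * exp (T * R) + 3 / C\<phi>"

text \<open>\<open>2 / T\<close> comes from the numerator; \<open>8 * R\<close> is twice the bound
  \<open>2 * T * R\<close> on the target, times the denominator error \<open>2\<close>, divided by
  \<open>T\<close>.\<close>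

definition residual_const :: "real \<Rightarrow> real \<Rightarrow> real \<Rightarrow> real" where
  "residual_const T R C\<phi> = trim_const T R C\<phi> * (2 / T + 8 * R)"

text \<open>Powers of \<open>|u|\<close> are replaced by powers of \<open>1 + u\<^sup>2\<close> to
  match the Sobolev weight of the kernel condition, at small frequencies as well.\<close>

lemma trim_level_bounds:
  assumes T: "0 < T" "0 < \<alpha>max" and C\<phi>: "0 < C\<phi>"
  shows "0 < trim_level T R \<alpha>max C\<phi> u"
    and "1 / trim_level T R \<alpha>max C\<phi> u \<le> trim_const T R C\<phi> * (1 + u\<^sup>2) powr (T * \<alpha>max / 2)"
proof -
  show "0 < trim_level T R \<alpha>max C\<phi> u"
    using C\<phi> by (auto simp: trim_level_def)
  have one: "1 \<le> (1 + u\<^sup>2) powr (T * \<alpha>max / 2)"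
    using T by (intro ge_one_powr_ge_zero) auto
  show "1 / trim_level T R \<alpha>max C\<phi> u \<le> trim_const T R C\<phi> * (1 + u\<^sup>2) powr (T * \<alpha>max / 2)"
  proof (cases "\<bar>u\<bar> < 1")
    case True
    then have "1 / trim_level T R \<alpha>max C\<phi> u = 3 * exp (T * R)"
      by (simp add: trim_level_def exp_minus field_simps)
    also have "\<dots> \<le> trim_const T R C\<phi> * 1"
      using C\<phi> by (simp add: trim_const_def)
    also have "\<dots> \<le> trim_const T R C\<phi> * (1 + u\<^sup>2) powr (T * \<alpha>max / 2)"
      using C\<phi> one by (intro mult_left_mono) (auto simp: trim_const_def)
    finally show ?thesis .
  next
    case False
    then have u2: "u\<^sup>2 = \<bar>u\<bar> powr 2"
      by simp
    have "\<bar>u\<bar> powr (T * \<alpha>max) = (u\<^sup>2) powr (T * \<alpha>max / 2)"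
      unfolding u2 powr_powr by simp
    also have "\<dots> \<le> (1 + u\<^sup>2) powr (T * \<alpha>max / 2)"
      using T by (intro powr_mono2) auto
    finally have p: "\<bar>u\<bar> powr (T * \<alpha>max) \<le> (1 + u\<^sup>2) powr (T * \<alpha>max / 2)" .
    have "1 / trim_level T R \<alpha>max C\<phi> u = 3 / C\<phi> * \<bar>u\<bar> powr (T * \<alpha>max)"
      using False C\<phi> by (simp add: trim_level_def powr_minus field_simps)
    also have "\<dots> \<le> trim_const T R C\<phi> * (1 + u\<^sup>2) powr (T * \<alpha>max / 2)"
      using C\<phi> p by (intro mult_mono) (auto simp: trim_const_def)
    finally show ?thesis .
  qed
qed

context option_model
begin

text \<open>Chosen so that \<open>- g - \<i> * d = (\<gamma> - g) + F + residual\<close> for the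
  empirical derivative \<open>d\<close> and the transform \<open>F\<close> of
  \<open>k_exp k\<close>: the drift error becomes a constant in the frequency.\<close>

definition residual :: "real \<Rightarrow> (nat \<Rightarrow> real) \<Rightarrow> real \<Rightarrow> complex" where
  "residual C\<phi> z u = - \<i> * (empirical_deriv T (trim_level T R \<alpha>max C\<phi>) (interpolant N x (\<lambda>j\<in>{1..N}. opt (x j) + \<delta> j * z j)) u
     - \<i> * (of_real \<gamma> + fourier (\<lambda>t. of_real (k_exp k t)) u))"

text \<open>Numerator and denominator of the empirical derivative deviate from their targets by at
  most \<open>1 + u\<^sup>2\<close> times the transformed errors, up to constants; dividing by the
  trimming level adds the power \<open>T * \<alpha>max / 2\<close>.\<close>

lemma residual_bound:
  assumes C\<phi>: "trim_constant T R \<alpha>max C\<phi>" and \<alpha>: "0 < \<alpha>max" and \<gamma>: "\<bar>\<gamma>\<bar> \<le> R"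
  shows "cmod (residual C\<phi> z u) \<le> residual_const T R C\<phi> * (1 + u\<^sup>2) powr (T * \<alpha>max / 2 + 1) *
    (cmod (fourier (\<lambda>t. of_real (t ^ 0 * opt_error z t)) u) + cmod (fourier (\<lambda>t. of_real (t ^ 1 * opt_error z t)) u))"
proof -
  let ?f = "interpolant N x (\<lambda>j\<in>{1..N}. opt (x j) + \<delta> j * z j)"
  let ?\<kappa> = "trim_level T R \<alpha>max C\<phi>"
  let ?F0 = "fourier (\<lambda>t. of_real (?f t)) u" and ?F1 = "fourier (\<lambda>t. of_real (t * ?f t)) u"
  let ?O0 = "fourier (\<lambda>t. of_real (opt t)) u" and ?O1 = "fourier (\<lambda>t. of_real (t * opt t)) u"
  define E0 where "E0 = fourier (\<lambda>t. of_real (t ^ 0 * opt_error z t)) u"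
  define E1 where "E1 = fourier (\<lambda>t. of_real (t ^ 1 * opt_error z t)) u"
  let ?m = "of_real T * (\<i> * (of_real \<gamma> + fourier (\<lambda>t. of_real (k_exp k t)) u))"
  let ?D' = "(\<i> - 2 * of_real u) * ?F0 - (of_real u + \<i> * of_real (u\<^sup>2)) * ?F1"
  let ?\<phi>' = "1 + \<i> * of_real u * (1 + \<i> * of_real u) * ?F0"
  have C0: "0 < C\<phi>"
    using C\<phi> by (simp add: trim_constant_def)
  have O_int: "integrable lborel (\<lambda>t. complex_of_real (opt t))" "integrable lborel (\<lambda>t. complex_of_real (t * opt t))"
    by (rule integrable_of_real[OF opt_int], rule integrable_of_real[OF x_opt_int])
  have F0: "?F0 = ?O0 + E0"
    using fourier_add[OF O_int(1) opt_error_int[of 0 z], of u] by (simp add: E0_def opt_error_eq)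
  have F1: "?F1 = ?O1 + E1"
    using fourier_add[OF O_int(2) opt_error_int[of 1 z], of u] by (simp add: E1_def opt_error_eq algebra_simps)
  have \<phi>_diff: "?\<phi>' - \<phi> u = \<i> * of_real u * (1 + \<i> * of_real u) * E0"
    unfolding option_fourier F0 by (simp add: algebra_simps)
  have D_diff: "?D' - \<phi> u * ?m = (\<i> - 2 * of_real u) * E0 - (of_real u + \<i> * of_real (u\<^sup>2)) * E1"
    unfolding option_fourier_deriv[symmetric] F0 F1 by (simp add: algebra_simps)
  have u2: "2 * \<bar>u\<bar> \<le> 1 + u\<^sup>2"
    using sum_squares_bound[of 1 "\<bar>u\<bar>"] by simp
  have quad: "\<bar>u\<bar> + u\<^sup>2 \<le> 2 * (1 + u\<^sup>2)"
    using u2 by simp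
  have \<phi>_err: "cmod (?\<phi>' - \<phi> u) \<le> 2 * (1 + u\<^sup>2) * cmod E0"
  proof -
    have "cmod (\<i> * of_real u * (1 + \<i> * of_real u)) \<le> \<bar>u\<bar> * (1 + \<bar>u\<bar>)"
      unfolding norm_mult using norm_triangle_ineq[of 1 "\<i> * of_real u"] by (intro mult_mono) (auto simp: norm_mult)
    also have "\<dots> \<le> 2 * (1 + u\<^sup>2)"
      using quad by (simp add: algebra_simps power2_eq_square)
    finally show ?thesis
      unfolding \<phi>_diff norm_mult[of _ E0] by (intro mult_right_mono) auto
  qed
  have D_err: "cmod (?D' - \<phi> u * ?m) \<le> 2 * (1 + u\<^sup>2) * (cmod E0 + cmod E1)"
  proof -
    have "cmod (\<i> - 2 * of_real u) \<le> 1 + 2 * \<bar>u\<bar>"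
      using norm_triangle_ineq4[of \<i> "2 * of_real u"] by (simp add: norm_mult)
    also have "\<dots> \<le> 2 * (1 + u\<^sup>2)"
      using u2 by simp (smt (verit) zero_le_power2)
    finally have 1: "cmod ((\<i> - 2 * of_real u) * E0) \<le> 2 * (1 + u\<^sup>2) * cmod E0"
      unfolding norm_mult by (intro mult_right_mono) auto
    have "cmod (of_real u + \<i> * of_real (u\<^sup>2)) \<le> \<bar>u\<bar> + u\<^sup>2"
      using norm_triangle_ineq[of "of_real u" "\<i> * of_real (u\<^sup>2)"] unfolding norm_mult norm_of_real by simp
    also have "\<dots> \<le> 2 * (1 + u\<^sup>2)"
      by (rule quad)
    finally have 2: "cmod ((of_real u + \<i> * of_real (u\<^sup>2)) * E1) \<le> 2 * (1 + u\<^sup>2) * cmod E1"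
      unfolding norm_mult[of _ E1] by (intro mult_right_mono) auto
    show ?thesis
      unfolding D_diff distrib_left[of "2 * (1 + u\<^sup>2)"]
      by (rule order_trans[OF norm_triangle_ineq4]) (rule add_mono[OF 1 2])
  qed
  have m_bound: "cmod ?m \<le> 2 * T * R"
  proof -
    have "cmod (of_real \<gamma> + fourier (\<lambda>t. of_real (k_exp k t)) u) \<le> R + R"
      using \<gamma> fourier_k_exp_bound[of u] by (intro order_trans[OF norm_triangle_ineq] add_mono) auto
    then have "T * cmod (of_real \<gamma> + fourier (\<lambda>t. of_real (k_exp k t)) u) \<le> T * (R + R)"
      using T_pos by (intro mult_left_mono) auto
    moreover have "cmod ?m = T * cmod (of_real \<gamma> + fourier (\<lambda>t. of_real (k_exp k t)) u)"
      using T_pos by (simp only: norm_mult norm_of_real norm_ii)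
    ultimately show ?thesis
      by simp
  qed
  have \<kappa>: "0 < ?\<kappa> u" and \<kappa>_inv: "1 / ?\<kappa> u \<le> trim_const T R C\<phi> * (1 + u\<^sup>2) powr (T * \<alpha>max / 2)"
    using trim_level_bounds[OF T_pos \<alpha> C0] by auto
  \<comment> \<open>For \<open>|u| < 1\<close> the bound on the Levy exponent is used, beyond that
    the defining property of \<open>C\<phi>\<close>.\<close>
  have \<kappa>3: "3 * ?\<kappa> u \<le> cmod (\<phi> u)"
  proof (cases "\<bar>u\<bar> < 1")
    case True
    have "T * \<bar>u\<bar> * R \<le> T * 1 * R"
      using True T_pos R_nonneg by (intro mult_right_mono mult_left_mono) auto
    then have "exp (- T * R) \<le> exp (- T * \<bar>u\<bar> * R)"
      by simp
    also have "\<dots> \<le> cmod (\<phi> u)"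
      by (rule \<phi>_lower_bound)
    finally show ?thesis
      using True by (simp add: trim_level_def)
  next
    case False
    then show ?thesis
      using C\<phi> in_class by (auto simp: trim_constant_def trim_level_def)
  qed
  define P where "P = (1 + u\<^sup>2) * (cmod E0 + cmod E1)"
  have P: "0 \<le> P"
    by (simp add: P_def)
  have "cmod (residual C\<phi> z u) = cmod (?D' / trim (?\<kappa> u) ?\<phi>' - ?m) / T"
  proof -
    have "residual C\<phi> z u = - \<i> * ((?D' / trim (?\<kappa> u) ?\<phi>' - ?m) / of_real T)"
      using T_pos by (simp add: residual_def empirical_deriv_def Let_def diff_divide_distrib)
    then show ?thesis
      using T_pos by (simp only: norm_mult norm_divide norm_of_real norm_minus_cancel norm_ii)
  qed
  also have "\<dots> \<le> (cmod (?D' - \<phi> u * ?m) + 2 * (2 * T * R) * cmod (?\<phi>' - \<phi> u)) / ?\<kappa> u / T"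
    using T_pos by (intro divide_right_mono trimmed_quotient \<kappa> \<kappa>3 m_bound) auto
  also have "\<dots> \<le> (2 * P + 2 * (2 * T * R) * (2 * P)) / ?\<kappa> u / T"
  proof (intro divide_right_mono add_mono mult_left_mono)
    show "cmod (?D' - \<phi> u * ?m) \<le> 2 * P"
      using D_err by (simp only: P_def mult.assoc)
    have "2 * (1 + u\<^sup>2) * cmod E0 \<le> 2 * (1 + u\<^sup>2) * (cmod E0 + cmod E1)"
      by (intro mult_left_mono) auto
    then show "cmod (?\<phi>' - \<phi> u) \<le> 2 * P"
      using \<phi>_err by (simp only: P_def mult.assoc)
  qed (use \<kappa> T_pos R_nonneg in auto)
  also have "\<dots> = (1 / ?\<kappa> u) * ((2 / T + 8 * R) * P)"
    using T_pos by (simp add: field_simps)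
  also have "\<dots> \<le> (trim_const T R C\<phi> * (1 + u\<^sup>2) powr (T * \<alpha>max / 2)) * ((2 / T + 8 * R) * P)"
    using T_pos R_nonneg P by (intro mult_right_mono \<kappa>_inv) auto
  also have "\<dots> = residual_const T R C\<phi> * ((1 + u\<^sup>2) powr (T * \<alpha>max / 2) * (1 + u\<^sup>2)) * (cmod E0 + cmod E1)"
    by (simp only: residual_const_def P_def mult_ac)
  also have "(1 + u\<^sup>2) powr (T * \<alpha>max / 2) * (1 + u\<^sup>2) = (1 + u\<^sup>2) powr (T * \<alpha>max / 2 + 1)"
    by (simp add: powr_add add_nonneg_nonneg abs_of_nonneg)
  finally show ?thesis
    by (simp only: E0_def E1_def)
qed

end

section \<open>Smoothness off the origin and its transfer to \<open>k_exp k\<close>\<close>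

lemma Cs_off_zero_0: "Cs_off_zero 0 f \<longleftrightarrow> continuous_on (- {0}) f"
  by (simp add: Cs_off_zero_def)

text \<open>Peels off the innermost derivative, so that inductions over \<open>s\<close> can vary
  the function.\<close>

lemma Cs_off_zero_Suc:
  "Cs_off_zero (Suc s) f \<longleftrightarrow> (\<forall>x. x \<noteq> 0 \<longrightarrow> f differentiable (at x)) \<and> Cs_off_zero s (deriv f)"
  unfolding Cs_off_zero_def
  by (auto simp: funpow_swap1 less_Suc_eq_0_disj simp del: funpow.simps) (auto simp: funpow_swap1)

lemma deriv_cong_off_zero:
  assumes "\<And>x. x \<noteq> 0 \<Longrightarrow> f x = g x" "x \<noteq> 0"
  shows "deriv f x = deriv (g :: real \<Rightarrow> real) x"
proof (rule deriv_cong_ev)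
  have "\<forall>\<^sub>F y in nhds x. y \<in> - {0}"
    using assms(2) by (intro eventually_nhds_in_open) (auto simp: open_Compl)
  then show "\<forall>\<^sub>F y in nhds x. f y = g y"
    by eventually_elim (use assms(1) in auto)
qed simp

lemma differentiable_cong_off_zero:
  fixes f g :: "real \<Rightarrow> real"
  assumes eq: "\<And>x. x \<noteq> 0 \<Longrightarrow> f x = g x" and "x \<noteq> 0" and "f differentiable (at x)"
  shows "g differentiable (at x)"
proof -
  obtain D where "(f has_derivative D) (at x)"
    using assms(3) by (auto simp: differentiable_def)
  then have "(g has_derivative D) (at x)"
    by (rule has_derivative_transform_within_open[where s = "- {0}"]) (use assms in \<open>auto simp: open_Compl\<close>)
  then show ?thesis
    by (auto simp: differentiable_def)
qed

text \<open>\<open>deriv\<close> may take an arbitrary value at the origin, so derivative formulas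
  are available only away from it.\<close>

lemma Cs_off_zero_cong:
  assumes "\<And>x. x \<noteq> 0 \<Longrightarrow> f x = g x" "Cs_off_zero s f"
  shows "Cs_off_zero s g"
  using assms
proof (induction s arbitrary: f g)
  case 0
  then show ?case
    using continuous_on_cong[of "- {0}" "- {0}" f g] by (simp add: Cs_off_zero_0)
next
  case (Suc s)
  have "Cs_off_zero s (deriv g)"
    by (rule Suc.IH[of "deriv f"]) (use Suc.prems deriv_cong_off_zero[of f g] in \<open>auto simp: Cs_off_zero_Suc\<close>)
  then show ?case
    using Suc.prems differentiable_cong_off_zero[of f g] by (auto simp: Cs_off_zero_Suc)
qed

lemma Cs_off_zero_pred: "Cs_off_zero (Suc s) f \<Longrightarrow> Cs_off_zero s f"
proof (induction s arbitrary: f)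
  case 0
  then have "f differentiable_on (- {0})"
    by (auto simp: Cs_off_zero_Suc differentiable_on_def intro: differentiable_at_withinI)
  then show ?case
    by (simp add: Cs_off_zero_0 differentiable_imp_continuous_on)
next
  case (Suc s)
  then show ?case
    by (subst Cs_off_zero_Suc) (auto simp: Cs_off_zero_Suc[of "Suc s"])
qed

lemma Cs_off_zero_add:
  assumes "Cs_off_zero s f" "Cs_off_zero s g"
  shows "Cs_off_zero s (\<lambda>x. f x + g x)"
  using assms
proof (induction s arbitrary: f g)
  case 0
  then show ?case
    by (auto simp: Cs_off_zero_0 intro: continuous_on_add)
next
  case (Suc s)
  have "Cs_off_zero s (\<lambda>x. deriv f x + deriv g x)"
    using Suc by (auto simp: Cs_off_zero_Suc)
  then have "Cs_off_zero s (deriv (\<lambda>x. f x + g x))"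
  proof (rule Cs_off_zero_cong[rotated])
    fix x :: real assume "x \<noteq> 0"
    then show "deriv f x + deriv g x = deriv (\<lambda>x. f x + g x) x"
      using Suc.prems by (subst deriv_add) (auto simp: Cs_off_zero_Suc real_differentiable_def field_differentiable_def)
  qed
  then show ?case
    using Suc.prems by (auto simp: Cs_off_zero_Suc intro: differentiable_add)
qed

text \<open>\<open>sgn\<close> is locally constant off the origin and \<open>exp\<close> reproduces
  itself, so the derivative is again of the form \<open>k_exp\<close>; this closes the induction on
  the smoothness.\<close>

lemma k_exp_deriv:
  fixes f :: "real \<Rightarrow> real"
  assumes x: "x \<noteq> 0" and f: "f differentiable (at x)"
  shows "(k_exp f has_real_derivative k_exp (\<lambda>x. f x + deriv f x) x) (at x)"
proof -
  have "(f has_real_derivative deriv f x) (at x)"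
    using f by (simp add: DERIV_deriv_iff_real_differentiable)
  then have "((\<lambda>y. sgn x * exp y * f y) has_real_derivative sgn x * exp x * f x + sgn x * exp x * deriv f x) (at x)"
    by (auto intro!: derivative_eq_intros simp: algebra_simps)
  then have "((\<lambda>y. sgn x * exp y * f y) has_real_derivative k_exp (\<lambda>x. f x + deriv f x) x) (at x)"
    by (simp add: k_exp_def distrib_left)
  then show ?thesis
  proof (rule has_field_derivative_transform_within_open)
    show "open {y. 0 < sgn x * y}"
      by (intro open_Collect_less continuous_intros)
    show "x \<in> {y. 0 < sgn x * y}"
      using x by (simp add: sgn_if)
    show "sgn x * exp y * f y = k_exp f y" if "y \<in> {y. 0 < sgn x * y}" for y
      using that by (auto simp: k_exp_def sgn_if split: if_splits)
  qed
qed

lemma Cs_off_zero_k_exp: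
  assumes "Cs_off_zero s f"
  shows "Cs_off_zero s (k_exp f)"
  using assms
proof (induction s arbitrary: f)
  case 0
  then show ?case
    unfolding Cs_off_zero_0 k_exp_def[abs_def] by (intro continuous_intros) auto
next
  case (Suc s)
  have "Cs_off_zero s (\<lambda>x. f x + deriv f x)"
    using Suc.prems Cs_off_zero_pred[OF Suc.prems] by (intro Cs_off_zero_add) (auto simp: Cs_off_zero_Suc)
  then have A: "Cs_off_zero s (k_exp (\<lambda>x. f x + deriv f x))"
    by (rule Suc.IH)
  have der: "(k_exp f has_real_derivative k_exp (\<lambda>x. f x + deriv f x) x) (at x)" if "x \<noteq> 0" for x
    using that Suc.prems by (intro k_exp_deriv) (auto simp: Cs_off_zero_Suc)
  have "Cs_off_zero s (deriv (k_exp f))"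
    by (rule Cs_off_zero_cong[OF _ A]) (use der[THEN DERIV_imp_deriv] in auto)
  then show ?case
    using der by (auto simp: Cs_off_zero_Suc real_differentiable_def)
qed

section \<open>Mean square risk\<close>

lemma Cs_off_zero_measurable:
  assumes "Cs_off_zero s f"
  shows "(deriv ^^ s) f \<in> borel_measurable borel"
proof -
  let ?g = "(deriv ^^ s) f"
  have "continuous_on (- {0}) ?g"
    using assms by (simp add: Cs_off_zero_def)
  then have [measurable]: "(\<lambda>x. indicator (- {0}) x *\<^sub>R ?g x) \<in> borel_measurable borel"
    by (rule borel_measurable_continuous_on_indicator[rotated]) simp
  have "?g = (\<lambda>x. if x = 0 then ?g 0 else indicator (- {0}) x *\<^sub>R ?g x)"
    by auto
  also have "\<dots> \<in> borel_measurable borel"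
    by measurable
  finally show ?thesis .
qed

text \<open>The sign \<open>\<sigma>\<close> lets one argument serve both half-lines.\<close>

lemma fourier_reflect:
  assumes "\<sigma> = 1 \<or> \<sigma> = -1"
  shows "fourier (\<lambda>x. f (\<sigma> * x)) u = fourier f (\<sigma> * u)"
  unfolding fourier_def using assms
  by (subst (2) lborel_integral_real_affine[where c = \<sigma> and t = 0]) auto

lemma inv_fourier_reflect:
  assumes "\<sigma> = 1 \<or> \<sigma> = -1"
  shows "inv_fourier h (\<sigma> * x) = inv_fourier (\<lambda>u. h (\<sigma> * u)) x"
  unfolding inv_fourier_def using assms
  by (subst lborel_integral_real_affine[where c = \<sigma> and t = 0]) auto

lemma nn_integral_reflect:
  fixes \<sigma> :: real
  assumes "\<sigma> = 1 \<or> \<sigma> = -1" "f \<in> borel_measurable borel"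
  shows "(\<integral>\<^sup>+x. f (\<sigma> * x) \<partial>lborel) = (\<integral>\<^sup>+x. f x \<partial>lborel)"
  using assms by (subst (2) nn_integral_real_affine[where c = \<sigma> and t = 0]) auto

text \<open>For \<open>a = T * \<alpha>max\<close> this is the squared frequency growth of the
  residual times the squared kernel transform, and at the same time the integrand of the Sobolev
  condition on the kernel.\<close>

definition spectral_weight :: "real \<Rightarrow> (real \<Rightarrow> real) \<Rightarrow> real \<Rightarrow> real \<Rightarrow> real" where
  "spectral_weight a W U u = (1 + u\<^sup>2) powr (a + 2) * (cmod (kernel_fourier W (u / U)))\<^sup>2"

lemma spectral_weight_nonneg: "0 \<le> spectral_weight a W U u"
  by (simp add: spectral_weight_def)

text \<open>Substituting \<open>u = U * v\<close> and using
  \<open>1 + (U * v)\<^sup>2 \<le> U\<^sup>2 * (1 + v\<^sup>2)\<close> for \<open>U \<ge> 1\<close>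
  gives the power \<open>2 * a + 4\<close> of \<open>U\<close>; the Jacobian adds one more.\<close>

lemma spectral_weight_scaling:
  assumes a: "0 \<le> a" and U: "1 \<le> U" and W: "W \<in> borel_measurable borel"
    and int: "integrable lborel (spectral_weight a W 1)"
  shows "(\<integral>\<^sup>+u. ennreal (spectral_weight a W U u) \<partial>lborel) \<le> ennreal (U powr (2 * a + 5) * (LINT u|lborel. spectral_weight a W 1 u))"
proof -
  have [measurable]: "kernel_fourier W \<in> borel_measurable borel"
    unfolding kernel_fourier_def using W by measurable
  have U0: "0 < U" using U by simp
  have "(\<integral>\<^sup>+u. ennreal (spectral_weight a W U u) \<partial>lborel) = ennreal U * (\<integral>\<^sup>+v. ennreal ((1 + (U * v)\<^sup>2) powr (a + 2) * (cmod (kernel_fourier W v))\<^sup>2) \<partial>lborel)"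
    unfolding spectral_weight_def using U0
    by (subst nn_integral_real_affine[where c = U and t = 0]) auto
  also have "\<dots> \<le> ennreal U * (\<integral>\<^sup>+v. ennreal (U powr (2 * a + 4)) * ennreal (spectral_weight a W 1 v) \<partial>lborel)"
  proof (intro mult_left_mono nn_integral_mono)
    fix v :: real
    have "1 \<le> U\<^sup>2"
      using U by simp
    then have "1 + (U * v)\<^sup>2 \<le> U\<^sup>2 * (1 + v\<^sup>2)"
      by (simp add: power_mult_distrib distrib_left)
    then have "(1 + (U * v)\<^sup>2) powr (a + 2) \<le> (U\<^sup>2 * (1 + v\<^sup>2)) powr (a + 2)"
      using a by (intro powr_mono2) auto
    also have "\<dots> = (U\<^sup>2) powr (a + 2) * (1 + v\<^sup>2) powr (a + 2)"
      by (rule powr_mult)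
    also have "(U\<^sup>2) powr (a + 2) = U powr (2 * a + 4)"
    proof -
      have "U\<^sup>2 = U powr 2" using U0 by simp
      then show ?thesis by (simp add: powr_powr distrib_left)
    qed
    finally have "(1 + (U * v)\<^sup>2) powr (a + 2) * (cmod (kernel_fourier W v))\<^sup>2 \<le> U powr (2 * a + 4) * (1 + v\<^sup>2) powr (a + 2) * (cmod (kernel_fourier W v))\<^sup>2"
      by (intro mult_right_mono) auto
    then show "ennreal ((1 + (U * v)\<^sup>2) powr (a + 2) * (cmod (kernel_fourier W v))\<^sup>2) \<le> ennreal (U powr (2 * a + 4)) * ennreal (spectral_weight a W 1 v)"
      unfolding spectral_weight_def by (simp add: ennreal_mult[symmetric] ennreal_leI mult.assoc)
  qed auto
  also have "\<dots> = ennreal U * (ennreal (U powr (2 * a + 4)) * (\<integral>\<^sup>+v. ennreal (spectral_weight a W 1 v) \<partial>lborel))"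
    using borel_measurable_integrable[OF int] by (subst nn_integral_cmult) auto
  also have "(\<integral>\<^sup>+v. ennreal (spectral_weight a W 1 v) \<partial>lborel) = ennreal (LINT u|lborel. spectral_weight a W 1 u)"
    using int by (intro nn_integral_eq_integral) (auto simp: spectral_weight_nonneg)
  also have "ennreal U * (ennreal (U powr (2 * a + 4)) * \<dots>) = ennreal (U * (U powr (2 * a + 4) * (LINT u|lborel. spectral_weight a W 1 u)))"
    using U0 by (simp add: ennreal_mult integral_nonneg_AE spectral_weight_nonneg)
  also have "U * (U powr (2 * a + 4) * (LINT u|lborel. spectral_weight a W 1 u)) = U powr (2 * a + 5) * (LINT u|lborel. spectral_weight a W 1 u)"
  proof -
    have "U powr (2 * a + 5) = U powr 1 * U powr (2 * a + 4)"
      by (subst powr_add[symmetric]) (simp add: add_ac)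
    then show ?thesis
      using U0 by simp
  qed
  finally show ?thesis .
qed

lemma trim_measurable [measurable]: "(\<lambda>(\<kappa>, z). trim \<kappa> z) \<in> borel_measurable (borel \<Otimes>\<^sub>M borel)"
  unfolding trim_def by measurable

lemma trim_level_measurable [measurable]: "trim_level T R \<alpha>max C\<phi> \<in> borel_measurable borel"
  unfolding trim_level_def[abs_def] by measurable

lemma empirical_deriv_measurable:
  assumes [measurable]: "\<kappa> \<in> borel_measurable borel" "f \<in> borel_measurable borel"
  shows "empirical_deriv T \<kappa> f \<in> borel_measurable borel"
  unfolding empirical_deriv_def[abs_def] Let_def by measurable

context option_model
begin

lemma interpolant_measurable: "interpolant N x v \<in> borel_measurable borel"
  unfolding interpolant_def[abs_def] by measurable

lemma residual_measurable [measurable]: "residual C\<phi> z \<in> borel_measurable borel"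
proof -
  have [measurable]: "empirical_deriv T (trim_level T R \<alpha>max C\<phi>) (interpolant N x (\<lambda>j\<in>{1..N}. opt (x j) + \<delta> j * z j)) \<in> borel_measurable borel"
    by (intro empirical_deriv_measurable interpolant_measurable trim_level_measurable)
  have [measurable]: "k_exp k \<in> borel_measurable borel"
    using borel_measurable_integrable[OF k_exp_int] by simp
  show ?thesis
    unfolding residual_def[abs_def] by measurable
qed

abbreviation E :: "nat \<Rightarrow> (nat \<Rightarrow> real) \<Rightarrow> real \<Rightarrow> real" where
  "E p z u \<equiv> (cmod (fourier (\<lambda>t. of_real (t ^ p * opt_error z t)) u))\<^sup>2"

text \<open>The first bound carries the variance. The second is linear in squared transforms and
  certifies integrability, through \<open>2 * w * c \<le> w\<^sup>2 + c\<^sup>2\<close>.\<close>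

lemma residual_kernel_pointwise:
  assumes C\<phi>: "trim_constant T R \<alpha>max C\<phi>" and \<alpha>: "0 < \<alpha>max" and \<gamma>: "\<bar>\<gamma>\<bar> \<le> R"
    and \<sigma>: "\<sigma> = 1 \<or> \<sigma> = -1"
  shows "(cmod (residual C\<phi> z (\<sigma> * u) * kernel_fourier W (u / U)))\<^sup>2 \<le>
      2 * (residual_const T R C\<phi>)\<^sup>2 * spectral_weight (T * \<alpha>max) W U u * (E 0 z (\<sigma> * u) + E 1 z (\<sigma> * u))" (is ?A)
    and "cmod (residual C\<phi> z (\<sigma> * u) * kernel_fourier W (u / U)) \<le>
      residual_const T R C\<phi> * (spectral_weight (T * \<alpha>max) W U u + (E 0 z (\<sigma> * u) + E 1 z (\<sigma> * u)))" (is ?B)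
proof -
  let ?C = "residual_const T R C\<phi>"
  let ?G = "cmod (kernel_fourier W (u / U))"
  define a where "a = cmod (fourier (\<lambda>t. of_real (t ^ 0 * opt_error z t)) (\<sigma> * u))"
  define b where "b = cmod (fourier (\<lambda>t. of_real (t ^ 1 * opt_error z t)) (\<sigma> * u))"
  define w where "w = (1 + u\<^sup>2) powr (T * \<alpha>max / 2 + 1) * ?G"
  have C: "0 \<le> ?C"
    using C\<phi> T_pos R_nonneg by (auto simp: residual_const_def trim_const_def trim_constant_def)
  have "(\<sigma> * u)\<^sup>2 = u\<^sup>2"
    using \<sigma> by auto
  then have "cmod (residual C\<phi> z (\<sigma> * u)) \<le> ?C * (1 + u\<^sup>2) powr (T * \<alpha>max / 2 + 1) * (a + b)"
    using residual_bound[OF C\<phi> \<alpha> \<gamma>, of z "\<sigma> * u"] by (simp only: a_def b_def)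
  from mult_right_mono[OF this, of ?G]
  have le: "cmod (residual C\<phi> z (\<sigma> * u) * kernel_fourier W (u / U)) \<le> ?C * (w * (a + b))"
    by (simp add: norm_mult w_def mult_ac)
  have w2: "w\<^sup>2 = spectral_weight (T * \<alpha>max) W U u"
  proof -
    have "((1 + u\<^sup>2) powr (T * \<alpha>max / 2 + 1))\<^sup>2 = (1 + u\<^sup>2) powr (T * \<alpha>max + 2)"
      by (simp add: power2_eq_square powr_add[symmetric] algebra_simps)
    then show ?thesis
      by (simp add: w_def spectral_weight_def power_mult_distrib)
  qed
  have pos: "0 \<le> w" "0 \<le> a" "0 \<le> b"
    by (simp_all add: w_def a_def b_def)
  have ab: "(a + b)\<^sup>2 \<le> 2 * (a\<^sup>2 + b\<^sup>2)"
    using sum_squares_bound[of a b] by (simp add: power2_sum)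
  have "(cmod (residual C\<phi> z (\<sigma> * u) * kernel_fourier W (u / U)))\<^sup>2 \<le> (?C * (w * (a + b)))\<^sup>2"
    by (intro power_mono le) auto
  also have "\<dots> = ?C\<^sup>2 * w\<^sup>2 * (a + b)\<^sup>2"
    by (simp add: power_mult_distrib)
  also have "\<dots> \<le> ?C\<^sup>2 * w\<^sup>2 * (2 * (a\<^sup>2 + b\<^sup>2))"
    by (intro mult_left_mono ab) auto
  also have "\<dots> = 2 * ?C\<^sup>2 * w\<^sup>2 * (a\<^sup>2 + b\<^sup>2)"
    by (simp only: mult_ac)
  finally show ?A
    unfolding w2 by (simp only: a_def b_def)
  have "w * (a + b) \<le> w\<^sup>2 + (a\<^sup>2 + b\<^sup>2)"
  proof -
    have "2 * (w * (a + b)) \<le> w\<^sup>2 + (a + b)\<^sup>2"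
      using sum_squares_bound[of w "a + b"] by (simp only: mult.assoc)
    moreover have "(a + b)\<^sup>2 \<le> 2 * a\<^sup>2 + 2 * b\<^sup>2"
      using ab by (simp only: distrib_left)
    ultimately show ?thesis
      using zero_le_power2[of w] by linarith
  qed
  then have "?C * (w * (a + b)) \<le> ?C * (w\<^sup>2 + (a\<^sup>2 + b\<^sup>2))"
    using C by (intro mult_left_mono) auto
  then show ?B
    using le unfolding w2 by (simp only: a_def b_def)
qed

text \<open>\<open>one_sided_estimate\<close> for the reflected function
  \<open>k_exp k (\<sigma> * x)\<close>, whose derivatives carry signs \<open>\<sigma> ^ l\<close>.
  The constant in the frequency domain is \<open>\<gamma> - g\<close>, so \<open>g\<close> does not
  occur on the right.\<close>

lemma one_sided_risk:
  fixes W :: "real \<Rightarrow> real"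
  assumes C\<phi>: "trim_constant T R \<alpha>max C\<phi>" and \<alpha>: "0 < \<alpha>max" and \<gamma>: "\<bar>\<gamma>\<bar> \<le> R"
    and \<sigma>: "\<sigma> = 1 \<or> \<sigma> = -1" and s: "0 < s" and U: "0 < U"
    and Cs: "Cs_off_zero s k" and L2: "L2norm ((deriv ^^ s) (k_exp k)) \<le> ennreal R"
    and W: "integrable lborel W" "\<And>x. 0 < x \<Longrightarrow> W x = 0" "(LINT x|lborel. W x) = 1"
    and moments: "\<And>l. l < s \<Longrightarrow> integrable lborel (\<lambda>x. x ^ l * W x)"
      "\<And>l. l \<in> {1..<s} \<Longrightarrow> (LINT x|lborel. x ^ l * W x) = 0"
    and m: "(\<integral>\<^sup>+y. ennreal (\<bar>y\<bar> ^ s * \<bar>W y\<bar>) \<partial>lborel) \<le> ennreal m"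
    and FW: "integrable lborel (kernel_fourier W)"
    and weight: "integrable lborel (spectral_weight (T * \<alpha>max) W U)"
  shows "(\<integral>\<^sup>+y. ennreal ((cmod (k_hat W U g (empirical_deriv T (trim_level T R \<alpha>max C\<phi>)
        (interpolant N x (\<lambda>j\<in>{1..N}. opt (x j) + \<delta> j * z j))) (\<sigma> * y) - of_real (k_exp k (\<sigma> * y))))\<^sup>2) * indicator {0<..} y \<partial>lborel)
    \<le> ennreal (2 * (m / U ^ s)\<^sup>2 * R\<^sup>2) +
      ennreal (1 / pi) * (\<integral>\<^sup>+u. ennreal ((cmod (residual C\<phi> z (\<sigma> * u) * kernel_fourier W (u / U)))\<^sup>2) \<partial>lborel)"
proof -
  let ?d = "empirical_deriv T (trim_level T R \<alpha>max C\<phi>) (interpolant N x (\<lambda>j\<in>{1..N}. opt (x j) + \<delta> j * z j))"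
  let ?g = "k_exp k"
  let ?K = "\<lambda>x. ?g (\<sigma> * x)"
  let ?D = "\<lambda>l x. \<sigma> ^ l * (deriv ^^ l) ?g (\<sigma> * x)"
  let ?r = "\<lambda>u. residual C\<phi> z (\<sigma> * u)"
  let ?q = "\<lambda>u. - of_real g - \<i> * ?d (\<sigma> * u)"
  let ?R = "\<integral>\<^sup>+u. ennreal ((cmod (?r u * kernel_fourier W (u / U)))\<^sup>2) \<partial>lborel"
  have g_Cs: "Cs_off_zero s ?g"
    by (rule Cs_off_zero_k_exp[OF Cs])
  note [measurable] = Cs_off_zero_measurable[OF g_Cs]
  have [measurable]: "W \<in> borel_measurable borel" "kernel_fourier W \<in> borel_measurable borel"
    using borel_measurable_integrable[OF W(1)] borel_measurable_integrable[OF FW] by simp_all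
  have D: "(?D l has_real_derivative ?D (Suc l) x) (at x)" if l: "l < s" and x: "0 < x" for l x
  proof -
    have "\<sigma> * x \<noteq> 0"
      using x \<sigma> by auto
    then have "((deriv ^^ l) ?g has_real_derivative (deriv ^^ Suc l) ?g (\<sigma> * x)) (at (\<sigma> * x))"
      using g_Cs l by (auto simp: Cs_off_zero_def DERIV_deriv_iff_real_differentiable)
    from DERIV_cmult[OF DERIV_chain2[where f = "(deriv ^^ l) ?g" and g = "\<lambda>x. \<sigma> * x", OF this DERIV_cmult_Id], of "\<sigma> ^ l"]
    show ?thesis
      by (simp add: mult_ac)
  qed
  have cont: "continuous_on {0<..} (?D s)"
  proof -
    have "continuous_on (- {0}) ((deriv ^^ s) ?g)"
      using g_Cs by (simp add: Cs_off_zero_def)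
    then have "continuous_on {0<..} (\<lambda>x. (deriv ^^ s) ?g (\<sigma> * x))"
      by (rule continuous_on_compose2) (use \<sigma> in \<open>auto intro!: continuous_intros\<close>)
    then show ?thesis
      by (intro continuous_intros)
  qed
  have K_int: "integrable lborel ?K"
    using lborel_integrable_real_affine[OF k_exp_int, of \<sigma> 0] \<sigma> by auto
  have E_int: "integrable lborel (\<lambda>u. E p z (\<sigma> * u))" if "p \<le> 1" for p
    using lborel_integrable_real_affine[OF opt_error_fourier_L2[OF that, of z], of \<sigma> 0] \<sigma> by auto
  have r_int: "integrable lborel (\<lambda>u. ?r u * kernel_fourier W (u / U))"
  proof (rule Bochner_Integration.integrable_bound)
    show "integrable lborel (\<lambda>u. residual_const T R C\<phi> * (spectral_weight (T * \<alpha>max) W U u + (E 0 z (\<sigma> * u) + E 1 z (\<sigma> * u))))"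
      using weight E_int[of 0] E_int[of 1] by (intro integrable_mult_right Bochner_Integration.integrable_add) auto
    show "AE u in lborel. norm (?r u * kernel_fourier W (u / U)) \<le> norm (residual_const T R C\<phi> * (spectral_weight (T * \<alpha>max) W U u + (E 0 z (\<sigma> * u) + E 1 z (\<sigma> * u))))"
      by (intro AE_I2, unfold real_norm_def, rule order_trans[OF residual_kernel_pointwise(2)[OF C\<phi> \<alpha> \<gamma> \<sigma>] abs_ge_self])
  qed measurable
  have q: "?q u = of_real (\<gamma> - g) + fourier (\<lambda>x. of_real (?K x)) u + ?r u" for u
  proof -
    have "fourier (\<lambda>x. complex_of_real (?K x)) u = fourier (\<lambda>x. of_real (?g x)) (\<sigma> * u)"
      by (rule fourier_reflect[OF \<sigma>])
    then show ?thesis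
      by (simp add: residual_def algebra_simps)
  qed
  \<comment> \<open>Reflecting \<open>x < 0\<close> also reflects the frequency, which undoes the
    minus sign in the kernel argument of \<open>k_hat\<close>.\<close>
  have hat: "k_hat W U g ?d (\<sigma> * y) = inv_fourier (\<lambda>u. ?q u * kernel_fourier W (u / U)) y" if y: "0 < y" for y
    using \<sigma>
  proof
    assume "\<sigma> = 1"
    then show ?thesis
      using y by (simp add: k_hat_def)
  next
    assume m1: "\<sigma> = -1"
    then have "k_hat W U g ?d (\<sigma> * y) = inv_fourier (\<lambda>u. (- of_real g - \<i> * ?d u) * kernel_fourier W (- u / U)) (\<sigma> * y)"
      using y by (simp add: k_hat_def)
    also have "\<dots> = inv_fourier (\<lambda>u. ?q u * kernel_fourier W (- (\<sigma> * u) / U)) y"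
      by (rule inv_fourier_reflect[OF \<sigma>])
    finally show ?thesis
      using m1 by simp
  qed
  have DL2: "(\<integral>\<^sup>+y. ennreal ((?D s y)\<^sup>2) * indicator {0<..} y \<partial>lborel) \<le> ennreal (R\<^sup>2)"
  proof -
    have "(\<integral>\<^sup>+y. ennreal ((?D s y)\<^sup>2) * indicator {0<..} y \<partial>lborel) \<le> (\<integral>\<^sup>+y. ennreal (((deriv ^^ s) ?g (\<sigma> * y))\<^sup>2) \<partial>lborel)"
    proof (intro nn_integral_mono)
      fix y
      have "(\<sigma> ^ s)\<^sup>2 = 1"
        using \<sigma> by (auto simp flip: power_mult)
      then show "ennreal ((?D s y)\<^sup>2) * indicator {0<..} y \<le> ennreal (((deriv ^^ s) ?g (\<sigma> * y))\<^sup>2)"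
        by (simp add: power_mult_distrib indicator_def)
    qed
    also have "\<dots> = (\<integral>\<^sup>+y. ennreal (((deriv ^^ s) ?g y)\<^sup>2) \<partial>lborel)"
      by (rule nn_integral_reflect[OF \<sigma>]) measurable
    also have "\<dots> = (L2norm ((deriv ^^ s) ?g))\<^sup>2"
      by (simp add: L2norm_power2)
    also have "\<dots> \<le> (ennreal R)\<^sup>2"
      by (intro power_mono L2) auto
    finally show ?thesis
      using R_nonneg by (simp add: ennreal_power)
  qed
  have "(\<integral>\<^sup>+y. ennreal ((cmod (k_hat W U g ?d (\<sigma> * y) - of_real (?K y)))\<^sup>2) * indicator {0<..} y \<partial>lborel)
     = (\<integral>\<^sup>+y. ennreal ((cmod (inv_fourier (\<lambda>u. ?q u * kernel_fourier W (u / U)) y - of_real (?K y)))\<^sup>2) * indicator {0<..} y \<partial>lborel)"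
    using hat by (intro nn_integral_cong) (auto simp: indicator_def)
  also have "\<dots> \<le> 2 * (ennreal ((m / U ^ s)\<^sup>2) * (\<integral>\<^sup>+y. ennreal ((?D s y)\<^sup>2) * indicator {0<..} y \<partial>lborel)) +
      2 * (ennreal (1 / (2 * pi)) * ?R)"
    by (rule one_sided_estimate[where K = ?K and D = ?D and r = ?r and q = ?q, OF s U D cont _ K_int W moments m FW r_int q]) auto
  also have "\<dots> \<le> 2 * (ennreal ((m / U ^ s)\<^sup>2) * ennreal (R\<^sup>2)) + 2 * (ennreal (1 / (2 * pi)) * ?R)"
    by (intro add_mono mult_left_mono DL2) auto
  also have "2 * (ennreal ((m / U ^ s)\<^sup>2) * ennreal (R\<^sup>2)) = ennreal (2 * (m / U ^ s)\<^sup>2 * R\<^sup>2)"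
    by (simp only: ennreal_numeral[symmetric] ennreal_mult[symmetric] zero_le_power2 mult_nonneg_nonneg zero_le_numeral mult.assoc)
  also have "2 * (ennreal (1 / (2 * pi)) * ?R) = ennreal (1 / pi) * ?R"
  proof -
    have "2 * ennreal (1 / (2 * pi)) = ennreal (2 * (1 / (2 * pi)))"
      by (subst ennreal_mult) auto
    then show ?thesis
      by (simp add: mult.assoc[symmetric])
  qed
  finally show ?thesis .
qed

end

lemma k_hat_measurable:
  assumes [measurable]: "d \<in> borel_measurable borel" "kernel_fourier W \<in> borel_measurable borel"
  shows "k_hat W U g d \<in> borel_measurable borel"
proof -
  have [measurable]: "inv_fourier (\<lambda>u. (- of_real g - \<i> * d u) * kernel_fourier W (u / U)) \<in> borel_measurable borel"
    "inv_fourier (\<lambda>u. (- of_real g - \<i> * d u) * kernel_fourier W (- u / U)) \<in> borel_measurable borel"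
    by (intro inv_fourier_measurable; measurable)+
  show ?thesis
    unfolding k_hat_def[abs_def] by measurable
qed

lemma nn_integral_split_reflect:
  fixes f :: "real \<Rightarrow> ennreal"
  assumes [measurable]: "f \<in> borel_measurable borel"
  shows "(\<integral>\<^sup>+y. f y \<partial>lborel) = (\<integral>\<^sup>+y. f (1 * y) * indicator {0<..} y \<partial>lborel) + (\<integral>\<^sup>+y. f (-1 * y) * indicator {0<..} y \<partial>lborel)"
proof -
  have "(\<integral>\<^sup>+y. f y \<partial>lborel) = (\<integral>\<^sup>+y. f y * indicator {0<..} y + f y * indicator {..<0} y \<partial>lborel)"
    by (rule nn_integral_cong_AE) (use AE_lborel_singleton[of "0::real"] in \<open>auto elim!: eventually_mono simp: indicator_def\<close>)
  also have "\<dots> = (\<integral>\<^sup>+y. f y * indicator {0<..} y \<partial>lborel) + (\<integral>\<^sup>+y. f y * indicator {..<0} y \<partial>lborel)"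
    by (rule nn_integral_add) measurable
  also have "(\<integral>\<^sup>+y. f y * indicator {..<0} y \<partial>lborel) = (\<integral>\<^sup>+y. f (-1 * y) * indicator {..<0} (-1 * y) \<partial>lborel)"
    by (rule nn_integral_reflect[symmetric]) auto
  finally show ?thesis
    by (simp add: indicator_def)
qed

section \<open>Consequences of the kernel conditions\<close>

lemma integrable_inverse_one_plus_square: "integrable lborel (\<lambda>u::real. inverse (1 + u\<^sup>2))"
  using integrable_inverse_1_plus_square by (simp add: set_integrable_def)

lemma kernel_facts:
  assumes ker: "kernel_cond T \<alpha>max s W" and T: "0 < T" "0 < \<alpha>max" and s: "1 \<le> s"
  shows "integrable lborel W" and "0 < x \<Longrightarrow> W x = 0" and "(LINT x|lborel. W x) = 1"
    and "l < s \<Longrightarrow> integrable lborel (\<lambda>x. x ^ l * W x)"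
    and "l \<in> {1..<s} \<Longrightarrow> (LINT x|lborel. x ^ l * W x) = 0"
    and "(\<integral>\<^sup>+y. ennreal (\<bar>y\<bar> ^ s * \<bar>W y\<bar>) \<partial>lborel) \<le> ennreal (LINT y|lborel. \<bar>y\<bar> ^ s * \<bar>W y\<bar>)"
    and "integrable lborel (kernel_fourier W)"
    and "0 < U \<Longrightarrow> integrable lborel (spectral_weight (T * \<alpha>max) W U)"
proof -
  show W: "integrable lborel W" and "(LINT x|lborel. W x) = 1"
    and "l \<in> {1..<s} \<Longrightarrow> (LINT x|lborel. x ^ l * W x) = 0"
    using ker by (simp_all add: kernel_cond_def)
  have [measurable]: "W \<in> borel_measurable borel"
    using borel_measurable_integrable[OF W] by simp
  have [measurable]: "kernel_fourier W \<in> borel_measurable borel"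
    unfolding kernel_fourier_def by measurable
  show "W x = 0" if "0 < x"
  proof (rule ccontr)
    assume "W x \<noteq> 0"
    then have "x \<in> closure {x. W x \<noteq> 0}"
      by (intro subsetD[OF closure_subset]) simp
    then show False
      using ker that by (auto simp: kernel_cond_def)
  qed
  have high: "integrable lborel (\<lambda>x. x ^ (2 * s - 1) * W x)"
    using ker by (simp add: kernel_cond_def)
  have pow: "\<bar>y\<bar> ^ l \<le> 1 + \<bar>y\<bar> ^ (2 * s - 1)" if "l \<le> 2 * s - 1" for y :: real and l
  proof (cases "\<bar>y\<bar> \<le> 1")
    case True
    then have "\<bar>y\<bar> ^ l \<le> 1"
      by (intro power_le_one) auto
    then show ?thesis
      by (simp add: add_increasing2)
  next
    case False
    then have "\<bar>y\<bar> ^ l \<le> \<bar>y\<bar> ^ (2 * s - 1)"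
      using that by (intro power_increasing) auto
    then show ?thesis by simp
  qed
  have int: "integrable lborel (\<lambda>x. x ^ l * W x)" if "l \<le> 2 * s - 1" for l
  proof (rule Bochner_Integration.integrable_bound)
    show "integrable lborel (\<lambda>x. \<bar>W x\<bar> + \<bar>x ^ (2 * s - 1) * W x\<bar>)"
      using W high by (intro Bochner_Integration.integrable_add integrable_abs)
    show "AE x in lborel. norm (x ^ l * W x) \<le> norm (\<bar>W x\<bar> + \<bar>x ^ (2 * s - 1) * W x\<bar>)"
    proof (rule AE_I2)
      fix x
      show "norm (x ^ l * W x) \<le> norm (\<bar>W x\<bar> + \<bar>x ^ (2 * s - 1) * W x\<bar>)"
        using mult_right_mono[OF pow[OF that, of x], of "\<bar>W x\<bar>"] by (simp add: abs_mult power_abs distrib_right)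
    qed
  qed measurable
  show "integrable lborel (\<lambda>x. x ^ l * W x)" if "l < s"
    using that by (intro int) simp
  have "integrable lborel (\<lambda>y. \<bar>y\<bar> ^ s * \<bar>W y\<bar>)"
    using integrable_abs[OF int[of s]] s by (simp add: abs_mult power_abs)
  then show "(\<integral>\<^sup>+y. ennreal (\<bar>y\<bar> ^ s * \<bar>W y\<bar>) \<partial>lborel) \<le> ennreal (LINT y|lborel. \<bar>y\<bar> ^ s * \<bar>W y\<bar>)"
    by (subst nn_integral_eq_integral) auto
  show weight: "integrable lborel (spectral_weight (T * \<alpha>max) W U)" if "0 < U" for U
    using ker that by (simp add: kernel_cond_def spectral_weight_def[abs_def])
  show "integrable lborel (kernel_fourier W)"
  proof (rule Bochner_Integration.integrable_bound)
    show "integrable lborel (\<lambda>u. spectral_weight (T * \<alpha>max) W 1 u + inverse (1 + u\<^sup>2))"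
      using weight[of 1] integrable_inverse_one_plus_square by simp
    show "AE u in lborel. norm (kernel_fourier W u) \<le> norm (spectral_weight (T * \<alpha>max) W 1 u + inverse (1 + u\<^sup>2))"
    proof (rule AE_I2)
      fix u :: real
      define a where "a = 1 + u\<^sup>2"
      define g where "g = cmod (kernel_fourier W u)"
      have a: "1 \<le> a" by (simp add: a_def)
      have "a powr 1 \<le> a powr (T * \<alpha>max + 2)"
        using a T by (intro powr_mono) (auto intro: add_increasing)
      then have "a * g\<^sup>2 \<le> a powr (T * \<alpha>max + 2) * g\<^sup>2"
        using a by (intro mult_right_mono) auto
      \<comment> \<open>Arithmetic-geometric mean: the Sobolev weight and the integrable
        \<open>1 / (1 + u\<^sup>2)\<close> together dominate the transform itself, so inversion
        applies to the kernel.\<close>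
      moreover have "g \<le> a * g\<^sup>2 + inverse a"
      proof -
        have "2 * (a * g) * 1 \<le> (a * g)\<^sup>2 + 1\<^sup>2"
          by (rule sum_squares_bound)
        moreover have "0 \<le> a * g"
          using a by (simp add: g_def)
        ultimately have "a * g \<le> (a * g)\<^sup>2 + 1"
          by simp
        also have "\<dots> = a * (a * g\<^sup>2 + inverse a)"
          using a by (simp add: power2_eq_square distrib_left)
        finally show ?thesis
          using a by (simp add: mult_le_cancel_left)
      qed
      ultimately have "g \<le> a powr (T * \<alpha>max + 2) * g\<^sup>2 + inverse a"
        by linarith
      then have "g \<le> spectral_weight (T * \<alpha>max) W 1 u + inverse (1 + u\<^sup>2)"
        by (simp add: spectral_weight_def a_def g_def)
      then show "norm (kernel_fourier W u) \<le> norm (spectral_weight (T * \<alpha>max) W 1 u + inverse (1 + u\<^sup>2))"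
        unfolding g_def real_norm_def by (rule order_trans[OF _ abs_ge_self])
    qed
  qed measurable
qed

section \<open>Expected risk and choice of the cut-off\<close>

context option_model
begin

text \<open>Free of the trimmed quotient: the realisation \<open>z\<close> enters only through
  squared moduli of affine functions, so measurability and expectation in the noise follow from
  \<open>opt_error_fourier\<close>.\<close>

definition residual_majorant :: "real \<Rightarrow> (real \<Rightarrow> real) \<Rightarrow> real \<Rightarrow> real \<Rightarrow> (nat \<Rightarrow> real) \<Rightarrow> ennreal" where
  "residual_majorant C\<phi> W U \<sigma> z = (\<integral>\<^sup>+u. ennreal (2 * (residual_const T R C\<phi>)\<^sup>2 * spectral_weight (T * \<alpha>max) W U u) *
    (ennreal (E 0 z (\<sigma> * u)) + ennreal (E 1 z (\<sigma> * u))) \<partial>lborel)"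

lemma residual_le_majorant:
  assumes C\<phi>: "trim_constant T R \<alpha>max C\<phi>" and \<alpha>: "0 < \<alpha>max" and \<gamma>: "\<bar>\<gamma>\<bar> \<le> R"
    and \<sigma>: "\<sigma> = 1 \<or> \<sigma> = -1"
  shows "(\<integral>\<^sup>+u. ennreal ((cmod (residual C\<phi> z (\<sigma> * u) * kernel_fourier W (u / U)))\<^sup>2) \<partial>lborel) \<le> residual_majorant C\<phi> W U \<sigma> z"
  unfolding residual_majorant_def
proof (rule nn_integral_mono)
  fix u
  let ?w = "2 * (residual_const T R C\<phi>)\<^sup>2 * spectral_weight (T * \<alpha>max) W U u"
  have "ennreal ((cmod (residual C\<phi> z (\<sigma> * u) * kernel_fourier W (u / U)))\<^sup>2) \<le> ennreal (?w * (E 0 z (\<sigma> * u) + E 1 z (\<sigma> * u)))"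
    by (intro ennreal_leI residual_kernel_pointwise(1)[OF C\<phi> \<alpha> \<gamma> \<sigma>])
  also have "\<dots> = ennreal ?w * (ennreal (E 0 z (\<sigma> * u)) + ennreal (E 1 z (\<sigma> * u)))"
    by (subst ennreal_mult) (auto simp: spectral_weight_nonneg)
  finally show "ennreal ((cmod (residual C\<phi> z (\<sigma> * u) * kernel_fourier W (u / U)))\<^sup>2) \<le> ennreal ?w * (ennreal (E 0 z (\<sigma> * u)) + ennreal (E 1 z (\<sigma> * u)))" .
qed

text \<open>Tonelli exchanges noise and frequency; the second moments, bounded uniformly in the
  frequency, come out of the integral and leave the spectral weight to be scaled. The factor
  \<open>4\<close> is the \<open>2\<close> of the majorant times the two exponents
  \<open>p\<close>.\<close>

lemma expected_majorant:
  fixes W :: "real \<Rightarrow> real"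
  assumes \<alpha>: "0 < \<alpha>max" and U: "1 \<le> U"
    and C1: "design_range N x * exp (- design_range N x) \<le> C1 * \<Delta>\<^sup>2"
    and C2: "\<Delta> * ((l2 N \<delta>)\<^sup>2 + (l2 N (\<lambda>j. x j * \<delta> j))\<^sup>2) \<le> C2 * (linf N \<delta>)\<^sup>2"
    and noise: "noise M N e B"
    and W: "integrable lborel W"
    and weight: "integrable lborel (spectral_weight (T * \<alpha>max) W 1)"
  shows "(\<lambda>\<omega>. residual_majorant C\<phi> W U \<sigma> (\<lambda>j. e j \<omega>)) \<in> borel_measurable M"
    and "(\<integral>\<^sup>+\<omega>. residual_majorant C\<phi> W U \<sigma> (\<lambda>j. e j \<omega>) \<partial>M)
    \<le> ennreal (4 * (residual_const T R C\<phi>)\<^sup>2 * error_const R C1 C2 * (LINT u|lborel. spectral_weight (T * \<alpha>max) W 1 u)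
        * ((noise_level N x \<delta>)\<^sup>2 * U powr (2 * (T * \<alpha>max) + 5)))"
proof -
  interpret prob_space M
    using noise by (simp add: noise_def)
  interpret P: pair_sigma_finite lborel M
    by unfold_locales
  have [measurable]: "e j \<in> borel_measurable M" if "j \<in> {1..N}" for j
    using noise that by (auto simp: noise_def indep_vars_def)
  have [measurable]: "W \<in> borel_measurable borel"
    using borel_measurable_integrable[OF W] by simp
  have [measurable]: "kernel_fourier W \<in> borel_measurable borel"
    unfolding kernel_fourier_def by measurable
  let ?C = "residual_const T R C\<phi>" and ?K = "error_const R C1 C2" and ?\<epsilon> = "noise_level N x \<delta>"
  let ?w = "spectral_weight (T * \<alpha>max) W U"
  let ?X = "\<lambda>p u \<omega>. ennreal (E p (\<lambda>j. e j \<omega>) (\<sigma> * u))"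
  have [measurable]: "?w \<in> borel_measurable borel"
    unfolding spectral_weight_def[abs_def] by measurable
  have K: "0 \<le> ?K"
    by (simp add: error_const_def)
  have X_meas: "(\<lambda>(u, \<omega>). ?X p u \<omega>) \<in> borel_measurable (lborel \<Otimes>\<^sub>M M)" if "p \<le> 1" for p
    unfolding opt_error_fourier[OF that] by measurable
  note [measurable] = X_meas[of 0, simplified] X_meas[of 1, simplified]
  have Y_meas: "(\<lambda>(u, \<omega>). ennreal (2 * ?C\<^sup>2 * ?w u) * (?X 0 u \<omega> + ?X 1 u \<omega>)) \<in> borel_measurable (lborel \<Otimes>\<^sub>M M)"
    using X_meas[of 0] X_meas[of 1] by measurable
  have "(\<lambda>(\<omega>, u). ennreal (2 * ?C\<^sup>2 * ?w u) * (?X 0 u \<omega> + ?X 1 u \<omega>)) \<in> borel_measurable (M \<Otimes>\<^sub>M lborel)"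
    using measurable_compose[OF measurable_pair_swap' Y_meas] by (simp add: split_beta')
  then show "(\<lambda>\<omega>. residual_majorant C\<phi> W U \<sigma> (\<lambda>j. e j \<omega>)) \<in> borel_measurable M"
    unfolding residual_majorant_def by (rule lborel.borel_measurable_nn_integral)
  have "(\<integral>\<^sup>+\<omega>. residual_majorant C\<phi> W U \<sigma> (\<lambda>j. e j \<omega>) \<partial>M) = (\<integral>\<^sup>+u. \<integral>\<^sup>+\<omega>. ennreal (2 * ?C\<^sup>2 * ?w u) * (?X 0 u \<omega> + ?X 1 u \<omega>) \<partial>M \<partial>lborel)"
    unfolding residual_majorant_def using P.Fubini'[OF Y_meas] by simp
  also have "\<dots> \<le> (\<integral>\<^sup>+u. ennreal (4 * ?C\<^sup>2 * ?K * ?\<epsilon>\<^sup>2) * ennreal (?w u) \<partial>lborel)"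
  proof (rule nn_integral_mono)
    fix u
    have Xu [measurable]: "?X p u \<in> borel_measurable M" if "p \<le> 1" for p
      unfolding opt_error_fourier[OF that] by measurable
    have "(\<integral>\<^sup>+\<omega>. ennreal (2 * ?C\<^sup>2 * ?w u) * (?X 0 u \<omega> + ?X 1 u \<omega>) \<partial>M)
       = ennreal (2 * ?C\<^sup>2 * ?w u) * ((\<integral>\<^sup>+\<omega>. ?X 0 u \<omega> \<partial>M) + (\<integral>\<^sup>+\<omega>. ?X 1 u \<omega> \<partial>M))"
      using Xu[of 0] Xu[of 1] by (simp only: nn_integral_cmult nn_integral_add borel_measurable_add le_numeral_extra zero_le)
    also have "\<dots> \<le> ennreal (2 * ?C\<^sup>2 * ?w u) * (ennreal (?K * ?\<epsilon>\<^sup>2) + ennreal (?K * ?\<epsilon>\<^sup>2))"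
      by (intro mult_left_mono add_mono opt_error_second_moment[OF C1 C2 noise]) auto
    also have "\<dots> = ennreal (2 * ?C\<^sup>2 * ?w u * (?K * ?\<epsilon>\<^sup>2 + ?K * ?\<epsilon>\<^sup>2))"
    proof -
      have "ennreal w * (ennreal a + ennreal a) = ennreal (w * (a + a))" if "0 \<le> w" "0 \<le> a" for w a
        using that by (subst ennreal_mult) (simp_all only: ennreal_plus add_nonneg_nonneg)
      then show ?thesis
        using K by (simp only: mult_nonneg_nonneg zero_le_power2 spectral_weight_nonneg zero_le_numeral)
    qed
    also have "2 * ?C\<^sup>2 * ?w u * (?K * ?\<epsilon>\<^sup>2 + ?K * ?\<epsilon>\<^sup>2) = (4 * ?C\<^sup>2 * ?K * ?\<epsilon>\<^sup>2) * ?w u"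
      by (simp add: algebra_simps)
    also have "ennreal \<dots> = ennreal (4 * ?C\<^sup>2 * ?K * ?\<epsilon>\<^sup>2) * ennreal (?w u)"
      using K by (intro ennreal_mult) (auto simp: spectral_weight_nonneg)
    finally show "(\<integral>\<^sup>+\<omega>. ennreal (2 * ?C\<^sup>2 * ?w u) * (?X 0 u \<omega> + ?X 1 u \<omega>) \<partial>M) \<le> ennreal (4 * ?C\<^sup>2 * ?K * ?\<epsilon>\<^sup>2) * ennreal (?w u)" .
  qed
  also have "\<dots> = ennreal (4 * ?C\<^sup>2 * ?K * ?\<epsilon>\<^sup>2) * (\<integral>\<^sup>+u. ennreal (?w u) \<partial>lborel)"
    by (rule nn_integral_cmult) measurable
  also have "\<dots> \<le> ennreal (4 * ?C\<^sup>2 * ?K * ?\<epsilon>\<^sup>2) * ennreal (U powr (2 * (T * \<alpha>max) + 5) * (LINT u|lborel. spectral_weight (T * \<alpha>max) W 1 u))"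
    using T_pos \<alpha> by (intro mult_left_mono spectral_weight_scaling U weight) auto
  also have "\<dots> = ennreal ((4 * ?C\<^sup>2 * ?K * ?\<epsilon>\<^sup>2) * (U powr (2 * (T * \<alpha>max) + 5) * (LINT u|lborel. spectral_weight (T * \<alpha>max) W 1 u)))"
    using K by (intro ennreal_mult[symmetric] mult_nonneg_nonneg integral_nonneg_AE) (auto simp: spectral_weight_nonneg)
  finally show "(\<integral>\<^sup>+\<omega>. residual_majorant C\<phi> W U \<sigma> (\<lambda>j. e j \<omega>) \<partial>M)
    \<le> ennreal (4 * ?C\<^sup>2 * ?K * (LINT u|lborel. spectral_weight (T * \<alpha>max) W 1 u) * (?\<epsilon>\<^sup>2 * U powr (2 * (T * \<alpha>max) + 5)))"
    by (simp only: mult_ac)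
qed

text \<open>Holds for every realisation of the noise and every value of \<open>G\<close>: the right
  side contains no trace of the drift estimate. The two half-lines double the bias constant to
  \<open>4\<close>.\<close>

lemma pathwise_risk:
  fixes W :: "real \<Rightarrow> real"
  assumes ker: "kernel_cond T \<alpha>max s W" and s: "1 \<le> s"
    and C\<phi>: "trim_constant T R \<alpha>max C\<phi>" and \<alpha>: "0 < \<alpha>max" and \<gamma>: "\<bar>\<gamma>\<bar> \<le> R" and U: "0 < U"
    and Cs: "Cs_off_zero s k" and L2: "L2norm ((deriv ^^ s) (k_exp k)) \<le> ennreal R"
  shows "(L2norm (\<lambda>y. k_estimator T (trim_level T R \<alpha>max C\<phi>) W U N x G (\<lambda>j\<in>{1..N}. opt (x j) + \<delta> j * z j) y - of_real (k_exp k y)))\<^sup>2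
    \<le> ennreal (4 * ((LINT y|lborel. \<bar>y\<bar> ^ s * \<bar>W y\<bar>) / U ^ s)\<^sup>2 * R\<^sup>2) + ennreal (1 / pi) *
      (residual_majorant C\<phi> W U 1 z + residual_majorant C\<phi> W U (-1) z)"
    (is "_ \<le> ?B + _ * (?I 1 + ?I (-1))")
proof -
  note kf = kernel_facts[OF ker T_pos \<alpha> s]
  let ?v = "\<lambda>j\<in>{1..N}. opt (x j) + \<delta> j * z j"
  let ?d = "empirical_deriv T (trim_level T R \<alpha>max C\<phi>) (interpolant N x ?v)"
  let ?h = "k_hat W U (G ?v) ?d"
  let ?m = "LINT y|lborel. \<bar>y\<bar> ^ s * \<bar>W y\<bar>"
  have [measurable]: "?h \<in> borel_measurable borel"
    using borel_measurable_integrable[OF kf(7)]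
    by (intro k_hat_measurable empirical_deriv_measurable interpolant_measurable trim_level_measurable) simp
  have [measurable]: "k_exp k \<in> borel_measurable borel"
    using borel_measurable_integrable[OF k_exp_int] by simp
  have s0: "0 < s"
    using s by simp
  have one: "(\<integral>\<^sup>+y. ennreal ((cmod (?h (\<sigma> * y) - of_real (k_exp k (\<sigma> * y))))\<^sup>2) * indicator {0<..} y \<partial>lborel)
      \<le> ennreal (2 * (?m / U ^ s)\<^sup>2 * R\<^sup>2) + ennreal (1 / pi) * ?I \<sigma>" if "\<sigma> = 1 \<or> \<sigma> = -1" for \<sigma>
  proof -
    have "(\<integral>\<^sup>+y. ennreal ((cmod (?h (\<sigma> * y) - of_real (k_exp k (\<sigma> * y))))\<^sup>2) * indicator {0<..} y \<partial>lborel)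
      \<le> ennreal (2 * (?m / U ^ s)\<^sup>2 * R\<^sup>2) + ennreal (1 / pi) * (\<integral>\<^sup>+u. ennreal ((cmod (residual C\<phi> z (\<sigma> * u) * kernel_fourier W (u / U)))\<^sup>2) \<partial>lborel)"
      by (rule one_sided_risk[OF C\<phi> \<alpha> \<gamma> that s0 U Cs L2 kf(1-7) kf(8)[OF U]])
    also have "\<dots> \<le> ennreal (2 * (?m / U ^ s)\<^sup>2 * R\<^sup>2) + ennreal (1 / pi) * ?I \<sigma>"
      by (intro add_left_mono mult_left_mono residual_le_majorant[OF C\<phi> \<alpha> \<gamma> that]) auto
    finally show ?thesis .
  qed
  have "(L2norm (\<lambda>y. k_estimator T (trim_level T R \<alpha>max C\<phi>) W U N x G ?v y - of_real (k_exp k y)))\<^sup>2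
     = (\<integral>\<^sup>+y. ennreal ((cmod (?h y - of_real (k_exp k y)))\<^sup>2) \<partial>lborel)"
    by (simp add: L2norm_power2 k_estimator_def)
  also have "\<dots> = (\<integral>\<^sup>+y. ennreal ((cmod (?h (1 * y) - of_real (k_exp k (1 * y))))\<^sup>2) * indicator {0<..} y \<partial>lborel) +
      (\<integral>\<^sup>+y. ennreal ((cmod (?h (-1 * y) - of_real (k_exp k (-1 * y))))\<^sup>2) * indicator {0<..} y \<partial>lborel)"
    by (rule nn_integral_split_reflect) measurable
  also have "\<dots> \<le> (ennreal (2 * (?m / U ^ s)\<^sup>2 * R\<^sup>2) + ennreal (1 / pi) * ?I 1) + (ennreal (2 * (?m / U ^ s)\<^sup>2 * R\<^sup>2) + ennreal (1 / pi) * ?I (-1))"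
    by (intro add_mono one) auto
  also have "\<dots> = (ennreal (2 * (?m / U ^ s)\<^sup>2 * R\<^sup>2) + ennreal (2 * (?m / U ^ s)\<^sup>2 * R\<^sup>2)) + ennreal (1 / pi) * (?I 1 + ?I (-1))"
    by (simp only: distrib_left add_ac)
  also have "ennreal (2 * (?m / U ^ s)\<^sup>2 * R\<^sup>2) + ennreal (2 * (?m / U ^ s)\<^sup>2 * R\<^sup>2) = ?B"
    by (subst ennreal_plus[symmetric]) auto
  finally show ?thesis .
qed

end

text \<open>Squared-bias constant plus variance constant; \<open>8 / pi\<close> is
  \<open>1 / pi\<close> from Plancherel times \<open>4\<close> from \<open>expected_majorant\<close>
  times two half-lines.\<close>

definition rate_const :: "real \<Rightarrow> real \<Rightarrow> real \<Rightarrow> real \<Rightarrow> real \<Rightarrow> real \<Rightarrow> nat \<Rightarrow> (real \<Rightarrow> real) \<Rightarrow> real" where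
  "rate_const T R \<alpha>max C\<phi> C1 C2 s W =
    4 * (LINT y|lborel. \<bar>y\<bar> ^ s * \<bar>W y\<bar>)\<^sup>2 * R\<^sup>2 +
    8 / pi * (residual_const T R C\<phi>)\<^sup>2 * error_const R C1 C2 * (LINT u|lborel. spectral_weight (T * \<alpha>max) W 1 u)"

lemma (in option_model) mean_square_risk:
  fixes W :: "real \<Rightarrow> real"
  assumes ker: "kernel_cond T \<alpha>max s W" and s: "1 \<le> s"
    and C\<phi>: "trim_constant T R \<alpha>max C\<phi>" and \<alpha>: "0 < \<alpha>max" and \<gamma>: "\<bar>\<gamma>\<bar> \<le> R"
    and Cs: "Cs_off_zero s k" and L2: "L2norm ((deriv ^^ s) (k_exp k)) \<le> ennreal R"
    and C1: "design_range N x * exp (- design_range N x) \<le> C1 * \<Delta>\<^sup>2"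
    and C2: "\<Delta> * ((l2 N \<delta>)\<^sup>2 + (l2 N (\<lambda>j. x j * \<delta> j))\<^sup>2) \<le> C2 * (linf N \<delta>)\<^sup>2"
    and noise: "noise M N e B" and small: "noise_level N x \<delta> \<le> 1"
  defines "q \<equiv> 2 * real s + 2 * T * \<alpha>max + 5"
  shows "(\<integral>\<^sup>+\<omega>. (L2norm (\<lambda>y. k_estimator T (trim_level T R \<alpha>max C\<phi>) W (noise_level N x \<delta> powr (- 2 / q)) N x G
        (observations T (\<gamma>, k) N x \<delta> e \<omega>) y - of_real (k_exp k y)))\<^sup>2 \<partial>M)
    \<le> ennreal (rate_const T R \<alpha>max C\<phi> C1 C2 s W * (noise_level N x \<delta> powr (2 * real s / q))\<^sup>2)"
proof -
  interpret prob_space M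
    using noise by (simp add: noise_def)
  note kf = kernel_facts[OF ker T_pos \<alpha> s]
  define \<epsilon> where "\<epsilon> = noise_level N x \<delta>"
  define U where "U = \<epsilon> powr (- 2 / q)"
  define m where "m = (LINT y|lborel. \<bar>y\<bar> ^ s * \<bar>W y\<bar>)"
  let ?C = "4 * (residual_const T R C\<phi>)\<^sup>2 * error_const R C1 C2 * (LINT u|lborel. spectral_weight (T * \<alpha>max) W 1 u)"
  let ?I = "\<lambda>\<sigma> \<omega>. residual_majorant C\<phi> W U \<sigma> (\<lambda>j. e j \<omega>)"
  have q: "0 < q"
    using T_pos \<alpha> by (auto simp: q_def intro!: add_nonneg_pos)
  have \<epsilon>: "0 < \<epsilon>"
    using mesh_pos linf_nonneg by (auto simp: \<epsilon>_def noise_level_def intro!: add_pos_nonneg)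
  \<comment> \<open>The exponent is negative and the noise level at most 1; the scaling of the
    spectral weight relies on this.\<close>
  have U: "1 \<le> U"
  proof -
    have "\<epsilon> powr 0 \<le> \<epsilon> powr (- 2 / q)"
      using \<epsilon> small q by (intro powr_mono') (auto simp: \<epsilon>_def)
    then show ?thesis
      using \<epsilon> by (simp add: U_def)
  qed
  define rate where "rate = (\<epsilon> powr (2 * real s / q))\<^sup>2"
  have rate_alt: "rate = \<epsilon> powr (4 * real s / q)"
    using \<epsilon> by (simp add: rate_def power2_eq_square flip: powr_add)
  have U_bias: "(1 / U ^ s)\<^sup>2 = rate"
  proof -
    have "U ^ s = \<epsilon> powr (- 2 / q * real s)"
      using \<epsilon> U by (simp add: U_def powr_powr flip: powr_realpow)
    then have "1 / U ^ s = \<epsilon> powr (2 * real s / q)"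
      by (simp add: powr_minus divide_inverse mult_ac)
    then show ?thesis
      by (simp add: rate_def)
  qed
  \<comment> \<open>Since \<open>2 * T * \<alpha>max + 5 = q - 2 * s\<close>, the exponent is
    \<open>2 - 2 * (q - 2 * s) / q = 4 * s / q\<close>, the same as for the squared bias.\<close>
  have U_var: "\<epsilon>\<^sup>2 * U powr (2 * (T * \<alpha>max) + 5) = rate"
  proof -
    have "\<epsilon>\<^sup>2 = \<epsilon> powr 2"
      using \<epsilon> by simp
    then have "\<epsilon>\<^sup>2 * U powr (2 * (T * \<alpha>max) + 5) = \<epsilon> powr (2 + - 2 / q * (2 * (T * \<alpha>max) + 5))"
      by (simp only: U_def powr_powr powr_add[of \<epsilon> 2])
    also have "2 + - 2 / q * (2 * (T * \<alpha>max) + 5) = 4 * real s / q"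
      using q by (simp add: field_simps) (simp add: q_def algebra_simps)
    finally show ?thesis
      by (simp only: rate_alt)
  qed
  have C0: "0 \<le> ?C"
    by (intro mult_nonneg_nonneg integral_nonneg_AE) (auto simp: error_const_def spectral_weight_nonneg)
  have I_meas: "?I \<sigma> \<in> borel_measurable M" and I: "(\<integral>\<^sup>+\<omega>. ?I \<sigma> \<omega> \<partial>M) \<le> ennreal (?C * rate)" for \<sigma>
    using expected_majorant[OF \<alpha> U C1 C2 noise kf(1) kf(8), of C\<phi> \<sigma>] unfolding \<epsilon>_def[symmetric] U_var by simp_all
  have "(\<integral>\<^sup>+\<omega>. (L2norm (\<lambda>y. k_estimator T (trim_level T R \<alpha>max C\<phi>) W U N x G
        (observations T (\<gamma>, k) N x \<delta> e \<omega>) y - of_real (k_exp k y)))\<^sup>2 \<partial>M)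
     \<le> (\<integral>\<^sup>+\<omega>. ennreal (4 * (m / U ^ s)\<^sup>2 * R\<^sup>2) + ennreal (1 / pi) * (?I 1 \<omega> + ?I (-1) \<omega>) \<partial>M)"
    unfolding observations_def m_def
    using U by (intro nn_integral_mono pathwise_risk ker s C\<phi> \<alpha> \<gamma> Cs L2) auto
  also have "\<dots> = ennreal (4 * (m / U ^ s)\<^sup>2 * R\<^sup>2) + ennreal (1 / pi) * ((\<integral>\<^sup>+\<omega>. ?I 1 \<omega> \<partial>M) + (\<integral>\<^sup>+\<omega>. ?I (-1) \<omega> \<partial>M))"
  proof -
    have "(\<integral>\<^sup>+\<omega>. c + d * (f \<omega> + g \<omega>) \<partial>M) = c + d * ((\<integral>\<^sup>+\<omega>. f \<omega> \<partial>M) + (\<integral>\<^sup>+\<omega>. g \<omega> \<partial>M))"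
      if "f \<in> borel_measurable M" "g \<in> borel_measurable M" for c d :: ennreal and f g
      using that by (simp add: nn_integral_add nn_integral_cmult emeasure_space_1)
    then show ?thesis
      using I_meas by blast
  qed
  also have "\<dots> \<le> ennreal (4 * (m / U ^ s)\<^sup>2 * R\<^sup>2) + ennreal (1 / pi) * (ennreal (?C * rate) + ennreal (?C * rate))"
    by (intro add_mono mult_left_mono I) auto
  also have "\<dots> = ennreal (4 * (m / U ^ s)\<^sup>2 * R\<^sup>2 + 1 / pi * (?C * rate + ?C * rate))"
  proof -
    have r: "0 \<le> ?C * rate"
      using C0 by (simp add: rate_def)
    have "ennreal (?C * rate) + ennreal (?C * rate) = ennreal (?C * rate + ?C * rate)"
      using r by (rule ennreal_plus[symmetric]) (rule r)
    moreover have "ennreal (1 / pi) * ennreal (?C * rate + ?C * rate) = ennreal (1 / pi * (?C * rate + ?C * rate))"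
      using r by (intro ennreal_mult[symmetric]) auto
    moreover have "0 \<le> 1 / pi * (?C * rate + ?C * rate)"
      using r by auto
    ultimately show ?thesis
      by (simp only: ennreal_plus[symmetric] zero_le_power2 mult_nonneg_nonneg zero_le_numeral)
  qed
  also have "4 * (m / U ^ s)\<^sup>2 * R\<^sup>2 + 1 / pi * (?C * rate + ?C * rate) = rate_const T R \<alpha>max C\<phi> C1 C2 s W * rate"
  proof -
    have "(m / U ^ s)\<^sup>2 = m\<^sup>2 * (1 / U ^ s)\<^sup>2"
      by (simp add: power_divide)
    then show ?thesis
      unfolding U_bias by (simp add: rate_const_def m_def field_simps)
  qed
  finally show ?thesis
    by (simp only: rate_def U_def \<epsilon>_def)
qed

theorem theorem3p4:
  fixes T R \<alpha>max C\<phi> B C1 C2 :: real and s :: nat and W :: "real \<Rightarrow> real"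
  assumes "0 < T" "1 \<le> s" "0 < R" "0 < \<alpha>max"
    and "kernel_cond T \<alpha>max s W"
    and "trim_constant T R \<alpha>max C\<phi>"
  shows "\<exists>C>0. \<exists>\<eta>>0. \<forall>N x \<delta> (M :: 'a measure) e G.
    design N x \<delta> \<longrightarrow> noise M N e B \<longrightarrow>
    mesh N x < \<eta> \<longrightarrow> 1 / \<eta> < design_range N x \<longrightarrow> noise_level N x \<delta> < \<eta> \<longrightarrow>
    design_range N x * exp (- design_range N x) \<le> C1 * (mesh N x)\<^sup>2 \<longrightarrow>
    mesh N x * ((l2 N \<delta>)\<^sup>2 + (l2 N (\<lambda>j. x j * \<delta> j))\<^sup>2) \<le> C2 * (linf N \<delta>)\<^sup>2 \<longrightarrow>
    G \<in> borel_measurable (Pi\<^sub>M {1..N} (\<lambda>_. borel)) \<longrightarrow>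
    (SUP P\<in>class_H T s R \<alpha>max. gamma_risk T P M N x \<delta> e G) < \<infinity> \<longrightarrow>
    (SUP P\<in>class_H T s R \<alpha>max.
       k_risk T P (trim_level T R \<alpha>max C\<phi>) W
         (noise_level N x \<delta> powr (- 2 / (2 * s + 2 * T * \<alpha>max + 5))) M N x \<delta> e G)
      \<le> ennreal (C * noise_level N x \<delta> powr (2 * s / (2 * s + 2 * T * \<alpha>max + 5)))"
proof -
  \<comment> \<open>The absolute value makes the root meaningful without a sign argument, the
    summand 1 makes \<open>C\<close> positive.\<close>
  define C where "C = sqrt \<bar>rate_const T R \<alpha>max C\<phi> C1 C2 s W\<bar> + 1"
  have C: "0 < C" "rate_const T R \<alpha>max C\<phi> C1 C2 s W \<le> C\<^sup>2"
  proof -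
    have "rate_const T R \<alpha>max C\<phi> C1 C2 s W \<le> (sqrt \<bar>rate_const T R \<alpha>max C\<phi> C1 C2 s W\<bar>)\<^sup>2"
      by simp
    also have "\<dots> \<le> C\<^sup>2"
      unfolding C_def by (intro power_mono) auto
    finally show "rate_const T R \<alpha>max C\<phi> C1 C2 s W \<le> C\<^sup>2" .
    show "0 < C"
      unfolding C_def by (intro add_nonneg_pos) auto
  qed
  show ?thesis
  \<comment> \<open>The threshold 1 suffices: the estimates are non-asymptotic once mesh and noise
    level are at most 1 and the design range is at least 1.\<close>
  proof (rule exI[of _ C], rule conjI, rule C(1), rule exI[of _ 1], rule conjI, rule zero_less_one, intro allI impI SUP_least)
    fix N x \<delta> and M :: "'a measure" and e G P
    assume d: "design N x \<delta>" "noise M N e B" "mesh N x < 1" "1 / 1 < design_range N x" "noise_level N x \<delta> < 1"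
      "design_range N x * exp (- design_range N x) \<le> C1 * (mesh N x)\<^sup>2"
      "mesh N x * ((l2 N \<delta>)\<^sup>2 + (l2 N (\<lambda>j. x j * \<delta> j))\<^sup>2) \<le> C2 * (linf N \<delta>)\<^sup>2"
    assume P: "P \<in> class_H T s R \<alpha>max"
    obtain \<gamma> k where Pk: "P = (\<gamma>, k)"
      by (cases P)
    have H: "(\<gamma>, k) \<in> class_G0 T R \<alpha>max" "Cs_off_zero s k" "\<bar>\<gamma>\<bar> \<le> R"
      "(\<integral>\<^sup>+ y. ennreal \<bar>y * exp y\<bar> \<partial>levy_law T (\<gamma>, k)) \<le> ennreal R"
      "L2norm ((deriv ^^ s) (k_exp k)) \<le> ennreal R"
      using P by (auto simp: class_H_def Pk)
    interpret option_model T R \<alpha>max \<gamma> k N x \<delta>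
      by unfold_locales (use assms d H in auto)
    let ?q = "2 * real s + 2 * T * \<alpha>max + 5"
    let ?\<epsilon> = "noise_level N x \<delta>"
    have "(\<integral>\<^sup>+\<omega>. (L2norm (\<lambda>y. k_estimator T (trim_level T R \<alpha>max C\<phi>) W (?\<epsilon> powr (- 2 / ?q)) N x G
        (observations T (\<gamma>, k) N x \<delta> e \<omega>) y - of_real (k_exp k y)))\<^sup>2 \<partial>M)
      \<le> ennreal (rate_const T R \<alpha>max C\<phi> C1 C2 s W * (?\<epsilon> powr (2 * real s / ?q))\<^sup>2)"
      using d(5) by (intro mean_square_risk[OF assms(5,2,6,4) H(3,2,5) d(6,7,2)]) simp
    also have "\<dots> \<le> ennreal ((C * ?\<epsilon> powr (2 * real s / ?q))\<^sup>2)"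
      unfolding power_mult_distrib by (intro ennreal_leI mult_right_mono C) auto
    finally show "k_risk T P (trim_level T R \<alpha>max C\<phi>) W (?\<epsilon> powr (- 2 / (2 * s + 2 * T * \<alpha>max + 5))) M N x \<delta> e G
      \<le> ennreal (C * ?\<epsilon> powr (2 * s / (2 * s + 2 * T * \<alpha>max + 5)))"
      unfolding k_risk_def Pk using C(1) by (subst esqrt_le_iff) auto
  qed
qed

end
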